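(* If the edge-probability $p=p(n)$ satisfies $n^{-o(1)}\le p\ll 1$, then with high probability the clique chromatic number of the binomial random graph $G_{n,p}$ satisfies $$\chi_c(G_{n,p})=\bigl(\tfrac12+o(1)\bigr)\log(n)/p.$$
   Context: $G_{n,p}$ is the binomial random graph on vertex set $\{1,\dots,n\}$, in which each pair of vertices is an edge independently with probability $p=p(n)\in(0,1)$. The clique chromatic number $\chi_c(G)$ of a graph $G$ is the smallest number of colors in a vertex coloring of $G$ so that no inclusion-maximal clique is monochromatic, where isolated vertices are ignored (i.e., only inclusion-maximal cliques with at least two vertices matter). All asymptotics are as $n\to\infty$; $f\ll g$ means $f/g\to0$; $p\ge n^{-o(1)}$ means $p\ge n^{-\gamma(n)}$ for some $\gamma(n)\to0$; $\log$ is the natural logarithm. "With high probability" means with probability tending to $1$ as $n\to\infty$. The conclusion means that there is a deterministic $\eta(n)\to0$ such that with high probability $|\chi_c(G_{n,p})\,p/\log(n)-\tfrac12|\le\eta(n)$. *)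

theory Defs
  imports "HOL-Probability.Probability"
begin

(* A simple graph (V, E): E is a set of two-element subsets of V. *)
type_synonym 'a sgraph = "'a set \<times> 'a set set"

definition vertex_pairs :: "'a set \<Rightarrow> 'a set set" where
  "vertex_pairs V = {e. e \<subseteq> V \<and> card e = 2}"

definition clique :: "'a sgraph \<Rightarrow> 'a set \<Rightarrow> bool" where
  "clique G K \<longleftrightarrow> K \<subseteq> fst G \<and> (\<forall>u\<in>K. \<forall>v\<in>K. u \<noteq> v \<longrightarrow> {u, v} \<in> snd G)"

definition maximal_clique :: "'a sgraph \<Rightarrow> 'a set \<Rightarrow> bool" where
  "maximal_clique G K \<longleftrightarrow> clique G K \<and> (\<forall>K'. clique G K' \<and> K \<subseteq> K' \<longrightarrow> K' = K)"

definition monochromatic :: "('a \<Rightarrow> nat) \<Rightarrow> 'a set \<Rightarrow> bool" where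
  "monochromatic c K \<longleftrightarrow> (\<exists>i. \<forall>v\<in>K. c v = i)"

(* Requiring card K \<ge> 2 discards the maximal cliques {v} with v isolated (and, in the graph
   without vertices, the empty clique).  It is meant for finite graphs: card is 0 on infinite sets. *)
definition clique_coloring :: "'a sgraph \<Rightarrow> nat \<Rightarrow> ('a \<Rightarrow> nat) \<Rightarrow> bool" where
  "clique_coloring G k c \<longleftrightarrow>
     c ` fst G \<subseteq> {..<k} \<and>
     (\<forall>K. maximal_clique G K \<and> card K \<ge> 2 \<longrightarrow> \<not> monochromatic c K)"

definition clique_chromatic_number :: "'a sgraph \<Rightarrow> nat" where
  "clique_chromatic_number G = (LEAST k. \<exists>c. clique_coloring G k c)"

(* The minimum above is attained: color all vertices differently. *)
lemma clique_coloring_exists: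
  assumes "finite (fst G)"
  shows "\<exists>c. clique_coloring G (card (fst G)) c"
proof -
  obtain c where c: "bij_betw c (fst G) {..<card (fst G)}"
    using assms ex_bij_betw_finite_nat[of "fst G"] by (auto simp: atLeast0LessThan)
  have "\<not> monochromatic c K" if "clique G K" "card K \<ge> 2" for K
  proof
    assume "monochromatic c K"
    then obtain i where i: "\<forall>v\<in>K. c v = i" by (auto simp: monochromatic_def)
    have "inj_on c K"
      using c that(1) by (auto simp: bij_betw_def clique_def intro: inj_on_subset)
    with i have "\<forall>u\<in>K. \<forall>v\<in>K. u = v" by (auto simp: inj_on_def)
    moreover have "finite K"
      using that(2) by (intro card_ge_0_finite) simp
    ultimately have "card K \<le> 1"
      by (simp add: card_le_Suc0_iff_eq)
    with that(2) show False by simp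
  qed
  then have "clique_coloring G (card (fst G)) c"
    using c by (auto simp: clique_coloring_def maximal_clique_def bij_betw_def)
  then show ?thesis by blast
qed

(* f e tells whether the pair e is an edge; the f e are independent Bernoulli variables.
   bernoulli_pmf q has success probability q only for 0 \<le> q \<le> 1. *)
definition gnp :: "nat \<Rightarrow> real \<Rightarrow> nat sgraph pmf" where
  "gnp n q =
     map_pmf (\<lambda>f. ({1..n}, {e \<in> vertex_pairs {1..n}. f e}))
       (Pi_pmf (vertex_pairs {1..n}) False (\<lambda>_. bernoulli_pmf q))"

end

theory Submission
  imports Defs "HOL-Real_Asymp.Real_Asymp"
begin

text \<open>
  Write x = ln n, b = - ln p and L = x / b. The hypotheses say that b and L tend to infinity.
  Three facts explain the constant 1/2. A neighbourhood N(v) contains no maximal clique, because v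
  can be added. The largest cliques in n^a random vertices have about 2 a L vertices. And a set of
  clearly fewer than L vertices has a common neighbour with high probability, whereas a typical
  clique with clearly more than L vertices has none. So a colour class is harmless if it lies in a
  neighbourhood or consists of n^(1/2 - c) random vertices, and k neighbourhoods leave about
  n (1 - p)^k vertices uncovered, which is n^(1/2) at k = x / (2 p).

  Upper bound. Fix k = (1/2 + c) x / p vertices. They give k colour classes inside neighbourhoods,
  one further class consists of the fixed vertices and the last one of the vertices that are
  adjacent to none of them. First moment computations show that the last two classes have only
  cliques with at most (1 - c/2) L vertices, and that all those can be extended
  (\<open>no_coloring_prob_le\<close>).

  Lower bound. It suffices that every colour class C without maximal clique is dominated: some
  vertex v outside C is adjacent to all but n^(1/2 + c) vertices of C. For then
  k = (1/2 - c') x / p classes, with c' much larger than c, yield k vertices such that all but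
  k n^(1/2 + c) vertices of the graph are adjacent to at least one of them. But any k vertices have
  about n^(1/2 + c') common non-neighbours (\<open>common_nonneighbour_prob\<close>).

  To see that C is dominated (\<open>colour_class_dominated\<close>), suppose that it is not, and choose a
  sequence of s, slightly more than L, disjoint parts of C, each with N vertices, N slightly more
  than n^(1/2). It is enough that most transversals of the parts have no common neighbour outside
  C: the parts have N^s transversals, and Janson's inequality is strong enough to find a clique
  among any N^s / 2 of them, simultaneously for all choices of the parts and of C. A vertex v is
  joined to all of a random transversal with probability equal to the product of its densities into
  the parts. If all these densities are at most p^(1 - d), the product is less than 1/n. The
  vertices with a larger density into a given part have total density O(L) into it, and their products are
  exponentially small in L as long as v is non-adjacent to a positive proportion of the first q
  parts. This fails for at most s - q vertices v, and as C is not dominated, the remaining s - q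
  parts can be chosen to avoid the neighbourhoods of these exceptional vertices, one part for each
  of them. That there are so few exceptional vertices, at most about 0.6 L, is a union bound in which the
  number of sets with n^(1/2) vertices, about n to the power n^(1/2) / 2, has to be counted
  accurately.
\<close>

section \<open>Random subsets of a finite set\<close>

text \<open>
  The expectation of f at a random subset of A that contains each element independently with
  probability p. As a finite sum it is defined for functions on subsets of any finite A, so that
  conditioning on part of the coordinates is a change of A.
\<close>
definition bexp :: "real \<Rightarrow> 'a set \<Rightarrow> ('a set \<Rightarrow> real) \<Rightarrow> real" where
  "bexp p A f = (\<Sum>S\<in>Pow A. p ^ card S * (1 - p) ^ card (A - S) * f S)"

definition bprob :: "real \<Rightarrow> 'a set \<Rightarrow> ('a set \<Rightarrow> bool) \<Rightarrow> real" where
  "bprob p A Q = bexp p A (\<lambda>S. of_bool (Q S))"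

lemma bexp_empty [simp]: "bexp p {} f = f {}"
  by (simp add: bexp_def)

text \<open>
  Conditioning on the coordinate e. The inductions on A below rest on this recursion.
\<close>
lemma bexp_insert:
  assumes "finite A" "e \<notin> A"
  shows "bexp p (insert e A) f = p * bexp p A (\<lambda>S. f (insert e S)) + (1 - p) * bexp p A f"
proof -
  let ?g = "\<lambda>B S. p ^ card S * (1 - p) ^ card (B - S) * f S"
  have disj: "Pow A \<inter> insert e ` Pow A = {}"
    using assms by auto
  have inj: "inj_on (insert e) (Pow A)"
    using assms by (intro inj_onI) (auto simp: insert_eq_iff)
  have "bexp p (insert e A) f
      = (\<Sum>S\<in>Pow A. ?g (insert e A) S) + (\<Sum>S\<in>Pow A. ?g (insert e A) (insert e S))"
    unfolding bexp_def Pow_insert using assms disj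
    by (subst sum.union_disjoint) (auto simp: sum.reindex[OF inj])
  also have "(\<Sum>S\<in>Pow A. ?g (insert e A) S) = (1 - p) * bexp p A f"
    unfolding bexp_def sum_distrib_left
  proof (rule sum.cong)
    fix S assume "S \<in> Pow A"
    then have "insert e A - S = insert e (A - S)" "e \<notin> A - S" "finite (A - S)"
      using assms by auto
    then show "?g (insert e A) S = (1 - p) * ?g A S" by simp
  qed simp
  also have "(\<Sum>S\<in>Pow A. ?g (insert e A) (insert e S)) = p * bexp p A (\<lambda>S. f (insert e S))"
    unfolding bexp_def sum_distrib_left
  proof (rule sum.cong)
    fix S assume "S \<in> Pow A"
    then have "insert e A - insert e S = A - S" "e \<notin> S" "finite S"
      using assms finite_subset by auto
    then show "?g (insert e A) (insert e S) = p * (p ^ card S * (1 - p) ^ card (A - S) * f (insert e S))"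
      by simp
  qed simp
  finally show ?thesis by simp
qed

lemma bexp_cong:
  assumes "\<And>S. S \<subseteq> A \<Longrightarrow> f S = g S" shows "bexp p A f = bexp p A g"
  unfolding bexp_def using assms by (intro sum.cong) auto

lemma bexp_mono:
  assumes "0 \<le> p" "p \<le> 1" "\<And>S. S \<subseteq> A \<Longrightarrow> f S \<le> g S"
  shows "bexp p A f \<le> bexp p A g"
  unfolding bexp_def using assms by (intro sum_mono mult_left_mono) auto

lemma bexp_add: "bexp p A (\<lambda>S. f S + g S) = bexp p A f + bexp p A g"
  by (simp add: bexp_def ring_distribs sum.distrib)

lemma bexp_cmult: "bexp p A (\<lambda>S. c * f S) = c * bexp p A f"
  by (simp add: bexp_def sum_distrib_left mult_ac)

lemma bexp_sum: "bexp p A (\<lambda>S. \<Sum>i\<in>I. f i S) = (\<Sum>i\<in>I. bexp p A (f i))"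
  unfolding bexp_def sum_distrib_left by (subst sum.swap) simp

lemma bexp_const: "finite A \<Longrightarrow> bexp p A (\<lambda>S. c) = c"
  by (induction A rule: finite_induct) (auto simp: bexp_insert algebra_simps)

text \<open>
  Fubini: the parts of a random subset in disjoint sets are independent.
\<close>
lemma bexp_union:
  assumes "finite A" "finite B" "A \<inter> B = {}"
  shows "bexp p (A \<union> B) f = bexp p A (\<lambda>S. bexp p B (\<lambda>T. f (S \<union> T)))"
  using assms
proof (induction A arbitrary: f rule: finite_induct)
  case (insert e A)
  then have "e \<notin> A \<union> B" "finite (A \<union> B)" by auto
  with insert show ?case
    by (simp add: bexp_insert)
qed simp

lemma bexp_pos:
  assumes "finite A" "0 < p" "p < 1" "\<And>S. S \<subseteq> A \<Longrightarrow> 0 < f S"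
  shows "0 < bexp p A f"
  unfolding bexp_def using assms by (intro sum_pos) auto

lemma bexp_nonneg:
  assumes "0 \<le> p" "p \<le> 1" "\<And>S. S \<subseteq> A \<Longrightarrow> 0 \<le> f S"
  shows "0 \<le> bexp p A f"
  unfolding bexp_def using assms by (intro sum_nonneg mult_nonneg_nonneg) auto

text \<open>
  Two decreasing functions are positively correlated. In the induction the averages over the two
  values of a new coordinate are ordered the same way for f and for g, so the covariance that the
  coordinate adds is p (1 - p) times a product of two numbers of equal sign.
\<close>
lemma harris_inequality:
  assumes "finite A" "0 \<le> p" "p \<le> 1"
    and "\<And>S T. S \<subseteq> T \<Longrightarrow> T \<subseteq> A \<Longrightarrow> f T \<le> f S"
    and "\<And>S T. S \<subseteq> T \<Longrightarrow> T \<subseteq> A \<Longrightarrow> g T \<le> g S"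
  shows "bexp p A f * bexp p A g \<le> bexp p A (\<lambda>S. f S * g S)"
  using assms
proof (induction A arbitrary: f g rule: finite_induct)
  case (insert e A)
  let ?f = "\<lambda>S. f (insert e S)" and ?g = "\<lambda>S. g (insert e S)"
  have sub: "T \<subseteq> insert e A" if "T \<subseteq> A" for T
    using that by auto
  have 1: "bexp p A f * bexp p A g \<le> bexp p A (\<lambda>S. f S * g S)"
    by (rule insert.IH) (simp_all add: insert.prems sub)
  have 2: "bexp p A ?f * bexp p A ?g \<le> bexp p A (\<lambda>S. ?f S * ?g S)"
  proof (rule insert.IH)
    fix S T assume "S \<subseteq> T" "T \<subseteq> A"
    then have "insert e S \<subseteq> insert e T" "insert e T \<subseteq> insert e A" by auto
    then show "?f T \<le> ?f S" "?g T \<le> ?g S"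
      by (simp_all add: insert.prems(3,4))
  qed (use insert.prems in auto)
  have le: "?f S \<le> f S" "?g S \<le> g S" if "S \<subseteq> A" for S
  proof -
    have "S \<subseteq> insert e S" "insert e S \<subseteq> insert e A" using that by auto
    then show "?f S \<le> f S" "?g S \<le> g S" by (simp_all add: insert.prems(3,4))
  qed
  have "bexp p A ?f \<le> bexp p A f" "bexp p A ?g \<le> bexp p A g"
    using insert.prems(1,2) le by (auto intro!: bexp_mono)
  then have "0 \<le> p * (1 - p) * ((bexp p A ?f - bexp p A f) * (bexp p A ?g - bexp p A g))"
    using insert.prems by (intro mult_nonneg_nonneg mult_nonpos_nonpos) auto
  then have "(p * bexp p A ?f + (1 - p) * bexp p A f) * (p * bexp p A ?g + (1 - p) * bexp p A g)
     \<le> p * (bexp p A ?f * bexp p A ?g) + (1 - p) * (bexp p A f * bexp p A g)"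
    by (simp add: algebra_simps)
  also have "\<dots> \<le> p * bexp p A (\<lambda>S. ?f S * ?g S) + (1 - p) * bexp p A (\<lambda>S. f S * g S)"
    using insert.prems 1 2 by (intro add_mono mult_left_mono) auto
  finally show ?case using insert by (simp add: bexp_insert)
qed simp

text \<open>
  Conditioning on T being contained in the random set.
\<close>
lemma bexp_subset_mult:
  assumes "finite A" "T \<subseteq> A"
  shows "bexp p A (\<lambda>S. of_bool (T \<subseteq> S) * f S) = p ^ card T * bexp p (A - T) (\<lambda>S. f (T \<union> S))"
proof -
  have fT: "finite T" using assms finite_subset by auto
  have "bexp p A (\<lambda>S. of_bool (T \<subseteq> S) * f S)
      = bexp p (T \<union> (A - T)) (\<lambda>S. of_bool (T \<subseteq> S) * f S)"
    using assms by (simp add: Un_absorb1)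
  also have "\<dots> = bexp p T (\<lambda>S. bexp p (A - T) (\<lambda>R. of_bool (T \<subseteq> S \<union> R) * f (S \<union> R)))"
    using assms fT by (subst bexp_union) auto
  also have "\<dots> = bexp p T (\<lambda>S. of_bool (S = T) * bexp p (A - T) (\<lambda>R. f (T \<union> R)))"
  proof (rule bexp_cong)
    fix S assume S: "S \<subseteq> T"
    have "bexp p (A - T) (\<lambda>R. of_bool (T \<subseteq> S \<union> R) * f (S \<union> R))
        = bexp p (A - T) (\<lambda>R. of_bool (S = T) * f (T \<union> R))"
      using S by (intro bexp_cong) auto
    then show "bexp p (A - T) (\<lambda>R. of_bool (T \<subseteq> S \<union> R) * f (S \<union> R))
       = of_bool (S = T) * bexp p (A - T) (\<lambda>R. f (T \<union> R))"
      by (simp add: bexp_cmult)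
  qed
  also have "\<dots> = (\<Sum>S\<in>Pow T. if S = T then p ^ card T * bexp p (A - T) (\<lambda>R. f (T \<union> R)) else 0)"
    unfolding bexp_def[of p T] by (intro sum.cong) auto
  also have "\<dots> = p ^ card T * bexp p (A - T) (\<lambda>R. f (T \<union> R))"
    using fT by (subst sum.delta) auto
  finally show ?thesis .
qed

lemma bprob_cong:
  assumes "\<And>S. S \<subseteq> A \<Longrightarrow> P S = Q S" shows "bprob p A P = bprob p A Q"
  unfolding bprob_def using assms by (intro bexp_cong) auto

lemma bprob_mono:
  assumes "0 \<le> p" "p \<le> 1" "\<And>S. S \<subseteq> A \<Longrightarrow> P S \<Longrightarrow> Q S"
  shows "bprob p A P \<le> bprob p A Q"
  unfolding bprob_def using assms by (intro bexp_mono) auto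

lemma bprob_not: "finite A \<Longrightarrow> bprob p A (\<lambda>S. \<not> Q S) = 1 - bprob p A Q"
proof -
  assume "finite A"
  then have "1 = bexp p A (\<lambda>S. of_bool (Q S) + of_bool (\<not> Q S))"
    by (subst bexp_cong[where g="\<lambda>_. 1"]) (auto simp: bexp_const)
  then show ?thesis by (simp add: bprob_def bexp_add)
qed

lemma bprob_disj:
  assumes "0 \<le> p" "p \<le> 1"
  shows "bprob p A (\<lambda>S. P S \<or> Q S) \<le> bprob p A P + bprob p A Q"
  unfolding bprob_def bexp_add[symmetric] using assms by (intro bexp_mono) auto

lemma bprob_union_bound:
  assumes "0 \<le> p" "p \<le> 1" "finite I"
  shows "bprob p A (\<lambda>S. \<exists>i\<in>I. Q i S) \<le> (\<Sum>i\<in>I. bprob p A (Q i))"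
proof -
  have "of_bool (\<exists>i\<in>I. Q i S) \<le> (\<Sum>i\<in>I. of_bool (Q i S) :: real)" for S
  proof (cases "\<exists>i\<in>I. Q i S")
    case True
    then obtain i where i: "i \<in> I" "Q i S" by auto
    then have "of_bool (Q i S) \<le> (\<Sum>i\<in>I. of_bool (Q i S) :: real)"
      using assms by (intro member_le_sum) auto
    with i True show ?thesis by simp
  qed (auto intro: sum_nonneg)
  then show ?thesis
    unfolding bprob_def bexp_sum[symmetric] using assms by (intro bexp_mono) auto
qed

lemma bprob_subset_avoid:
  assumes "finite A" "T \<subseteq> A" "T' \<subseteq> A" "T \<inter> T' = {}"
  shows "bprob p A (\<lambda>S. T \<subseteq> S \<and> S \<inter> T' = {}) = p ^ card T * (1 - p) ^ card T'"
proof -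
  have fin: "finite T'" "finite (A - T)" using assms finite_subset by auto
  have "bprob p A (\<lambda>S. T \<subseteq> S \<and> S \<inter> T' = {})
      = bexp p A (\<lambda>S. of_bool (T \<subseteq> S) * of_bool (S \<inter> T' = {}))"
    unfolding bprob_def by (intro bexp_cong) auto
  also have "\<dots> = p ^ card T * bexp p (A - T) (\<lambda>S. of_bool ((T \<union> S) \<inter> T' = {}))"
    using assms by (subst bexp_subset_mult) auto
  also have "bexp p (A - T) (\<lambda>S. of_bool ((T \<union> S) \<inter> T' = {}))
      = bexp p (T' \<union> (A - T - T')) (\<lambda>S. of_bool (S \<inter> T' = {}))"
    using assms by (intro arg_cong2[where f="bexp p"]) (auto simp: fun_eq_iff)
  also have "\<dots> = bexp p T' (\<lambda>S. bexp p (A - T - T') (\<lambda>R. of_bool (S = {})))"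
  proof (subst bexp_union)
    have "(S \<union> R) \<inter> T' = S" if "S \<subseteq> T'" "R \<subseteq> A - T - T'" for S R
      using that by auto
    then show "bexp p T' (\<lambda>S. bexp p (A - T - T') (\<lambda>R. of_bool ((S \<union> R) \<inter> T' = {})))
       = bexp p T' (\<lambda>S. bexp p (A - T - T') (\<lambda>R. of_bool (S = {})))"
      by (intro bexp_cong) auto
  qed (use fin in auto)
  also have "\<dots> = bexp p T' (\<lambda>S. of_bool (S = {}))"
    using fin by (simp add: bexp_const)
  also have "\<dots> = (\<Sum>S\<in>Pow T'. if S = {} then (1 - p) ^ card T' else 0)"
    unfolding bexp_def by (intro sum.cong) auto
  also have "\<dots> = (1 - p) ^ card T'"
    using fin by (subst sum.delta) auto
  finally show ?thesis .
qed

text \<open>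
  Events that depend on disjoint blocks of coordinates are independent.
\<close>
lemma bprob_blocks:
  assumes "finite I" "\<And>i. i \<in> I \<Longrightarrow> finite (B i)" "disjoint_family_on B I" "finite A"
    and "(\<Union>i\<in>I. B i) \<subseteq> A"
  shows "bprob p A (\<lambda>S. \<forall>i\<in>I. Q i (S \<inter> B i)) = (\<Prod>i\<in>I. bprob p (B i) (Q i))"
  using assms
proof (induction I arbitrary: A rule: finite_induct)
  case empty
  then show ?case by (simp add: bprob_def bexp_const)
next
  case (insert j I)
  have dj: "B j \<inter> B i = {}" if "i \<in> I" for i
    using insert that by (auto simp: disjoint_family_on_def)
  have "bprob p A (\<lambda>S. \<forall>i\<in>insert j I. Q i (S \<inter> B i))
      = bexp p (B j \<union> (A - B j)) (\<lambda>S. of_bool (\<forall>i\<in>insert j I. Q i (S \<inter> B i)))"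
    using insert.prems by (simp add: bprob_def Un_absorb1)
  also have "\<dots> = bexp p (B j) (\<lambda>S. bexp p (A - B j) (\<lambda>R. of_bool (\<forall>i\<in>insert j I. Q i ((S \<union> R) \<inter> B i))))"
    using insert.prems by (subst bexp_union) auto
  also have "\<dots> = bexp p (B j) (\<lambda>S. bprob p (A - B j) (\<lambda>R. \<forall>i\<in>I. Q i (R \<inter> B i)) * of_bool (Q j S))"
  proof (rule bexp_cong)
    fix S assume S: "S \<subseteq> B j"
    have "bexp p (A - B j) (\<lambda>R. of_bool (\<forall>i\<in>insert j I. Q i ((S \<union> R) \<inter> B i)))
        = bexp p (A - B j) (\<lambda>R. of_bool (Q j S) * of_bool (\<forall>i\<in>I. Q i (R \<inter> B i)))"
    proof (rule bexp_cong)
      fix R assume R: "R \<subseteq> A - B j"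
      have "(S \<union> R) \<inter> B j = S" using S R by auto
      moreover have "(S \<union> R) \<inter> B i = R \<inter> B i" if "i \<in> I" for i
        using S dj[OF that] by auto
      ultimately show "of_bool (\<forall>i\<in>insert j I. Q i ((S \<union> R) \<inter> B i))
         = of_bool (Q j S) * (of_bool (\<forall>i\<in>I. Q i (R \<inter> B i)) :: real)"
        by auto
    qed
    then show "bexp p (A - B j) (\<lambda>R. of_bool (\<forall>i\<in>insert j I. Q i ((S \<union> R) \<inter> B i)))
      = bprob p (A - B j) (\<lambda>R. \<forall>i\<in>I. Q i (R \<inter> B i)) * of_bool (Q j S)"
      by (simp add: bexp_cmult bprob_def mult.commute)
  qed
  also have "\<dots> = bprob p (A - B j) (\<lambda>R. \<forall>i\<in>I. Q i (R \<inter> B i)) * bprob p (B j) (Q j)"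
    by (simp add: bexp_cmult bprob_def)
  also have "bprob p (A - B j) (\<lambda>R. \<forall>i\<in>I. Q i (R \<inter> B i)) = (\<Prod>i\<in>I. bprob p (B i) (Q i))"
  proof (rule insert.IH)
    show "(\<Union>i\<in>I. B i) \<subseteq> A - B j"
      using insert.prems(4) dj by fast
  qed (use insert.prems in \<open>auto simp: disjoint_family_on_def\<close>)
  finally show ?case using insert.hyps by (simp add: mult.commute)
qed

lemma bexp_exp_card:
  assumes "finite A" "T \<subseteq> A"
  shows "bexp p A (\<lambda>S. exp (l * real (card (S \<inter> T)))) = (1 + p * (exp l - 1)) ^ card T"
proof -
  have fT: "finite T" using assms finite_subset by auto
  have fst: "bexp p T (\<lambda>S. exp (l * real (card (S \<inter> T)))) = (1 + p * (exp l - 1)) ^ card T"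
    using fT
  proof (induction T rule: finite_induct)
    case (insert e T)
    have "bexp p T (\<lambda>S. exp (l * real (card (insert e S \<inter> insert e T))))
       = bexp p T (\<lambda>S. exp l * exp (l * real (card (S \<inter> T))))"
    proof (rule bexp_cong)
      fix S assume "S \<subseteq> T"
      then have "insert e S \<inter> insert e T = insert e (S \<inter> T)" "e \<notin> S \<inter> T" "finite (S \<inter> T)"
        using insert by auto
      then show "exp (l * real (card (insert e S \<inter> insert e T))) = exp l * exp (l * real (card (S \<inter> T)))"
        by (simp add: ring_distribs exp_add)
    qed
    moreover have "bexp p T (\<lambda>S. exp (l * real (card (S \<inter> insert e T))))
       = bexp p T (\<lambda>S. exp (l * real (card (S \<inter> T))))"
      using insert by (intro bexp_cong) (auto intro!: arg_cong[where f=card])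
    ultimately show ?case
      using insert by (simp add: bexp_insert bexp_cmult algebra_simps)
  qed simp
  have "bexp p A (\<lambda>S. exp (l * real (card (S \<inter> T))))
      = bexp p (T \<union> (A - T)) (\<lambda>S. exp (l * real (card (S \<inter> T))))"
    using assms by (simp add: Un_absorb1)
  also have "\<dots> = bexp p T (\<lambda>S. bexp p (A - T) (\<lambda>R. exp (l * real (card (S \<inter> T)))))"
    using assms fT by (subst bexp_union)
      (auto intro!: bexp_cong arg_cong[where f=card])
  also have "\<dots> = (1 + p * (exp l - 1)) ^ card T"
    using assms fst by (simp add: bexp_const)
  finally show ?thesis .
qed

text \<open>
  Markov's inequality for the exponential moment. The parameter l stays free, because it is tuned
  to very different densities below.
\<close>
lemma chernoff_upper:
  assumes "finite A" "T \<subseteq> A" "0 \<le> p" "p \<le> 1" "0 \<le> l"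
  shows "bprob p A (\<lambda>S. z \<le> real (card (S \<inter> T))) \<le> exp (p * exp l * real (card T) - l * z)"
proof -
  have "bprob p A (\<lambda>S. z \<le> real (card (S \<inter> T)))
      \<le> bexp p A (\<lambda>S. exp (- l * z) * exp (l * real (card (S \<inter> T))))"
    unfolding bprob_def
    using assms by (intro bexp_mono) (auto simp: of_bool_def mult_exp_exp mult_left_mono)
  also have "\<dots> = exp (- l * z) * (1 + p * (exp l - 1)) ^ card T"
    using assms by (simp add: bexp_cmult bexp_exp_card)
  also have "(1 + p * (exp l - 1)) ^ card T \<le> exp (p * exp l) ^ card T"
  proof (rule power_mono)
    have "1 + p * (exp l - 1) \<le> 1 + p * exp l" using assms by (simp add: algebra_simps)
    also have "\<dots> \<le> exp (p * exp l)" by (rule exp_ge_add_one_self)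
    finally show "1 + p * (exp l - 1) \<le> exp (p * exp l)" .
    show "0 \<le> 1 + p * (exp l - 1)" using assms by simp
  qed
  also have "exp (- l * z) * exp (p * exp l) ^ card T = exp (p * exp l * real (card T) - l * z)"
    by (simp add: exp_of_nat_mult[symmetric] mult_exp_exp algebra_simps)
  finally show ?thesis by simp
qed

lemma bprob_Pi_pmf:
  assumes "finite A" "0 \<le> p" "p \<le> 1"
  shows "measure_pmf.prob (Pi_pmf A False (\<lambda>_. bernoulli_pmf p)) {f. Q {e \<in> A. f e}} = bprob p A Q"
proof -
  let ?M = "Pi_pmf A False (\<lambda>_. bernoulli_pmf p)"
  let ?h = "\<lambda>S e. e \<in> S"
  let ?F = "?h ` {S \<in> Pow A. Q S}"
  have sup: "f \<in> ?F" if "f \<in> set_pmf ?M" "Q {e \<in> A. f e}" for f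
  proof -
    have "f x = False" if "x \<notin> A" for x
      using \<open>f \<in> set_pmf ?M\<close> that set_Pi_pmf_subset[OF assms(1), of False "\<lambda>_. bernoulli_pmf p"] by auto
    then have "f = ?h {e \<in> A. f e}" by blast
    with that(2) show ?thesis by (intro image_eqI[where x="{e \<in> A. f e}"]) (assumption, blast)
  qed
  have "measure_pmf.prob ?M {f. Q {e \<in> A. f e}} = measure_pmf.prob ?M ?F"
  proof (rule measure_pmf.finite_measure_eq_AE)
    have "Q {e \<in> A. e \<in> S}" if "S \<subseteq> A" "Q S" for S
    proof -
      have "{e \<in> A. e \<in> S} = S" using that by auto
      then show ?thesis using that by simp
    qed
    then show "AE f in measure_pmf ?M. (f \<in> {f. Q {e \<in> A. f e}}) = (f \<in> ?F)"
      by (subst AE_measure_pmf_iff) (use sup in auto)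
  qed auto
  also have "\<dots> = (\<Sum>f\<in>?F. pmf ?M f)"
    using assms by (intro measure_measure_pmf_finite) auto
  also have "\<dots> = (\<Sum>S\<in>{S \<in> Pow A. Q S}. pmf ?M (?h S))"
    by (subst sum.reindex) (auto intro!: inj_onI simp: fun_eq_iff)
  also have "\<dots> = (\<Sum>S\<in>{S \<in> Pow A. Q S}. p ^ card S * (1 - p) ^ card (A - S))"
  proof (rule sum.cong)
    fix S assume S: "S \<in> {S \<in> Pow A. Q S}"
    then have "pmf ?M (?h S) = (\<Prod>x\<in>A. pmf (bernoulli_pmf p) (x \<in> S))"
      using assms by (subst pmf_Pi) auto
    also have "\<dots> = (\<Prod>x\<in>A. if x \<in> S then p else 1 - p)"
      using assms by (intro prod.cong) auto
    also have "\<dots> = p ^ card S * (1 - p) ^ card (A - S)"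
      using S assms by (subst prod.If_cases) (auto simp: Int_absorb1 Diff_eq)
    finally show "pmf ?M (?h S) = p ^ card S * (1 - p) ^ card (A - S)" .
  qed simp
  also have "\<dots> = bprob p A Q"
    unfolding bprob_def bexp_def using assms
    by (intro sum.mono_neutral_cong_left) auto
  finally show ?thesis .
qed

lemma finite_vertex_pairs [simp]: "finite V \<Longrightarrow> finite (vertex_pairs V)"
  unfolding vertex_pairs_def by (rule finite_subset[of _ "Pow V"]) auto

lemma gnp_prob:
  assumes "0 \<le> p" "p \<le> 1"
  shows "measure_pmf.prob (gnp n p) {G. Q G} = bprob p (vertex_pairs {1..n}) (\<lambda>S. Q ({1..n}, S))"
  unfolding gnp_def measure_map_pmf
  using bprob_Pi_pmf[of "vertex_pairs {1..n}" p "\<lambda>S. Q ({1..n}, S)"] assms by (simp add: vimage_def)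

section \<open>Janson's inequality\<close>

text \<open>
  One term of the derivative estimate behind Janson's inequality, which is about X = number of i
  with E i contained in the random set. Given that E k is contained in it, the sets that meet E k
  contribute a factor exp (- l Y) and the others a factor exp (- l Z). Both are decreasing in the
  remaining coordinates, hence positively correlated. The first factor is at least 1 - l Y, and
  the second does not depend on the condition and has expectation at least that of exp (- l X).
\<close>
lemma bexp_exp_cond_lower:
  fixes E :: "'i \<Rightarrow> 'a set"
  assumes "finite A" "0 \<le> p" "p \<le> 1" "finite I" "\<And>i. i \<in> I \<Longrightarrow> E i \<subseteq> A" "0 \<le> l" "k \<in> I"
  defines "X \<equiv> (\<lambda>S. \<Sum>i\<in>I. of_bool (E i \<subseteq> S) :: real)"
  shows "bexp p A (\<lambda>S. of_bool (E k \<subseteq> S) * exp (- l * X S))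
     \<ge> (p ^ card (E k) - l * (\<Sum>i\<in>{i\<in>I. E i \<inter> E k \<noteq> {}}. p ^ card (E i \<union> E k)))
         * bexp p A (\<lambda>S. exp (- l * X S))"
proof -
  let ?N = "{i\<in>I. E i \<inter> E k \<noteq> {}}" and ?M = "{i\<in>I. E i \<inter> E k = {}}"
  define Y where "Y S = (\<Sum>i\<in>?N. of_bool (E i \<subseteq> S) :: real)" for S
  define Z where "Z S = (\<Sum>i\<in>?M. of_bool (E i \<subseteq> S) :: real)" for S
  let ?K = "E k" and ?B = "A - E k"
  have XYZ: "X S = Y S + Z S" for S
  proof -
    have "I = ?N \<union> ?M" by auto
    then have "X S = (\<Sum>i\<in>?N \<union> ?M. of_bool (E i \<subseteq> S))" by (simp add: X_def)
    also have "\<dots> = Y S + Z S"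
      unfolding Y_def Z_def using assms(4) by (intro sum.union_disjoint) auto
    finally show ?thesis .
  qed
  have finB: "finite ?B" and KA: "?K \<subseteq> A"
    using assms(1-7) by auto
  then have finK: "finite ?K"
    using assms(1) finite_subset by blast
  have Zeq: "Z (?K \<union> S) = Z (S - ?K)" and Zeq2: "Z S = Z (S - ?K)" for S
    unfolding Z_def by (intro sum.cong refl arg_cong[where f=of_bool]; blast)+
  have Ymono: "Y S \<le> Y T" and Zmono: "Z S \<le> Z T" if "S \<subseteq> T" for S T
    unfolding Y_def Z_def using that by (intro sum_mono; force)+
  have Z0: "Z S \<ge> 0" for S unfolding Z_def by (auto intro: sum_nonneg)
  have Y0: "Y S \<ge> 0" for S unfolding Y_def by (auto intro: sum_nonneg)
  \<comment> \<open>Dropping Y only increases the exponential, and Z does not depend on the coordinates in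
    E k.\<close>
  have Psi: "bexp p A (\<lambda>S. exp (- l * X S)) \<le> bexp p ?B (\<lambda>S. exp (- l * Z S))"
  proof -
    have "bexp p A (\<lambda>S. exp (- l * X S)) \<le> bexp p A (\<lambda>S. exp (- l * Z S))"
      using assms(1-7) Y0 by (intro bexp_mono) (auto simp: XYZ mult_left_mono)
    also have "\<dots> = bexp p (?K \<union> ?B) (\<lambda>S. exp (- l * Z S))"
      using KA by (simp add: Un_absorb1)
    also have "\<dots> = bexp p ?K (\<lambda>S. bexp p ?B (\<lambda>R. exp (- l * Z (S \<union> R))))"
      using finB finK by (subst bexp_union) auto
    also have "\<dots> = bexp p ?K (\<lambda>S. bexp p ?B (\<lambda>R. exp (- l * Z R)))"
    proof (intro bexp_cong)
      fix S R assume "S \<subseteq> ?K" "R \<subseteq> ?B"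
      then have "(S \<union> R) - ?K = R" "R - ?K = R" by auto
      then have "Z (S \<union> R) = Z R" by (metis Zeq2)
      then show "exp (- l * Z (S \<union> R)) = exp (- l * Z R)" by simp
    qed
    finally show ?thesis using finK by (simp add: bexp_const)
  qed
  have first: "p ^ card ?K * bexp p ?B (\<lambda>S. 1 - l * Y (?K \<union> S))
     = p ^ card ?K - l * (\<Sum>i\<in>?N. p ^ card (E i \<union> ?K))"
  proof -
    have "p ^ card ?K * bexp p ?B (\<lambda>S. 1 - l * Y (?K \<union> S))
        = bexp p A (\<lambda>S. of_bool (?K \<subseteq> S) * (1 - l * Y S))"
      using bexp_subset_mult[OF assms(1) KA, of p "\<lambda>S. 1 - l * Y S"] by simp
    also have "\<dots> = bexp p A (\<lambda>S. of_bool (?K \<subseteq> S) + (- l) * (\<Sum>i\<in>?N. of_bool (E i \<union> ?K \<subseteq> S)))"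
      by (intro bexp_cong) (auto simp: Y_def algebra_simps sum_distrib_left sum_negf)
    also have "\<dots> = bprob p A (\<lambda>S. ?K \<subseteq> S) - l * (\<Sum>i\<in>?N. bprob p A (\<lambda>S. E i \<union> ?K \<subseteq> S))"
      unfolding bexp_add bexp_cmult bexp_sum bprob_def by simp
    also have "bprob p A (\<lambda>S. ?K \<subseteq> S) = p ^ card ?K"
      using bprob_subset_avoid[of A ?K "{}" p] assms(1) KA by simp
    also have "(\<Sum>i\<in>?N. bprob p A (\<lambda>S. E i \<union> ?K \<subseteq> S)) = (\<Sum>i\<in>?N. p ^ card (E i \<union> ?K))"
    proof (intro sum.cong refl)
      fix i assume "i \<in> ?N"
      then have "E i \<union> ?K \<subseteq> A" using assms(5) KA by auto
      then show "bprob p A (\<lambda>S. E i \<union> ?K \<subseteq> S) = p ^ card (E i \<union> ?K)"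
        using bprob_subset_avoid[of A "E i \<union> ?K" "{}" p] assms(1) by simp
    qed
    finally show ?thesis .
  qed
  have "bexp p A (\<lambda>S. of_bool (?K \<subseteq> S) * exp (- l * X S))
      = p ^ card ?K * bexp p ?B (\<lambda>S. exp (- l * X (?K \<union> S)))"
    by (rule bexp_subset_mult[OF assms(1) KA])
  also have "bexp p ?B (\<lambda>S. exp (- l * X (?K \<union> S)))
      = bexp p ?B (\<lambda>S. exp (- l * Y (?K \<union> S)) * exp (- l * Z S))"
  proof (intro bexp_cong)
    fix S assume "S \<subseteq> ?B"
    then have "S - ?K = S" by auto
    then show "exp (- l * X (?K \<union> S)) = exp (- l * Y (?K \<union> S)) * exp (- l * Z S)"
      by (simp add: XYZ Zeq mult_exp_exp algebra_simps)
  qed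
  finally have eq: "bexp p A (\<lambda>S. of_bool (?K \<subseteq> S) * exp (- l * X S))
      = p ^ card ?K * bexp p ?B (\<lambda>S. exp (- l * Y (?K \<union> S)) * exp (- l * Z S))" .
  have "bexp p ?B (\<lambda>S. exp (- l * Y (?K \<union> S))) * bexp p ?B (\<lambda>S. exp (- l * Z S))
      \<le> bexp p ?B (\<lambda>S. exp (- l * Y (?K \<union> S)) * exp (- l * Z S))"
    using assms(1-7) finB by (intro harris_inequality) (auto intro!: mult_left_mono Ymono Zmono)
  then have 1: "bexp p A (\<lambda>S. of_bool (?K \<subseteq> S) * exp (- l * X S))
     \<ge> p ^ card ?K * (bexp p ?B (\<lambda>S. exp (- l * Y (?K \<union> S))) * bexp p ?B (\<lambda>S. exp (- l * Z S)))"
    unfolding eq using assms(1-7) by (intro mult_left_mono) auto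
  have 2: "bexp p ?B (\<lambda>S. exp (- l * Y (?K \<union> S))) \<ge> bexp p ?B (\<lambda>S. 1 - l * Y (?K \<union> S))"
  proof (rule bexp_mono)
    show "1 - l * Y (?K \<union> S) \<le> exp (- l * Y (?K \<union> S))" for S
      using exp_ge_add_one_self[of "- l * Y (?K \<union> S)"] by simp
  qed (use assms(1-7) in auto)
  have "bexp p ?B (\<lambda>S. exp (- l * Y (?K \<union> S))) * bexp p ?B (\<lambda>S. exp (- l * Z S))
     \<ge> bexp p ?B (\<lambda>S. exp (- l * Y (?K \<union> S))) * bexp p A (\<lambda>S. exp (- l * X S))"
    using Psi assms(1-7) by (intro mult_left_mono bexp_nonneg) auto
  moreover have "bexp p ?B (\<lambda>S. exp (- l * Y (?K \<union> S))) * bexp p A (\<lambda>S. exp (- l * X S))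
     \<ge> bexp p ?B (\<lambda>S. 1 - l * Y (?K \<union> S)) * bexp p A (\<lambda>S. exp (- l * X S))"
    using 2 assms(1-7) by (intro mult_right_mono bexp_nonneg) auto
  ultimately have "p ^ card ?K * (bexp p ?B (\<lambda>S. 1 - l * Y (?K \<union> S)) * bexp p A (\<lambda>S. exp (- l * X S)))
     \<le> p ^ card ?K * (bexp p ?B (\<lambda>S. exp (- l * Y (?K \<union> S))) * bexp p ?B (\<lambda>S. exp (- l * Z S)))"
    using assms(1-7) by (intro mult_left_mono) auto
  with 1 show ?thesis by (simp add: first[symmetric] mult.assoc)
qed

text \<open>
  With mu and D the two sums in the exponent, the moment generating function Psi of - X satisfies
  - Psi' \<ge> (mu - l D) Psi. Integrating the logarithmic derivative from 0 to l bounds Psi l,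
  and Psi l bounds the probability that X vanishes. The choice l = mu / D gives the usual form exp
  (- mu^2 / (2 D)).
\<close>
lemma janson_inequality:
  fixes E :: "'i \<Rightarrow> 'a set"
  assumes "finite A" "0 < p" "p < 1" "finite I" "\<And>i. i \<in> I \<Longrightarrow> E i \<subseteq> A" "0 \<le> l"
  shows "bprob p A (\<lambda>S. \<forall>i\<in>I. \<not> E i \<subseteq> S)
    \<le> exp (- l * (\<Sum>i\<in>I. p ^ card (E i))
        + l\<^sup>2 / 2 * (\<Sum>k\<in>I. \<Sum>i\<in>{i\<in>I. E i \<inter> E k \<noteq> {}}. p ^ card (E i \<union> E k)))"
proof -
  define X where "X S = (\<Sum>i\<in>I. of_bool (E i \<subseteq> S) :: real)" for S
  define mu where "mu = (\<Sum>i\<in>I. p ^ card (E i))"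
  define D where "D = (\<Sum>k\<in>I. \<Sum>i\<in>{i\<in>I. E i \<inter> E k \<noteq> {}}. p ^ card (E i \<union> E k))"
  define Psi where "Psi l = bexp p A (\<lambda>S. exp (- l * X S))" for l
  define Psi' where "Psi' l = bexp p A (\<lambda>S. X S * exp (- l * X S))" for l
  have Psi_pos: "Psi l > 0" for l
    unfolding Psi_def using assms by (intro bexp_pos) auto
  have deriv: "(Psi has_real_derivative - Psi' l) (at l)" for l
    unfolding Psi_def Psi'_def bexp_def
    by (auto intro!: derivative_eq_intros simp: sum_negf[symmetric] mult_ac)
  have Psi'_ge: "Psi' l \<ge> (mu - l * D) * Psi l" if "0 \<le> l" for l
  proof -
    have "Psi' l = (\<Sum>k\<in>I. bexp p A (\<lambda>S. of_bool (E k \<subseteq> S) * exp (- l * X S)))"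
      by (simp add: Psi'_def X_def sum_distrib_right bexp_sum[symmetric])
    also have "\<dots> \<ge> (\<Sum>k\<in>I. (p ^ card (E k) - l * (\<Sum>i\<in>{i\<in>I. E i \<inter> E k \<noteq> {}}. p ^ card (E i \<union> E k))) * Psi l)"
      unfolding Psi_def X_def using assms that by (intro sum_mono bexp_exp_cond_lower) auto
    finally show ?thesis
      by (simp add: mu_def D_def sum_distrib_right sum_distrib_left sum_subtractf algebra_simps)
  qed
  \<comment> \<open>The differential inequality says that g decreases, and g vanishes at 0.\<close>
  define g where "g l = ln (Psi l) + mu * l - D * l\<^sup>2 / 2" for l
  have "g l \<le> g 0"
  proof (rule DERIV_nonpos_imp_nonincreasing[OF assms(6)])
    fix x assume x: "0 \<le> x" "x \<le> l"
    have "(g has_real_derivative (- Psi' x / Psi x + mu - D * x)) (at x)"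
      unfolding g_def by (rule derivative_eq_intros deriv Psi_pos refl | simp)+
    moreover have "- Psi' x / Psi x + mu - D * x \<le> 0"
      using Psi'_ge[OF x(1)] Psi_pos[of x] by (simp add: field_simps)
    ultimately show "\<exists>y. (g has_real_derivative y) (at x) \<and> y \<le> 0" by blast
  qed
  also have "g 0 = 0"
    using assms by (simp add: g_def Psi_def bexp_const)
  finally have "ln (Psi l) \<le> - l * mu + l\<^sup>2 / 2 * D"
    by (simp add: g_def algebra_simps)
  then have "Psi l \<le> exp (- l * mu + l\<^sup>2 / 2 * D)"
    using Psi_pos[of l] by (metis exp_le_cancel_iff exp_ln)
  moreover have "bprob p A (\<lambda>S. \<forall>i\<in>I. \<not> E i \<subseteq> S) \<le> Psi l"
    unfolding bprob_def Psi_def X_def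
    using assms by (intro bexp_mono) (auto simp: of_bool_def)
  ultimately show ?thesis by (simp add: mu_def D_def)
qed

section \<open>Cliques, neighbourhoods and the upper bound\<close>

definition cross :: "'a set \<Rightarrow> 'a set \<Rightarrow> 'a set set" where
  "cross A B = (\<lambda>(u, v). {u, v}) ` (A \<times> B)"

lemma finite_cross [simp]: "finite A \<Longrightarrow> finite B \<Longrightarrow> finite (cross A B)"
  by (simp add: cross_def)

lemma cross_subset_vertex_pairs:
  "A \<subseteq> V \<Longrightarrow> B \<subseteq> V \<Longrightarrow> A \<inter> B = {} \<Longrightarrow> cross A B \<subseteq> vertex_pairs V"
  by (auto simp: cross_def vertex_pairs_def card_insert_if)

lemma inj_on_cross: "A \<inter> B = {} \<Longrightarrow> inj_on (\<lambda>(u, v). {u, v}) (A \<times> B)"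
  by (auto simp: inj_on_def doubleton_eq_iff)

lemma card_cross: "A \<inter> B = {} \<Longrightarrow> card (cross A B) = card A * card B"
  unfolding cross_def by (subst card_image) (auto simp: inj_on_cross card_cartesian_product)

lemma cross_singleton_subset: "cross {w} K \<subseteq> S \<longleftrightarrow> (\<forall>u\<in>K. {u, w} \<in> S)"
  by (auto simp: cross_def insert_commute)

lemma cross_singleton_inter: "S \<inter> cross {w} K = {} \<longleftrightarrow> (\<forall>u\<in>K. {u, w} \<notin> S)"
  by (auto simp: cross_def insert_commute)

lemma card_vertex_pairs: "finite A \<Longrightarrow> card (vertex_pairs A) = card A choose 2"
  using n_subsets[of A 2] by (simp add: vertex_pairs_def)

lemma vertex_pairs_mono: "A \<subseteq> B \<Longrightarrow> vertex_pairs A \<subseteq> vertex_pairs B"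
  by (auto simp: vertex_pairs_def)

lemma clique_iff: "clique (V, S) K \<longleftrightarrow> K \<subseteq> V \<and> vertex_pairs K \<subseteq> S"
proof
  assume "clique (V, S) K"
  then show "K \<subseteq> V \<and> vertex_pairs K \<subseteq> S"
    by (auto simp: clique_def vertex_pairs_def card_2_iff)
next
  assume *: "K \<subseteq> V \<and> vertex_pairs K \<subseteq> S"
  have "{u, v} \<in> vertex_pairs K" if "u \<in> K" "v \<in> K" "u \<noteq> v" for u v
    using that by (simp add: vertex_pairs_def)
  with * show "clique (V, S) K"
    by (auto simp: clique_def)
qed

lemma clique_insert:
  "clique (V, S) K \<Longrightarrow> w \<in> V \<Longrightarrow> (\<And>u. u \<in> K \<Longrightarrow> {u, w} \<in> S) \<Longrightarrow> clique (V, S) (insert w K)"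
  by (auto simp: clique_def insert_commute)

lemma maximal_clique_no_common_neighbour:
  assumes "maximal_clique (V, S) K" "w \<in> V" "w \<notin> K"
  shows "\<exists>u\<in>K. {u, w} \<notin> S"
proof (rule ccontr)
  assume "\<not> ?thesis"
  then have "clique (V, S) (insert w K)"
    using assms by (auto simp: maximal_clique_def intro!: clique_insert)
  then have "insert w K = K"
    using assms(1) by (auto simp: maximal_clique_def)
  with assms(3) show False by auto
qed

lemma card_sized_subsets_le: "finite V \<Longrightarrow> card {K. K \<subseteq> V \<and> card K = s} \<le> card V ^ s"
  using binomial_le_pow[of s "card V"]
  by (cases "s \<le> card V") (simp_all add: n_subsets binomial_eq_0)

lemma finite_sized_subsets [simp]: "finite V \<Longrightarrow> finite {K. K \<subseteq> V \<and> card K = s}"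
  by (rule finite_subset[of _ "Pow V"]) auto

text \<open>
  Colour i < k is used inside the neighbourhood of the i-th vertex of S0, colour k on the vertices
  without neighbour in S0, and colour k + 1 on S0 itself. A clique in the first kind of class is
  extended by the corresponding vertex of S0, and a clique in one of the last two classes is too
  small to be maximal.
\<close>
lemma clique_coloring_by_neighbourhoods:
  assumes fin: "finite V" and S0: "S0 \<subseteq> V"
    and ext: "\<And>K. K \<subseteq> V \<Longrightarrow> card K \<le> s \<Longrightarrow> \<exists>w\<in>V - K. \<forall>u\<in>K. {u, w} \<in> S"
    and in0: "\<And>K. K \<subseteq> S0 \<Longrightarrow> vertex_pairs K \<subseteq> S \<Longrightarrow> card K \<le> s"
    and out0: "\<And>K. K \<subseteq> V - S0 \<Longrightarrow> vertex_pairs K \<subseteq> S \<Longrightarrow> S \<inter> cross K S0 = {} \<Longrightarrow> card K \<le> s"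
  shows "\<exists>c. clique_coloring (V, S) (card S0 + 2) c"
proof -
  define k where "k = card S0"
  obtain e where e: "bij_betw e {..<k} S0"
    using ex_bij_betw_nat_finite[of S0] fin S0 finite_subset
    by (metis atLeast0LessThan k_def)
  define c where "c v = (if v \<in> S0 then k + 1 else if \<exists>i<k. {e i, v} \<in> S
      then LEAST i. i < k \<and> {e i, v} \<in> S else k)" for v
  have e_least: "c v < k \<and> {e (c v), v} \<in> S" if "v \<notin> S0" "\<exists>i<k. {e i, v} \<in> S" for v
    using that LeastI_ex[of "\<lambda>i. i < k \<and> {e i, v} \<in> S"] by (auto simp: c_def)
  have "\<not> monochromatic c K" if K: "maximal_clique (V, S) K" and K2: "card K \<ge> 2" for K
  proof
    assume "monochromatic c K"
    then obtain i where i: "\<And>v. v \<in> K \<Longrightarrow> c v = i" by (auto simp: monochromatic_def)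
    have KV: "K \<subseteq> V" "vertex_pairs K \<subseteq> S"
      using K by (auto simp: maximal_clique_def clique_iff)
    have big: "\<not> card K \<le> s"
    proof
      assume "card K \<le> s"
      from ext[OF KV(1) this] maximal_clique_no_common_neighbour[OF K] show False by auto
    qed
    have cle: "c v = k + 1 \<longleftrightarrow> v \<in> S0" for v
    proof (cases "v \<in> S0 \<or> (\<exists>i<k. {e i, v} \<in> S)")
      case True
      then show ?thesis using e_least[of v] by (cases "v \<in> S0") (simp_all add: c_def)
    qed (auto simp: c_def)
    obtain v0 where v0: "v0 \<in> K" using K2 by fastforce
    consider "i = k + 1" | "i \<noteq> k + 1" "i < k" | "i \<noteq> k + 1" "\<not> i < k" by blast
    then show False
    proof cases
      case 1
      then have "K \<subseteq> S0" using cle i by auto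
      then show False using in0 KV big by auto
    next
      case 2
      have nS0: "v \<notin> S0" if "v \<in> K" for v using cle[of v] i[OF that] 2 by simp
      have adj: "{e i, v} \<in> S" if "v \<in> K" for v
      proof -
        have "\<exists>j<k. {e j, v} \<in> S"
          using i[OF that] 2 nS0[OF that] by (auto simp: c_def split: if_splits)
        then show ?thesis using e_least[OF nS0[OF that]] i[OF that] by simp
      qed
      have "e i \<in> S0" using e 2 by (auto simp: bij_betw_def)
      then have "e i \<in> V" "e i \<notin> K" using S0 nS0 by auto
      from maximal_clique_no_common_neighbour[OF K this] adj show False
        by (auto simp: insert_commute)
    next
      case 3
      have nS0: "v \<notin> S0" if "v \<in> K" for v using cle[of v] i[OF that] 3 by simp
      have nadj: "{x, v} \<notin> S" if v: "v \<in> K" and x: "x \<in> S0" for v x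
      proof
        assume "{x, v} \<in> S"
        moreover obtain j where "j < k" "x = e j" using e x by (auto simp: bij_betw_def)
        ultimately have "c v < k" using e_least[OF nS0[OF v]] by blast
        with i[OF v] 3 show False by simp
      qed
      have "S \<inter> cross K S0 = {}"
        using nadj by (auto simp: cross_def insert_commute)
      moreover have "K \<subseteq> V - S0" using KV nS0 by auto
      ultimately show False using out0 KV big by auto
    qed
  qed
  moreover have "c v < k + 2" for v
  proof (cases "v \<in> S0 \<or> (\<exists>i<k. {e i, v} \<in> S)")
    case True
    then show ?thesis using e_least[of v] by (cases "v \<in> S0") (simp_all add: c_def)
  qed (auto simp: c_def)
  ultimately have "clique_coloring (V, S) (k + 2) c"
    by (auto simp: clique_coloring_def)
  then show ?thesis by (auto simp: k_def)
qed

context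
  fixes V :: "'a set" and p :: real
  assumes fin: "finite V" and p: "0 \<le> p" "p \<le> 1"
begin

text \<open>
  For a fixed set K of s vertices, the events that w is adjacent to all of K are independent for
  different w outside K, and each has probability p^s. Smaller sets are covered by enlarging them.
\<close>
lemma common_neighbour_prob:
  assumes s: "s \<le> card V"
  shows "bprob p (vertex_pairs V)
     (\<lambda>S. \<not> (\<forall>K. K \<subseteq> V \<longrightarrow> card K \<le> s \<longrightarrow> (\<exists>w\<in>V - K. \<forall>u\<in>K. {u, w} \<in> S)))
     \<le> real (card V) ^ s * (1 - p ^ s) ^ (card V - s)"
proof -
  let ?I = "{K. K \<subseteq> V \<and> card K = s}"
  let ?Q = "\<lambda>K S. \<forall>w\<in>V - K. \<not> cross {w} K \<subseteq> S \<inter> cross {w} K"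
  have "bprob p (vertex_pairs V)
     (\<lambda>S. \<not> (\<forall>K. K \<subseteq> V \<longrightarrow> card K \<le> s \<longrightarrow> (\<exists>w\<in>V - K. \<forall>u\<in>K. {u, w} \<in> S)))
     \<le> bprob p (vertex_pairs V) (\<lambda>S. \<exists>K\<in>?I. ?Q K S)"
  proof (rule bprob_mono[OF p])
    fix S assume "\<not> (\<forall>K. K \<subseteq> V \<longrightarrow> card K \<le> s \<longrightarrow> (\<exists>w\<in>V - K. \<forall>u\<in>K. {u, w} \<in> S))"
    then obtain K where K: "K \<subseteq> V" "card K \<le> s" "\<And>w. w \<in> V - K \<Longrightarrow> \<exists>u\<in>K. {u, w} \<notin> S" by blast
    obtain K' where K': "K \<subseteq> K'" "K' \<subseteq> V" "card K' = s"
      using exists_subset_between[of K s V] K s fin by auto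
    have "?Q K' S"
      using K' K(3) by (fastforce simp: cross_singleton_subset)
    then show "\<exists>K\<in>?I. ?Q K S" using K' by blast
  qed
  also have "\<dots> \<le> (\<Sum>K\<in>?I. bprob p (vertex_pairs V) (?Q K))"
    by (rule bprob_union_bound[OF p]) (use fin in auto)
  also have "\<dots> = (\<Sum>K\<in>?I. (1 - p ^ s) ^ (card V - s))"
  proof (rule sum.cong)
    fix K assume K: "K \<in> ?I"
    then have finK: "finite K" using fin finite_subset by auto
    have "bprob p (vertex_pairs V) (?Q K)
        = (\<Prod>w\<in>V - K. bprob p (cross {w} K) (\<lambda>R. \<not> cross {w} K \<subseteq> R))"
    proof (rule bprob_blocks[where Q="\<lambda>w R. \<not> cross {w} K \<subseteq> R"])
      show "disjoint_family_on (\<lambda>w. cross {w} K) (V - K)"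
        by (auto simp: disjoint_family_on_def cross_def doubleton_eq_iff)
      show "(\<Union>w\<in>V - K. cross {w} K) \<subseteq> vertex_pairs V"
        using K cross_subset_vertex_pairs[of _ V K] by blast
    qed (use fin finK in auto)
    also have "\<dots> = (\<Prod>w\<in>V - K. 1 - p ^ s)"
    proof (rule prod.cong)
      fix w assume w: "w \<in> V - K"
      have "bprob p (cross {w} K) (\<lambda>R. cross {w} K \<subseteq> R) = p ^ s"
        using bprob_subset_avoid[of "cross {w} K" "cross {w} K" "{}" p] finK w K
        by (simp add: card_cross)
      then show "bprob p (cross {w} K) (\<lambda>R. \<not> cross {w} K \<subseteq> R) = 1 - p ^ s"
        using finK by (simp add: bprob_not)
    qed simp
    also have "\<dots> = (1 - p ^ s) ^ (card V - s)"
      using K finK by (simp add: card_Diff_subset)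
    finally show "bprob p (vertex_pairs V) (?Q K) = (1 - p ^ s) ^ (card V - s)" .
  qed simp
  also have "\<dots> = real (card ?I) * (1 - p ^ s) ^ (card V - s)" by simp
  also have "\<dots> \<le> real (card V) ^ s * (1 - p ^ s) ^ (card V - s)"
    using card_sized_subsets_le[OF fin, of s] p
    by (intro mult_right_mono) (auto simp: power_le_one simp flip: of_nat_power)
  finally show ?thesis .
qed

text \<open>
  First moment bound for cliques with more than s vertices that have no edge to T. The case where
  T is empty bounds the clique number of the graph on U.
\<close>
lemma clique_avoiding_prob:
  assumes U: "U \<subseteq> V" and T: "T \<subseteq> V" "U \<inter> T = {}"
  shows "bprob p (vertex_pairs V)
     (\<lambda>S. \<exists>K. K \<subseteq> U \<and> vertex_pairs K \<subseteq> S \<and> S \<inter> cross K T = {} \<and> \<not> card K \<le> s)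
     \<le> real (card U) ^ (s + 1) * (p ^ ((s + 1) choose 2) * (1 - p) ^ ((s + 1) * card T))"
proof -
  let ?I = "{K. K \<subseteq> U \<and> card K = s + 1}"
  let ?Q = "\<lambda>K S. vertex_pairs K \<subseteq> S \<and> S \<inter> cross K T = {}"
  have finU: "finite U" using U fin finite_subset by auto
  have "bprob p (vertex_pairs V)
     (\<lambda>S. \<exists>K. K \<subseteq> U \<and> vertex_pairs K \<subseteq> S \<and> S \<inter> cross K T = {} \<and> \<not> card K \<le> s)
     \<le> bprob p (vertex_pairs V) (\<lambda>S. \<exists>K\<in>?I. ?Q K S)"
  proof (rule bprob_mono[OF p])
    fix S assume "\<exists>K. K \<subseteq> U \<and> vertex_pairs K \<subseteq> S \<and> S \<inter> cross K T = {} \<and> \<not> card K \<le> s"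
    then obtain K where K: "K \<subseteq> U" "vertex_pairs K \<subseteq> S" "S \<inter> cross K T = {}" "\<not> card K \<le> s" by blast
    obtain K' where K': "K' \<subseteq> K" "card K' = s + 1"
      by (rule obtain_subset_with_card_n[of "s + 1" K]) (use K(4) in auto)
    have "cross K' T \<subseteq> cross K T" using K' by (auto simp: cross_def)
    then have "?Q K' S" using K K' vertex_pairs_mono[OF K'(1)] by auto
    then show "\<exists>K\<in>?I. ?Q K S" using K K' by blast
  qed
  also have "\<dots> \<le> (\<Sum>K\<in>?I. bprob p (vertex_pairs V) (?Q K))"
    by (rule bprob_union_bound[OF p]) (use finU in auto)
  also have "\<dots> = (\<Sum>K\<in>?I. p ^ ((s + 1) choose 2) * (1 - p) ^ ((s + 1) * card T))"
  proof (rule sum.cong)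
    fix K assume K: "K \<in> ?I"
    then have finK: "finite K" using finU finite_subset by auto
    have "vertex_pairs K \<inter> cross K T = {}"
      using K T by (auto simp: vertex_pairs_def cross_def)
    moreover have "cross K T \<subseteq> vertex_pairs V"
      using K T U by (intro cross_subset_vertex_pairs) auto
    moreover have "vertex_pairs K \<subseteq> vertex_pairs V"
      using K U by (intro vertex_pairs_mono) auto
    moreover have "card (cross K T) = (s + 1) * card T"
      using K T by (subst card_cross) auto
    ultimately show "bprob p (vertex_pairs V) (?Q K) = p ^ ((s + 1) choose 2) * (1 - p) ^ ((s + 1) * card T)"
      using fin finK K by (subst bprob_subset_avoid) (auto simp: card_vertex_pairs)
  qed simp
  also have "\<dots> = real (card ?I) * (p ^ ((s + 1) choose 2) * (1 - p) ^ ((s + 1) * card T))" by simp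
  also have "\<dots> \<le> real (card U) ^ (s + 1) * (p ^ ((s + 1) choose 2) * (1 - p) ^ ((s + 1) * card T))"
    using card_sized_subsets_le[OF finU, of "s + 1"] p
    by (intro mult_right_mono) (auto simp flip: of_nat_power of_nat_mult power_Suc)
  finally show ?thesis .
qed

lemma upper_bound_prob:
  assumes s: "s \<le> card V" and k: "k \<le> card V"
  shows "bprob p (vertex_pairs V) (\<lambda>S. \<not> (\<exists>c. clique_coloring (V, S) (k + 2) c))
     \<le> real (card V) ^ s * (1 - p ^ s) ^ (card V - s)
       + real k ^ (s + 1) * p ^ ((s + 1) choose 2)
       + real (card V) ^ (s + 1) * (p ^ ((s + 1) choose 2) * (1 - p) ^ ((s + 1) * k))"
proof -
  obtain S0 where S0: "S0 \<subseteq> V" "card S0 = k"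
    using obtain_subset_with_card_n[OF k] by auto
  let ?B1 = "\<lambda>S. \<not> (\<forall>K. K \<subseteq> V \<longrightarrow> card K \<le> s \<longrightarrow> (\<exists>w\<in>V - K. \<forall>u\<in>K. {u, w} \<in> S))"
  let ?B2 = "\<lambda>S. \<exists>K. K \<subseteq> S0 \<and> vertex_pairs K \<subseteq> S \<and> S \<inter> cross K {} = {} \<and> \<not> card K \<le> s"
  let ?B3 = "\<lambda>S. \<exists>K. K \<subseteq> V - S0 \<and> vertex_pairs K \<subseteq> S \<and> S \<inter> cross K S0 = {} \<and> \<not> card K \<le> s"
  let ?A = "vertex_pairs V"
  have "bprob p ?A (\<lambda>S. \<not> (\<exists>c. clique_coloring (V, S) (k + 2) c))
      \<le> bprob p ?A (\<lambda>S. (?B1 S \<or> ?B2 S) \<or> ?B3 S)"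
  proof (rule bprob_mono[OF p])
    fix S assume no: "\<not> (\<exists>c. clique_coloring (V, S) (k + 2) c)"
    show "(?B1 S \<or> ?B2 S) \<or> ?B3 S"
    proof (rule ccontr)
      assume "\<not> ((?B1 S \<or> ?B2 S) \<or> ?B3 S)"
      then have "\<exists>c. clique_coloring (V, S) (card S0 + 2) c"
        using S0 fin by (intro clique_coloring_by_neighbourhoods[where s=s]) (auto simp: cross_def)
      with no S0 show False by simp
    qed
  qed
  also have "\<dots> \<le> bprob p ?A (\<lambda>S. ?B1 S \<or> ?B2 S) + bprob p ?A ?B3"
    by (rule bprob_disj[OF p])
  also have "\<dots> \<le> (bprob p ?A ?B1 + bprob p ?A ?B2) + bprob p ?A ?B3"
    by (intro add_right_mono bprob_disj[OF p])
  also have "bprob p ?A ?B1 \<le> real (card V) ^ s * (1 - p ^ s) ^ (card V - s)"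
    by (rule common_neighbour_prob[OF s])
  also have "bprob p ?A ?B2 \<le> real k ^ (s + 1) * p ^ ((s + 1) choose 2)"
    using clique_avoiding_prob[of S0 "{}" s] S0 by simp
  also have "bprob p ?A ?B3 \<le> real (card V) ^ (s + 1) * (p ^ ((s + 1) choose 2) * (1 - p) ^ ((s + 1) * k))"
  proof -
    have "bprob p ?A ?B3
      \<le> real (card (V - S0)) ^ (s + 1) * (p ^ ((s + 1) choose 2) * (1 - p) ^ ((s + 1) * card S0))"
      using S0 by (intro clique_avoiding_prob) auto
    also have "\<dots> \<le> real (card V) ^ (s + 1) * (p ^ ((s + 1) choose 2) * (1 - p) ^ ((s + 1) * k))"
      unfolding S0 using p fin by (intro mult_right_mono power_mono) (auto intro: card_mono)
    finally show ?thesis .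
  qed
  finally show ?thesis by simp
qed

text \<open>
  The events that v has a neighbour in T are independent for different v. Choosing X in advance
  turns the statement that T has more than r common non-neighbours into a plain union bound.
\<close>
lemma common_nonneighbour_prob:
  assumes kr: "k + r \<le> card V"
  shows "bprob p (vertex_pairs V)
     (\<lambda>S. \<not> (\<forall>T X. T \<subseteq> V \<longrightarrow> X \<subseteq> V \<longrightarrow> card T \<le> k \<longrightarrow> card X \<le> r \<longrightarrow>
            (\<exists>v\<in>V - T - X. \<forall>u\<in>T. {u, v} \<notin> S)))
     \<le> real (card V) ^ (k + r) * (1 - (1 - p) ^ k) ^ (card V - k - r)"
proof -
  let ?I = "{T. T \<subseteq> V \<and> card T = k} \<times> {X. X \<subseteq> V \<and> card X = r}"
  let ?Q = "\<lambda>(T, X) S. \<forall>v\<in>V - T - X. (S \<inter> cross {v} T) \<inter> cross {v} T \<noteq> {}"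
  let ?c = "(1 - (1 - p) ^ k) ^ (card V - k - r)"
  have c01: "0 \<le> 1 - (1 - p) ^ k" "1 - (1 - p) ^ k \<le> 1"
    using p by (auto simp: power_le_one)
  have "bprob p (vertex_pairs V)
     (\<lambda>S. \<not> (\<forall>T X. T \<subseteq> V \<longrightarrow> X \<subseteq> V \<longrightarrow> card T \<le> k \<longrightarrow> card X \<le> r \<longrightarrow>
            (\<exists>v\<in>V - T - X. \<forall>u\<in>T. {u, v} \<notin> S)))
     \<le> bprob p (vertex_pairs V) (\<lambda>S. \<exists>i\<in>?I. ?Q i S)"
  proof (rule bprob_mono[OF p])
    fix S assume "\<not> (\<forall>T X. T \<subseteq> V \<longrightarrow> X \<subseteq> V \<longrightarrow> card T \<le> k \<longrightarrow> card X \<le> r \<longrightarrow>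
            (\<exists>v\<in>V - T - X. \<forall>u\<in>T. {u, v} \<notin> S))"
    then obtain T X where TX: "T \<subseteq> V" "X \<subseteq> V" "card T \<le> k" "card X \<le> r"
      "\<not> (\<exists>v\<in>V - T - X. \<forall>u\<in>T. {u, v} \<notin> S)"
      unfolding not_all not_imp by (elim exE conjE) (rule that)
    obtain T' where T': "T \<subseteq> T'" "T' \<subseteq> V" "card T' = k"
      using exists_subset_between[OF TX(3) _ TX(1) fin] kr by (meson add_leD1 le_trans)
    obtain X' where X': "X \<subseteq> X'" "X' \<subseteq> V" "card X' = r"
      using exists_subset_between[OF TX(4) _ TX(2) fin] kr by (meson add_leD2 le_trans)
    have "?Q (T', X') S"
    proof (clarsimp)
      fix v assume v: "v \<in> V" "v \<notin> T'" "v \<notin> X'" and no: "S \<inter> cross {v} T' = {}"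
      then have "v \<in> V - T - X" using T' X' by blast
      then obtain u where "u \<in> T" "{u, v} \<in> S" using TX(5) by blast
      with no T' show False by (auto simp: cross_singleton_inter)
    qed
    then show "\<exists>i\<in>?I. ?Q i S" using T' X' by blast
  qed
  also have "\<dots> \<le> (\<Sum>i\<in>?I. bprob p (vertex_pairs V) (?Q i))"
    by (rule bprob_union_bound[OF p]) (use fin in auto)
  also have "\<dots> \<le> (\<Sum>i\<in>?I. ?c)"
  proof (rule sum_mono)
    fix i assume "i \<in> ?I"
    then obtain T X where i: "i = (T, X)" "T \<subseteq> V" "card T = k" "X \<subseteq> V" "card X = r" by auto
    then have finT: "finite T" "finite X" using fin finite_subset by auto
    have "bprob p (vertex_pairs V) (?Q i)
        = (\<Prod>v\<in>V - T - X. bprob p (cross {v} T) (\<lambda>R. R \<inter> cross {v} T \<noteq> {}))"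
      unfolding i prod.case
    proof (rule bprob_blocks[where Q="\<lambda>w R. R \<inter> cross {w} T \<noteq> {}"])
      show "disjoint_family_on (\<lambda>w. cross {w} T) (V - T - X)"
        by (auto simp: disjoint_family_on_def cross_def doubleton_eq_iff)
      show "(\<Union>w\<in>V - T - X. cross {w} T) \<subseteq> vertex_pairs V"
        using i cross_subset_vertex_pairs[of _ V T] by blast
    qed (use fin finT in auto)
    also have "\<dots> = (\<Prod>v\<in>V - T - X. 1 - (1 - p) ^ k)"
    proof (rule prod.cong)
      fix w assume w: "w \<in> V - T - X"
      have "bprob p (cross {w} T) (\<lambda>R. R \<inter> cross {w} T = {}) = (1 - p) ^ k"
        using bprob_subset_avoid[of "cross {w} T" "{}" "cross {w} T" p] finT w i
        by (simp add: card_cross)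
      then show "bprob p (cross {w} T) (\<lambda>R. R \<inter> cross {w} T \<noteq> {}) = 1 - (1 - p) ^ k"
        using finT by (simp add: bprob_not)
    qed simp
    also have "\<dots> = (1 - (1 - p) ^ k) ^ card (V - T - X)" by simp
    also have "\<dots> \<le> ?c"
    proof (rule power_decreasing)
      have "V - T - X = V - (T \<union> X)" by auto
      then have "card (V - T - X) = card V - card (T \<union> X)"
        using i finT by (simp add: card_Diff_subset)
      moreover have "card (T \<union> X) \<le> k + r"
        using card_Un_le[of T X] i by simp
      ultimately show "card V - k - r \<le> card (V - T - X)" by simp
    qed (use c01 in auto)
    finally show "bprob p (vertex_pairs V) (?Q i) \<le> ?c" .
  qed
  also have "\<dots> = real (card ?I) * ?c" by simp
  also have "\<dots> \<le> real (card V) ^ (k + r) * ?c"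
  proof (rule mult_right_mono)
    have "card ?I \<le> card V ^ k * card V ^ r"
      unfolding card_cartesian_product
      by (intro mult_mono card_sized_subsets_le[OF fin]) auto
    then show "real (card ?I) \<le> real (card V) ^ (k + r)"
      by (simp add: power_add flip: of_nat_power of_nat_mult)
  qed (use c01 in auto)
  finally show ?thesis .
qed

end

section \<open>Degrees into small sets\<close>

lemma card_inter_cross:
  assumes "finite B" "finite D" "B \<inter> D = {}"
  shows "card (S \<inter> cross B D) = (\<Sum>v\<in>B. card {u\<in>D. {u, v} \<in> S})"
proof -
  have "S \<inter> cross B D = (\<lambda>(u, v). {u, v}) ` (SIGMA v:B. {u\<in>D. {u, v} \<in> S})"
    by (auto simp: cross_def insert_commute image_iff)
  also have "card \<dots> = card (SIGMA v:B. {u\<in>D. {u, v} \<in> S})"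
    by (rule card_image) (use inj_on_cross[OF assms(3)] in \<open>auto simp: inj_on_def\<close>)
  also have "\<dots> = (\<Sum>v\<in>B. card {u\<in>D. {u, v} \<in> S})"
    using assms by (subst card_SigmaI) auto
  finally show ?thesis .
qed

lemma sum_power_card_Pow: "finite V \<Longrightarrow> (\<Sum>B\<in>Pow V. x ^ card B) = (1 + x :: real) ^ card V"
proof (induction V rule: finite_induct)
  case (insert a V)
  have inj: "inj_on (insert a) (Pow V)"
    using insert by (intro inj_onI) (auto simp: insert_eq_iff)
  have "(\<Sum>B\<in>Pow (insert a V). x ^ card B) = (\<Sum>B\<in>Pow V. x ^ card B) + (\<Sum>B\<in>Pow V. x ^ card (insert a B))"
    unfolding Pow_insert using insert
    by (subst sum.union_disjoint) (auto simp: sum.reindex[OF inj])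
  also have "(\<Sum>B\<in>Pow V. x ^ card (insert a B)) = (\<Sum>B\<in>Pow V. x * x ^ card B)"
  proof (rule sum.cong)
    fix B assume "B \<in> Pow V"
    then have "finite B" "a \<notin> B" using insert finite_subset by auto
    then show "x ^ card (insert a B) = x * x ^ card B" by simp
  qed simp
  finally show ?case using insert by (simp add: sum_distrib_left[symmetric] algebra_simps)
qed simp

context
  fixes V :: "'a set" and p :: real
  assumes fin: "finite V" and p: "0 < p" "p < 1"
begin

text \<open>
  Bounding the total degree of the vertices with density at least \<beta> into D, rather than
  their number, is what makes the sum over all of them of a product of densities small. The number
  \<kappa> is what an edge gains in the exponential moment, l, minus what the moment itself costs,
  p exp l / \<beta>; with \<beta> = p^(1 - \<delta>) and exp l = p^(- \<delta>) it is \<delta> ln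
  (1/p) - 1.
\<close>
lemma heavy_degree_sum_prob:
  fixes \<beta> R l :: real
  assumes l: "0 \<le> l" and b: "0 < \<beta>" and k: "p * exp l / \<beta> + \<kappa> \<le> l" "0 \<le> \<kappa>"
    and small: "real (card V) * exp (- \<kappa> * \<beta> * real N / 2) \<le> 1"
  shows "bprob p (vertex_pairs V)
     (\<lambda>S. \<not> (\<forall>D\<in>{D. D \<subseteq> V \<and> card D = N}. \<forall>B\<in>Pow (V - D).
        (\<forall>v\<in>B. \<beta> * real N \<le> real (card {u\<in>D. {u, v} \<in> S})) \<longrightarrow>
        (\<Sum>v\<in>B. real (card {u\<in>D. {u, v} \<in> S})) \<le> R * real N))
     \<le> real (card V) ^ N * (exp 1 * exp (- \<kappa> * R * real N / 2))"
proof -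
  let ?n = "card V" and ?A = "vertex_pairs V"
  let ?d = "\<lambda>S D v. real (card {u\<in>D. {u, v} \<in> S})"
  let ?I = "{D. D \<subseteq> V \<and> card D = N}"
  define x where "x = exp (- \<kappa> * \<beta> * real N / 2)"
  let ?Q = "\<lambda>D S. \<exists>B\<in>Pow (V - D). (\<forall>v\<in>B. \<beta> * real N \<le> ?d S D v) \<and> \<not> (\<Sum>v\<in>B. ?d S D v) \<le> R * real N"
  let ?e = "exp (- \<kappa> * R * real N / 2)"
  have x: "0 \<le> x" "real ?n * x \<le> 1" using small by (auto simp: x_def)
  have one: "bprob p ?A (\<lambda>S. (\<forall>v\<in>B. \<beta> * real N \<le> ?d S D v) \<and> \<not> (\<Sum>v\<in>B. ?d S D v) \<le> R * real N)
     \<le> x ^ card B * ?e" if D: "D \<in> ?I" and B: "B \<in> Pow (V - D)" for D B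
  proof -
    \<comment> \<open>The lower bound for z by the average of its two terms gives a weight x for each
      vertex of B, so that the sum over all B converges, and a factor for D.\<close>
    define z where "z = max (\<beta> * real (card B) * real N) (R * real N)"
    have f: "finite B" "finite D" "B \<inter> D = {}" using D B fin finite_subset by auto
    have sub: "cross B D \<subseteq> ?A" using D B by (intro cross_subset_vertex_pairs) auto
    have "bprob p ?A (\<lambda>S. (\<forall>v\<in>B. \<beta> * real N \<le> ?d S D v) \<and> \<not> (\<Sum>v\<in>B. ?d S D v) \<le> R * real N)
       \<le> bprob p ?A (\<lambda>S. z \<le> real (card (S \<inter> cross B D)))"
    proof (rule bprob_mono)
      fix S assume S: "(\<forall>v\<in>B. \<beta> * real N \<le> ?d S D v) \<and> \<not> (\<Sum>v\<in>B. ?d S D v) \<le> R * real N"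
      have "(\<Sum>v\<in>B. \<beta> * real N) \<le> (\<Sum>v\<in>B. ?d S D v)" using S by (intro sum_mono) auto
      with S show "z \<le> real (card (S \<inter> cross B D))"
        unfolding card_inter_cross[OF f] z_def by (simp add: algebra_simps)
    qed (use p in auto)
    also have "\<dots> \<le> exp (p * exp l * real (card (cross B D)) - l * z)"
      using sub fin p l by (intro chernoff_upper) auto
    also have "\<dots> \<le> exp (- \<kappa> * (\<beta> * real (card B) * real N + R * real N) / 2)"
    proof -
      have "p * exp l * real (card (cross B D)) = (p * exp l / \<beta>) * (\<beta> * real (card B) * real N)"
        using f D b by (simp add: card_cross)
      also have "\<dots> \<le> (p * exp l / \<beta>) * z"
        using p b by (intro mult_left_mono) (auto simp: z_def)
      finally have 1: "p * exp l * real (card (cross B D)) \<le> (p * exp l / \<beta>) * z" .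
      have "0 \<le> \<beta> * real (card B) * real N" using b by auto
      then have "z \<ge> 0" by (auto simp: z_def)
      then have "(p * exp l / \<beta> + \<kappa>) * z \<le> l * z" using k by (intro mult_right_mono) auto
      with 1 have "p * exp l * real (card (cross B D)) - l * z \<le> - \<kappa> * z"
        by (simp add: algebra_simps)
      also have "\<dots> \<le> - \<kappa> * ((\<beta> * real (card B) * real N + R * real N) / 2)"
      proof -
        have "(\<beta> * real (card B) * real N + R * real N) / 2 \<le> z" by (auto simp: z_def)
        from mult_left_mono[OF this k(2)] show ?thesis by simp
      qed
      finally show ?thesis by simp
    qed
    also have "\<dots> = x ^ card B * ?e"
      by (simp add: x_def exp_of_nat_mult[symmetric] mult_exp_exp field_simps)
    finally show ?thesis .
  qed
  have "bprob p ?A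
     (\<lambda>S. \<not> (\<forall>D\<in>?I. \<forall>B\<in>Pow (V - D). (\<forall>v\<in>B. \<beta> * real N \<le> ?d S D v) \<longrightarrow>
        (\<Sum>v\<in>B. ?d S D v) \<le> R * real N)) \<le> bprob p ?A (\<lambda>S. \<exists>D\<in>?I. ?Q D S)"
    using p by (intro bprob_mono) auto
  also have "\<dots> \<le> (\<Sum>D\<in>?I. bprob p ?A (?Q D))"
    using p fin by (intro bprob_union_bound) auto
  also have "\<dots> \<le> (\<Sum>D\<in>?I. exp 1 * ?e)"
  proof (rule sum_mono)
    fix D assume D: "D \<in> ?I"
    have "bprob p ?A (?Q D) \<le> (\<Sum>B\<in>Pow (V - D).
       bprob p ?A (\<lambda>S. (\<forall>v\<in>B. \<beta> * real N \<le> ?d S D v) \<and> \<not> (\<Sum>v\<in>B. ?d S D v) \<le> R * real N))"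
      using p fin by (intro bprob_union_bound) auto
    also have "\<dots> \<le> (\<Sum>B\<in>Pow (V - D). x ^ card B * ?e)"
      using one[OF D] by (intro sum_mono) auto
    also have "\<dots> = (1 + x) ^ card (V - D) * ?e"
      using fin by (simp add: sum_distrib_right[symmetric] sum_power_card_Pow)
    also have "\<dots> \<le> exp 1 * ?e"
    proof (rule mult_right_mono)
      have "(1 + x) ^ card (V - D) \<le> (1 + x) ^ ?n"
        using x fin by (intro power_increasing card_mono) auto
      also have "\<dots> \<le> exp x ^ ?n"
        using x by (intro power_mono) (auto intro: exp_ge_add_one_self)
      also have "\<dots> = exp (real ?n * x)" by (simp add: exp_of_nat_mult[symmetric])
      also have "\<dots> \<le> exp 1" using x by simp
      finally show "(1 + x) ^ card (V - D) \<le> exp 1" .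
    qed simp
    finally show "bprob p ?A (?Q D) \<le> exp 1 * ?e" .
  qed
  also have "\<dots> = real (card ?I) * (exp 1 * ?e)" by simp
  also have "\<dots> \<le> real ?n ^ N * (exp 1 * ?e)"
    using card_sized_subsets_le[OF fin, of N]
    by (intro mult_right_mono) (auto simp flip: of_nat_power)
  finally show ?thesis .
qed

text \<open>
  The number of sets D is kept as a binomial coefficient: for M = n^(1/2) it is about n^(M/2), and
  a has to stay clearly below ln n / b, which the cruder bound n^M would not give.
\<close>
lemma dense_vertices_prob:
  fixes \<theta> b :: real
  assumes pb: "p = exp (- b)"
  shows "bprob p (vertex_pairs V)
     (\<lambda>S. \<not> (\<forall>D\<in>{D. D \<subseteq> V \<and> card D = M}. \<forall>A\<in>{A. A \<subseteq> V - D \<and> card A = a}.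
        \<exists>v\<in>A. real (card {u\<in>D. {u, v} \<in> S}) < \<theta> * real M))
     \<le> real (card V choose M) * real (card V) ^ a * exp (real a * real M * (1 - \<theta> * b))"
proof -
  let ?n = "card V" and ?A = "vertex_pairs V"
  let ?d = "\<lambda>S D v. real (card {u\<in>D. {u, v} \<in> S})"
  let ?I = "{D. D \<subseteq> V \<and> card D = M}"
  let ?J = "\<lambda>D. {A. A \<subseteq> V - D \<and> card A = a}"
  let ?e = "exp (real a * real M * (1 - \<theta> * b))"
  have b: "0 \<le> b" using p pb by auto
  have one: "bprob p ?A (\<lambda>S. \<forall>v\<in>A. \<theta> * real M \<le> ?d S D v) \<le> ?e"
    if D: "D \<in> ?I" and A: "A \<in> ?J D" for D A
  proof -
    have f: "finite A" "finite D" "A \<inter> D = {}" using D A fin finite_subset[of _ V] by auto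
    have sub: "cross A D \<subseteq> ?A" using D A by (intro cross_subset_vertex_pairs) auto
    have "bprob p ?A (\<lambda>S. \<forall>v\<in>A. \<theta> * real M \<le> ?d S D v)
       \<le> bprob p ?A (\<lambda>S. real a * (\<theta> * real M) \<le> real (card (S \<inter> cross A D)))"
    proof (rule bprob_mono)
      fix S assume S: "\<forall>v\<in>A. \<theta> * real M \<le> ?d S D v"
      have "(\<Sum>v\<in>A. \<theta> * real M) \<le> (\<Sum>v\<in>A. ?d S D v)" using S by (intro sum_mono) auto
      with A show "real a * (\<theta> * real M) \<le> real (card (S \<inter> cross A D))"
        unfolding card_inter_cross[OF f] by simp
    qed (use p in auto)
    also have "\<dots> \<le> exp (p * exp b * real (card (cross A D)) - b * (real a * (\<theta> * real M)))"
      using sub fin p b by (intro chernoff_upper) auto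
    also have "\<dots> = ?e"
      using f D A by (simp add: card_cross pb mult_exp_exp algebra_simps)
    finally show ?thesis .
  qed
  have "bprob p ?A (\<lambda>S. \<not> (\<forall>D\<in>?I. \<forall>A\<in>?J D. \<exists>v\<in>A. ?d S D v < \<theta> * real M))
      = bprob p ?A (\<lambda>S. \<exists>D\<in>?I. \<exists>A\<in>?J D. \<forall>v\<in>A. \<theta> * real M \<le> ?d S D v)"
    by (intro bprob_cong) (simp add: not_less)
  also have "\<dots> \<le> (\<Sum>D\<in>?I. bprob p ?A (\<lambda>S. \<exists>A\<in>?J D. \<forall>v\<in>A. \<theta> * real M \<le> ?d S D v))"
    using p fin by (intro bprob_union_bound) auto
  also have "\<dots> \<le> (\<Sum>D\<in>?I. real ?n ^ a * ?e)"
  proof (rule sum_mono)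
    fix D assume D: "D \<in> ?I"
    have "bprob p ?A (\<lambda>S. \<exists>A\<in>?J D. \<forall>v\<in>A. \<theta> * real M \<le> ?d S D v)
       \<le> (\<Sum>A\<in>?J D. bprob p ?A (\<lambda>S. \<forall>v\<in>A. \<theta> * real M \<le> ?d S D v))"
      using p fin by (intro bprob_union_bound) auto
    also have "\<dots> \<le> (\<Sum>A\<in>?J D. ?e)" using one[OF D] by (intro sum_mono) auto
    also have "\<dots> = real (card (?J D)) * ?e" by simp
    also have "\<dots> \<le> real ?n ^ a * ?e"
    proof (rule mult_right_mono)
      have "card (?J D) \<le> card (V - D) ^ a" using fin by (intro card_sized_subsets_le) auto
      also have "\<dots> \<le> ?n ^ a" using fin by (intro power_mono card_mono) auto
      finally show "real (card (?J D)) \<le> real ?n ^ a" by (simp flip: of_nat_power)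
    qed simp
    finally show "bprob p ?A (\<lambda>S. \<exists>A\<in>?J D. \<forall>v\<in>A. \<theta> * real M \<le> ?d S D v) \<le> real ?n ^ a * ?e" .
  qed
  also have "\<dots> = real (?n choose M) * real ?n ^ a * ?e"
    using n_subsets[OF fin, of M] by simp
  finally show ?thesis .
qed

end

section \<open>Cliques among transversals\<close>

text \<open>
  Transversals of the parts P 0, ..., P (s - 1) without common neighbour in W, encoded as choice
  functions so that the counting lemmas for dependent products apply.
\<close>
definition escaping_transversals :: "nat \<Rightarrow> (nat \<Rightarrow> 'a set) \<Rightarrow> 'a set \<Rightarrow> 'a set set \<Rightarrow> (nat \<Rightarrow> 'a) set" where
  "escaping_transversals s P W S
     = {K \<in> PiE {..<s} P. \<forall>v\<in>W. \<exists>i<s. {K i, v} \<notin> S}"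

text \<open>
  Pairs of transversals are grouped by the set I of positions where they agree: for a given I
  there are at most N^(s - |I|) choices of the second one.
\<close>
lemma transversal_overlap_sum:
  fixes p :: real
  assumes p: "0 < p"
    and P: "\<And>i. i < s \<Longrightarrow> card (P i) = N" "N > 0" and K: "K \<in> PiE {..<s} P"
  defines "J \<equiv> \<lambda>K'. {i\<in>{..<s}. K' i = K i}"
  shows "(\<Sum>K'\<in>{K'\<in>PiE {..<s} P. 2 \<le> card (J K')}. 1 / p ^ (card (J K') choose 2))
     \<le> real N ^ s * (\<Sum>j=2..s. real s ^ j / (real N ^ j * p ^ (j choose 2)))"
proof -
  have finP: "finite (P i)" if "i < s" for i
    using P that by (metis card.infinite less_numeral_extra(3))
  have fin: "finite (PiE {..<s} P)" using finP by (intro finite_PiE) auto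
  let ?Js = "{I\<in>Pow {..<s}. 2 \<le> card I}"
  let ?Ks = "{K'\<in>PiE {..<s} P. 2 \<le> card (J K')}"
  have agree: "card {K'\<in>?Ks. J K' = I} \<le> N ^ (s - card I)" if I: "I \<in> ?Js" for I
  proof -
    have "{K'\<in>?Ks. J K' = I} \<subseteq> PiE {..<s} (\<lambda>i. if i \<in> I then {K i} else P i)"
    proof
      fix K' assume "K' \<in> {K'\<in>?Ks. J K' = I}"
      then have 1: "K' \<in> PiE {..<s} P" "J K' = I" by auto
      show "K' \<in> PiE {..<s} (\<lambda>i. if i \<in> I then {K i} else P i)"
      proof (rule PiE_I)
        fix i assume "i \<in> {..<s}"
        then show "K' i \<in> (if i \<in> I then {K i} else P i)"
          using 1 by (auto simp: J_def)
      qed (use 1 in auto)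
    qed
    then have "card {K'\<in>?Ks. J K' = I} \<le> card (PiE {..<s} (\<lambda>i. if i \<in> I then {K i} else P i))"
      using finP by (intro card_mono finite_PiE) auto
    also have "\<dots> = (\<Prod>i<s. if i \<in> I then 1 else N)"
      using P by (subst card_PiE) (auto intro!: prod.cong)
    also have "\<dots> = N ^ card ({..<s} - I)"
      by (subst prod.If_cases) (auto simp: Diff_eq)
    also have "card ({..<s} - I) = s - card I"
      using I finite_subset[of I "{..<s}"] by (subst card_Diff_subset) auto
    finally show ?thesis .
  qed
  have "(\<Sum>K'\<in>?Ks. 1 / p ^ (card (J K') choose 2))
      = (\<Sum>I\<in>?Js. \<Sum>K'\<in>{K'\<in>?Ks. J K' = I}. 1 / p ^ (card (J K') choose 2))"
    using fin by (intro sum.group[symmetric]) (auto simp: J_def)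
  also have "\<dots> = (\<Sum>I\<in>?Js. real (card {K'\<in>?Ks. J K' = I}) / p ^ (card I choose 2))"
    by (intro sum.cong) auto
  also have "\<dots> \<le> (\<Sum>I\<in>?Js. real (N ^ (s - card I)) / p ^ (card I choose 2))"
    using agree p by (intro sum_mono divide_right_mono of_nat_mono) auto
  also have "\<dots> = (\<Sum>j\<in>{2..s}. \<Sum>I\<in>{I\<in>?Js. card I = j}. real (N ^ (s - card I)) / p ^ (card I choose 2))"
  proof (rule sum.group[symmetric])
    show "card ` ?Js \<subseteq> {2..s}"
      using card_mono[of "{..<s}"] by fastforce
  qed auto
  also have "\<dots> = (\<Sum>j\<in>{2..s}. real (card {I\<in>?Js. card I = j}) * (real (N ^ (s - j)) / p ^ (j choose 2)))"
    by (intro sum.cong refl) simp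
  also have "\<dots> \<le> (\<Sum>j\<in>{2..s}. real (s ^ j) * (real (N ^ (s - j)) / p ^ (j choose 2)))"
  proof (intro sum_mono mult_right_mono of_nat_mono)
    fix j assume "j \<in> {2..s}"
    have "card {I\<in>?Js. card I = j} \<le> card {I. I \<subseteq> {..<s} \<and> card I = j}"
      by (intro card_mono) auto
    also have "\<dots> \<le> s ^ j" using card_sized_subsets_le[of "{..<s}" j] by simp
    finally show "card {I\<in>?Js. card I = j} \<le> s ^ j" .
  qed (use p in auto)
  also have "\<dots> = (\<Sum>j\<in>{2..s}. real N ^ s * (real s ^ j / (real N ^ j * p ^ (j choose 2))))"
  proof (intro sum.cong refl)
    fix j assume "j \<in> {2..s}"
    then have "real N ^ s = real N ^ (s - j) * real N ^ j" by (simp flip: power_add)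
    then show "real (s ^ j) * (real (N ^ (s - j)) / p ^ (j choose 2))
       = real N ^ s * (real s ^ j / (real N ^ j * p ^ (j choose 2)))"
      using P(2) by simp
  qed
  finally show ?thesis by (simp add: sum_distrib_left)
qed

text \<open>
  As the parts are disjoint, two transversals share exactly the vertices at the positions where
  they agree.
\<close>
lemma transversal_pairs:
  fixes P :: "nat \<Rightarrow> 'a set"
  assumes disj: "disjoint_family_on P {..<s}" and K: "K \<in> PiE {..<s} P"
  shows "card (vertex_pairs (K ` {..<s})) = s choose 2"
    and "K' \<in> PiE {..<s} P \<Longrightarrow> vertex_pairs (K ` {..<s}) \<inter> vertex_pairs (K' ` {..<s})
       = vertex_pairs (K ` {i\<in>{..<s}. K' i = K i})"
    and "I \<subseteq> {..<s} \<Longrightarrow> card (vertex_pairs (K ` I)) = card I choose 2"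
proof -
  have same: "i = j" if "i < s" "j < s" "L i = L' j" "L \<in> PiE {..<s} P" "L' \<in> PiE {..<s} P" for i j L L'
  proof (rule ccontr)
    assume "i \<noteq> j"
    then have "P i \<inter> P j = {}" using disj that(1,2) by (auto simp: disjoint_family_on_def)
    moreover have "L i \<in> P i" "L' j \<in> P j"
      using PiE_mem[OF that(4)] PiE_mem[OF that(5)] that(1,2) by simp_all
    ultimately show False using that(3) by (metis disjoint_iff)
  qed
  have inj: "inj_on K {..<s}" using same K by (auto intro!: inj_onI)
  show 3: "card (vertex_pairs (K ` I)) = card I choose 2" if "I \<subseteq> {..<s}" for I
  proof -
    have "finite (K ` I)" "inj_on K I"
      using that finite_subset[OF that] inj_on_subset[OF inj that] by auto
    then show ?thesis by (simp add: card_vertex_pairs card_image)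
  qed
  from 3[of "{..<s}"] show "card (vertex_pairs (K ` {..<s})) = s choose 2" by simp
  assume K': "K' \<in> PiE {..<s} P"
  have "K ` {..<s} \<inter> K' ` {..<s} = K ` {i\<in>{..<s}. K' i = K i}"
  proof (intro equalityI subsetI)
    fix x assume "x \<in> K ` {..<s} \<inter> K' ` {..<s}"
    then obtain i j where ij: "i < s" "j < s" "x = K i" "x = K' j" by auto
    with same[of i j K K'] K K' have "i = j" by simp
    with ij show "x \<in> K ` {i\<in>{..<s}. K' i = K i}" by auto
  next
    fix x assume "x \<in> K ` {i\<in>{..<s}. K' i = K i}"
    then obtain i where "i < s" "K' i = K i" "x = K i" by auto
    then have "x \<in> K ` {..<s}" "x = K' i" by auto
    with \<open>i < s\<close> show "x \<in> K ` {..<s} \<inter> K' ` {..<s}" by auto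
  qed
  moreover have "vertex_pairs A \<inter> vertex_pairs B = vertex_pairs (A \<inter> B)" for A B :: "'a set"
    by (auto simp: vertex_pairs_def)
  ultimately show "vertex_pairs (K ` {..<s}) \<inter> vertex_pairs (K' ` {..<s})
       = vertex_pairs (K ` {i\<in>{..<s}. K' i = K i})" by simp
qed

text \<open>
  Janson's inequality for cliques among a family F of transversals. The expected number of cliques
  in F is at least half of that for all transversals, and the overlap sum is at most that for all
  of them. Hence no structure of F is needed, and F may depend on all edges that leave the parts.
\<close>
lemma no_transversal_clique_prob:
  fixes p :: real
  assumes p: "0 < p" "p < 1" and s: "2 \<le> s"
    and P: "\<And>i. i < s \<Longrightarrow> card (P i) = N" "N > 0" and disj: "disjoint_family_on P {..<s}"
    and U: "(\<Union>i<s. P i) \<subseteq> U" "finite U"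
    and F: "F \<subseteq> PiE {..<s} P" "real N ^ s \<le> 2 * real (card F)"
  shows "bprob p (vertex_pairs U) (\<lambda>S. \<forall>K\<in>F. \<not> vertex_pairs (K ` {..<s}) \<subseteq> S)
     \<le> exp (- 1 / (8 * (\<Sum>j=2..s. real s ^ j / (real N ^ j * p ^ (j choose 2)))))"
proof -
  define D where "D = (\<Sum>j=2..s. real s ^ j / (real N ^ j * p ^ (j choose 2)))"
  define q where "q = p ^ (s choose 2)"
  define M where "M = real N ^ s"
  define E where "E K = vertex_pairs (K ` {..<s})" for K :: "nat \<Rightarrow> 'a"
  define J where "J K K' = {i\<in>{..<s}. K' i = K i}" for K K' :: "nat \<Rightarrow> 'a"
  have finP: "finite (P i)" if "i < s" for i
    using P that by (metis card.infinite less_numeral_extra(3))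
  have finPi: "finite (PiE {..<s} P)" using finP by (intro finite_PiE) auto
  then have finF: "finite F" using F finite_subset by auto
  have cardF: "real (card F) \<le> M"
  proof -
    have "card F \<le> card (PiE {..<s} P)" using F finPi by (intro card_mono)
    also have "\<dots> = N ^ s" using P by (subst card_PiE) auto
    finally show ?thesis unfolding M_def by (simp flip: of_nat_power)
  qed
  have M: "M > 0" using P by (simp add: M_def)
  have q: "q > 0" using p by (simp add: q_def)
  have D: "D > 0" unfolding D_def using s P p by (intro sum_pos) auto
  have EU: "E K \<subseteq> vertex_pairs U" if "K \<in> F" for K
    unfolding E_def using that F U by (intro vertex_pairs_mono) fastforce
  have inner: "(\<Sum>K'\<in>{K'\<in>F. E K' \<inter> E K \<noteq> {}}. p ^ card (E K' \<union> E K)) \<le> q\<^sup>2 * (M * D)"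
    if K: "K \<in> F" for K
  proof -
    have K': "K \<in> PiE {..<s} P" using K F by auto
    have fE: "finite (E L)" for L by (simp add: E_def)
    have int: "E K' \<inter> E K = vertex_pairs (K ` J K K')" "card (E K' \<inter> E K) = card (J K K') choose 2"
      if "K' \<in> F" for K'
    proof -
      show 1: "E K' \<inter> E K = vertex_pairs (K ` J K K')"
        using transversal_pairs(2)[OF disj K', of K'] that F by (auto simp: E_def J_def)
      show "card (E K' \<inter> E K) = card (J K K') choose 2"
        unfolding 1 by (rule transversal_pairs(3)[OF disj K']) (auto simp: J_def)
    qed
    have "(\<Sum>K'\<in>{K'\<in>F. E K' \<inter> E K \<noteq> {}}. p ^ card (E K' \<union> E K))
       = (\<Sum>K'\<in>{K'\<in>F. E K' \<inter> E K \<noteq> {}}. q\<^sup>2 * (1 / p ^ (card (J K K') choose 2)))"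
    proof (rule sum.cong)
      fix K' assume "K' \<in> {K'\<in>F. E K' \<inter> E K \<noteq> {}}"
      then have K'F: "K' \<in> F" by auto
      have "card (E K' \<union> E K) + card (E K' \<inter> E K) = (s choose 2) + (s choose 2)"
        using card_Un_Int[of "E K'" "E K"] fE transversal_pairs(1)[OF disj] K' K'F F
        by (simp add: E_def subset_iff)
      then have "p ^ card (E K' \<union> E K) * p ^ card (E K' \<inter> E K) = q\<^sup>2"
        by (simp add: q_def power2_eq_square flip: power_add)
      then show "p ^ card (E K' \<union> E K) = q\<^sup>2 * (1 / p ^ (card (J K K') choose 2))"
        using p by (simp add: int(2)[OF K'F] field_simps)
    qed simp
    also have "\<dots> \<le> (\<Sum>K'\<in>{K'\<in>PiE {..<s} P. 2 \<le> card (J K K')}. q\<^sup>2 * (1 / p ^ (card (J K K') choose 2)))"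
    proof (rule sum_mono2)
      show "{K'\<in>F. E K' \<inter> E K \<noteq> {}} \<subseteq> {K'\<in>PiE {..<s} P. 2 \<le> card (J K K')}"
      proof
        fix K' assume *: "K' \<in> {K'\<in>F. E K' \<inter> E K \<noteq> {}}"
        then have "card (E K' \<inter> E K) > 0" using fE by (simp add: card_gt_0_iff)
        then have "2 \<le> card (J K K')" using int(2)[of K'] * binomial_eq_0[of "card (J K K')" 2]
          by (cases "2 \<le> card (J K K')") auto
        then show "K' \<in> {K'\<in>PiE {..<s} P. 2 \<le> card (J K K')}" using * F by auto
      qed
    qed (use finPi p in auto)
    also have "\<dots> = q\<^sup>2 * (\<Sum>K'\<in>{K'\<in>PiE {..<s} P. 2 \<le> card (J K K')}. 1 / p ^ (card (J K K') choose 2))"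
      by (simp add: sum_distrib_left)
    also have "\<dots> \<le> q\<^sup>2 * (M * D)"
      unfolding M_def D_def J_def using p P K'
      by (intro mult_left_mono transversal_overlap_sum) auto
    finally show ?thesis .
  qed
  \<comment> \<open>This l minimizes the exponent in Janson's inequality with card F q for the expectation
    and M^2 q^2 D for the overlap sum.\<close>
  define l where "l = real (card F) / (M\<^sup>2 * q * D)"
  have l: "0 \<le> l" using M q D by (simp add: l_def)
  have "bprob p (vertex_pairs U) (\<lambda>S. \<forall>K\<in>F. \<not> E K \<subseteq> S)
     \<le> exp (- l * (\<Sum>K\<in>F. p ^ card (E K))
         + l\<^sup>2 / 2 * (\<Sum>K\<in>F. \<Sum>K'\<in>{K'\<in>F. E K' \<inter> E K \<noteq> {}}. p ^ card (E K' \<union> E K)))"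
    using EU l p U finF by (intro janson_inequality) auto
  also have "\<dots> \<le> exp (- l * (real (card F) * q) + l\<^sup>2 / 2 * (M * (q\<^sup>2 * (M * D))))"
  proof -
    have "(\<Sum>K\<in>F. p ^ card (E K)) = (\<Sum>K\<in>F. q)"
      using transversal_pairs(1)[OF disj] F by (intro sum.cong) (auto simp: E_def q_def)
    moreover have "(\<Sum>K\<in>F. \<Sum>K'\<in>{K'\<in>F. E K' \<inter> E K \<noteq> {}}. p ^ card (E K' \<union> E K)) \<le> (\<Sum>K\<in>F. q\<^sup>2 * (M * D))"
      by (rule sum_mono) (rule inner)
    moreover have "(\<Sum>K\<in>F. q\<^sup>2 * (M * D)) \<le> M * (q\<^sup>2 * (M * D))"
      using cardF M D by (simp add: mult_right_mono)
    ultimately show ?thesis by (simp add: mult_left_mono)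
  qed
  also have "- l * (real (card F) * q) + l\<^sup>2 / 2 * (M * (q\<^sup>2 * (M * D))) = - ((real (card F) / M)\<^sup>2 / (2 * D))"
    using M q D by (simp add: l_def field_simps power2_eq_square)
  also have "exp \<dots> \<le> exp (- 1 / (8 * D))"
  proof -
    have "1 / 2 \<le> real (card F) / M" using F(2) M by (simp add: M_def field_simps)
    then have "(1 / 2)\<^sup>2 \<le> (real (card F) / M)\<^sup>2" by (intro power_mono) auto
    then have "(1 / 2)\<^sup>2 / (2 * D) \<le> (real (card F) / M)\<^sup>2 / (2 * D)"
      using D by (intro divide_right_mono) auto
    then show ?thesis by (simp add: power2_eq_square)
  qed
  finally show ?thesis by (simp add: E_def D_def)
qed

text \<open>
  Whether a transversal escapes W depends only on edges between W and the parts, so these are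
  exposed first. The bound is then strong enough to afford all choices of the parts and all 2^n
  sets W, because for the parameters used below the exponent from Janson's inequality exceeds n by
  a power of n.
\<close>
lemma escaping_transversal_clique_prob:
  fixes p :: real
  assumes fin: "finite V" and p: "0 < p" "p < 1" and s: "2 \<le> s" and N: "N > 0"
  shows "bprob p (vertex_pairs V)
     (\<lambda>S. \<not> (\<forall>P\<in>PiE {..<s} (\<lambda>_. {D. D \<subseteq> V \<and> card D = N}). \<forall>W\<in>Pow V.
        disjoint_family_on P {..<s} \<and> W \<inter> (\<Union>i<s. P i) = {}
          \<and> real N ^ s \<le> 2 * real (card (escaping_transversals s P W S)) \<longrightarrow>
        (\<exists>K\<in>escaping_transversals s P W S. vertex_pairs (K ` {..<s}) \<subseteq> S)))
     \<le> real (card V) ^ (N * s) * 2 ^ card V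
        * exp (- 1 / (8 * (\<Sum>j=2..s. real s ^ j / (real N ^ j * p ^ (j choose 2)))))"
proof -
  let ?A = "vertex_pairs V"
  let ?Ps = "PiE {..<s} (\<lambda>_. {D. D \<subseteq> V \<and> card D = N})"
  let ?T = "\<lambda>P W S. escaping_transversals s P W S"
  let ?bad = "\<lambda>P W S. disjoint_family_on P {..<s} \<and> W \<inter> (\<Union>i<s. P i) = {}
          \<and> real N ^ s \<le> 2 * real (card (?T P W S))
          \<and> (\<forall>K\<in>?T P W S. \<not> vertex_pairs (K ` {..<s}) \<subseteq> S)"
  let ?e = "exp (- 1 / (8 * (\<Sum>j=2..s. real s ^ j / (real N ^ j * p ^ (j choose 2)))))"
  have finPs: "finite ?Ps" using fin by (intro finite_PiE) auto
  have one: "bprob p ?A (?bad P W) \<le> ?e" if P: "P \<in> ?Ps" and W: "W \<in> Pow V" for P W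
  proof (cases "disjoint_family_on P {..<s} \<and> W \<inter> (\<Union>i<s. P i) = {}")
    case True
    define U where "U = (\<Union>i<s. P i)"
    have PV: "P i \<subseteq> V" "card (P i) = N" if "i < s" for i
    proof -
      have "P i \<in> {D. D \<subseteq> V \<and> card D = N}" using P that by (intro PiE_mem[OF P]) auto
      then show "P i \<subseteq> V" "card (P i) = N" by auto
    qed
    have U: "U \<subseteq> V" "finite U" using PV fin finite_subset[of U V] by (auto simp: U_def)
    have sub: "vertex_pairs U \<subseteq> ?A" using U by (intro vertex_pairs_mono)
    have "bprob p ?A (?bad P W) = bexp p ((?A - vertex_pairs U) \<union> vertex_pairs U) (\<lambda>S. of_bool (?bad P W S))"
      using sub by (simp add: bprob_def Un_absorb2)
    also have "\<dots> = bexp p (?A - vertex_pairs U) (\<lambda>S1. bprob p (vertex_pairs U) (\<lambda>S2. ?bad P W (S1 \<union> S2)))"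
      unfolding bprob_def using fin U by (subst bexp_union) auto
    also have "\<dots> \<le> bexp p (?A - vertex_pairs U) (\<lambda>S1. ?e)"
    proof (rule bexp_mono)
      fix S1 assume S1: "S1 \<subseteq> ?A - vertex_pairs U"
      define F where "F = ?T P W S1"
      have TF: "?T P W (S1 \<union> S2) = F" if S2: "S2 \<subseteq> vertex_pairs U" for S2
      proof -
        have "{x, v} \<notin> S2" if "v \<in> W" for x v
          using that S2 True by (auto simp: vertex_pairs_def U_def)
        then show ?thesis unfolding F_def escaping_transversals_def by auto
      qed
      have FPi: "F \<subseteq> PiE {..<s} P" by (auto simp: F_def escaping_transversals_def)
      show "bprob p (vertex_pairs U) (\<lambda>S2. ?bad P W (S1 \<union> S2)) \<le> ?e"
      proof (cases "real N ^ s \<le> 2 * real (card F)")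
        case big: True
        have "bprob p (vertex_pairs U) (\<lambda>S2. ?bad P W (S1 \<union> S2))
            \<le> bprob p (vertex_pairs U) (\<lambda>S2. \<forall>K\<in>F. \<not> vertex_pairs (K ` {..<s}) \<subseteq> S2)"
          using p by (intro bprob_mono) (auto simp: TF)
        also have "\<dots> \<le> ?e"
          using p s PV N True U big FPi
          by (intro no_transversal_clique_prob[where P=P]) (auto simp: U_def)
        finally show ?thesis .
      next
        case False
        then have "bprob p (vertex_pairs U) (\<lambda>S2. ?bad P W (S1 \<union> S2)) = bprob p (vertex_pairs U) (\<lambda>S2. False)"
          by (intro bprob_cong) (auto simp: TF)
        also have "\<dots> = 0" using U by (simp add: bprob_def bexp_const)
        finally show ?thesis by simp
      qed
    qed (use p in auto)
    also have "\<dots> = ?e" using fin by (simp add: bexp_const)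
    finally show ?thesis .
  next
    case False
    then have "bprob p ?A (?bad P W) = bprob p ?A (\<lambda>S. False)" by (intro bprob_cong) auto
    also have "\<dots> = 0" using fin by (simp add: bprob_def bexp_const)
    finally show ?thesis by simp
  qed
  have "bprob p ?A
     (\<lambda>S. \<not> (\<forall>P\<in>?Ps. \<forall>W\<in>Pow V.
        disjoint_family_on P {..<s} \<and> W \<inter> (\<Union>i<s. P i) = {} \<and> real N ^ s \<le> 2 * real (card (?T P W S)) \<longrightarrow>
        (\<exists>K\<in>?T P W S. vertex_pairs (K ` {..<s}) \<subseteq> S)))
     \<le> bprob p ?A (\<lambda>S. \<exists>i\<in>?Ps \<times> Pow V. ?bad (fst i) (snd i) S)"
    using p by (intro bprob_mono) auto
  also have "\<dots> \<le> (\<Sum>i\<in>?Ps \<times> Pow V. bprob p ?A (?bad (fst i) (snd i)))"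
    using p fin finPs by (intro bprob_union_bound) auto
  also have "\<dots> \<le> (\<Sum>i\<in>?Ps \<times> Pow V. ?e)"
    using one by (intro sum_mono) auto
  also have "\<dots> = real (card ?Ps * card (Pow V)) * ?e" by (simp add: card_cartesian_product)
  also have "\<dots> \<le> real (card V ^ (N * s) * 2 ^ card V) * ?e"
  proof (intro mult_right_mono of_nat_mono mult_mono)
    have "card ?Ps = card {D. D \<subseteq> V \<and> card D = N} ^ s"
      by (subst card_PiE) auto
    also have "\<dots> \<le> (card V ^ N) ^ s"
      by (intro power_mono card_sized_subsets_le[OF fin]) auto
    finally show "card ?Ps \<le> card V ^ (N * s)" by (simp add: power_mult)
    show "card (Pow V) \<le> 2 ^ card V" using fin by (simp add: card_Pow)
  qed auto
  finally show ?thesis by simp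
qed

section \<open>Colour classes without maximal cliques\<close>

text \<open>
  Greedy choice: together the earlier parts have too few vertices to exhaust T i.
\<close>
lemma extend_disjoint_parts:
  assumes N: "N > 0"
    and P: "\<And>i. i < q \<Longrightarrow> card (P i) = N" "disjoint_family_on P {..<q}"
    and T: "\<And>i. q \<le> i \<Longrightarrow> i < q + r \<Longrightarrow> finite (T i) \<and> (q + r) * N \<le> card (T i)"
  shows "\<exists>P'. (\<forall>i<q. P' i = P i) \<and> (\<forall>i. q \<le> i \<longrightarrow> i < q + r \<longrightarrow> P' i \<subseteq> T i)
      \<and> (\<forall>i<q + r. card (P' i) = N) \<and> disjoint_family_on P' {..<q + r}"
  using T
proof (induction r)
  case 0
  then show ?case using P by (intro exI[of _ P]) auto
next
  case (Suc r)
  have "finite (T i) \<and> (q + r) * N \<le> card (T i)" if "q \<le> i" "i < q + r" for i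
    using Suc.prems[of i] that by auto
  from Suc.IH[OF this] obtain P' where P':
    "\<forall>i<q. P' i = P i" "\<forall>i. q \<le> i \<longrightarrow> i < q + r \<longrightarrow> P' i \<subseteq> T i"
    "\<forall>i<q + r. card (P' i) = N" "disjoint_family_on P' {..<q + r}" by auto
  define Y where "Y = (\<Union>i<q + r. P' i)"
  have "card Y \<le> (\<Sum>i<q + r. card (P' i))" unfolding Y_def by (rule card_UN_le) simp
  also have "\<dots> = (q + r) * N" using P'(3) by simp
  finally have Y: "card Y \<le> (q + r) * N" .
  have "(q + Suc r) * N \<le> card (T (q + r))"
    using Suc.prems[of "q + r"] by simp
  with Y have "(q + Suc r) * N - (q + r) * N \<le> card (T (q + r)) - card Y"
    by linarith
  also have "\<dots> \<le> card (T (q + r) - Y)" by (rule diff_card_le_card_Diff)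
     (use P'(3) N in \<open>auto simp: Y_def intro!: card_ge_0_finite\<close>)
  finally have "N \<le> card (T (q + r) - Y)" by (simp add: algebra_simps)
  then obtain Z where Z: "Z \<subseteq> T (q + r) - Y" "card Z = N"
    by (rule obtain_subset_with_card_n) 
  show ?case
  proof (intro exI[of _ "P'(q + r := Z)"] conjI allI impI)
    fix i
    { assume "i < q" then show "(P'(q + r := Z)) i = P i" using P' by auto }
    { assume "q \<le> i" "i < q + Suc r" then show "(P'(q + r := Z)) i \<subseteq> T i"
        using P' Z by (cases "i = q + r") auto }
    { assume "i < q + Suc r" then show "card ((P'(q + r := Z)) i) = N"
        using P' Z by (cases "i = q + r") auto }
  next
    show "disjoint_family_on (P'(q + r := Z)) {..<q + Suc r}"
      unfolding disjoint_family_on_def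
    proof (intro ballI impI)
      fix i j assume ij: "i \<in> {..<q + Suc r}" "j \<in> {..<q + Suc r}" "i \<noteq> j"
      have ZP: "Z \<inter> P' i = {}" if "i < q + r" for i using Z that by (auto simp: Y_def)
      consider "i = q + r" "j < q + r" | "j = q + r" "i < q + r" | "i < q + r" "j < q + r"
        using ij by (cases "i = q + r"; cases "j = q + r") auto
      then show "(P'(q + r := Z)) i \<inter> (P'(q + r := Z)) j = {}"
      proof cases
        case 1
        then show ?thesis using ZP[of j] by simp
      next
        case 2
        then show ?thesis using ZP[of i] by (simp add: Int_commute)
      next
        case 3
        then show ?thesis using P'(4) ij(3) by (auto simp: disjoint_family_on_def)
      qed
    qed
  qed
qed

lemma prod_le_exp_sum:
  fixes x :: "'i \<Rightarrow> real"
  assumes "\<And>i. i \<in> I \<Longrightarrow> 0 \<le> x i"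
  shows "(\<Prod>i\<in>I. x i) \<le> exp (\<Sum>i\<in>I. x i - 1)"
proof (cases "finite I")
  case True
  have "x i \<le> exp (x i - 1)" for i
    using exp_ge_add_one_self[of "x i - 1"] by simp
  then have "(\<Prod>i\<in>I. x i) \<le> (\<Prod>i\<in>I. exp (x i - 1))"
    using assms by (intro prod_mono) auto
  also have "\<dots> = exp (\<Sum>i\<in>I. x i - 1)" using True by (simp add: exp_sum)
  finally show ?thesis .
qed simp

text \<open>
  A clique in C without common neighbour outside C can only be extended inside C, so a largest
  extension inside C is maximal in the whole graph.
\<close>
lemma maximal_clique_within:
  assumes fin: "finite V" and C: "C \<subseteq> V" and K0: "clique (V, S) K0" "K0 \<subseteq> C"
    and esc: "\<And>v. v \<in> V - C \<Longrightarrow> \<exists>u\<in>K0. {u, v} \<notin> S"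
  shows "\<exists>K. maximal_clique (V, S) K \<and> K0 \<subseteq> K \<and> K \<subseteq> C"
proof -
  let ?A = "{K. clique (V, S) K \<and> K \<subseteq> C}"
  have "finite ?A" using fin C by (intro finite_subset[of ?A "Pow V"]) auto
  moreover have "K0 \<in> ?A" using K0 by auto
  ultimately obtain K where K: "K \<in> ?A" "K0 \<subseteq> K" "\<And>L. L \<in> ?A \<Longrightarrow> K \<subseteq> L \<Longrightarrow> K = L"
    using finite_has_maximal2[of ?A K0] by auto
  have "L = K" if L: "clique (V, S) L" "K \<subseteq> L" for L
  proof -
    have "L \<subseteq> C"
    proof
      fix v assume v: "v \<in> L"
      show "v \<in> C"
      proof (rule ccontr)
        assume nC: "v \<notin> C"
        then have "v \<in> V - C" using v L by (auto simp: clique_def)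
        from esc[OF this] obtain u where u: "u \<in> K0" "{u, v} \<notin> S" by auto
        then have "u \<in> L" "u \<noteq> v" using K L K0 nC by auto
        with v L(1) u show False by (auto simp: clique_def)
      qed
    qed
    with L K(3)[of L] show ?thesis by auto
  qed
  then have "maximal_clique (V, S) K" using K(1) by (simp add: maximal_clique_def)
  with K show ?thesis by blast
qed

text \<open>
  The sum is the expected number of vertices of W adjacent to all of a random transversal.
\<close>
lemma escaping_transversals_majority:
  fixes S :: "'a set set" and P :: "nat \<Rightarrow> 'a set" and W :: "'a set"
  assumes N: "N > 0" and P: "\<And>i. i < s \<Longrightarrow> card (P i) = N" and W: "finite W"
    and sum: "(\<Sum>v\<in>W. \<Prod>i<s. real (card {u\<in>P i. {u, v} \<in> S}) / real N) \<le> 1 / 2"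
  shows "real N ^ s \<le> 2 * real (card (escaping_transversals s P W S))"
proof -
  let ?E = "escaping_transversals s P W S" and ?Pi = "PiE {..<s} P"
  let ?B = "\<lambda>v. PiE {..<s} (\<lambda>i. {u\<in>P i. {u, v} \<in> S})"
  have finP: "finite (P i)" if "i < s" for i
    using P that N by (metis card.infinite less_numeral_extra(3))
  have fin: "finite ?Pi" using finP by (intro finite_PiE) auto
  have finB: "finite (?B v)" for v using finP by (intro finite_PiE) auto
  have sub: "?Pi \<subseteq> ?E \<union> (\<Union>v\<in>W. ?B v)"
  proof
    fix K assume K: "K \<in> ?Pi"
    show "K \<in> ?E \<union> (\<Union>v\<in>W. ?B v)"
    proof (cases "K \<in> ?E")
      case False
      then obtain v where v: "v \<in> W" "\<forall>i<s. {K i, v} \<in> S"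
        using K by (auto simp: escaping_transversals_def)
      have "K \<in> ?B v"
      proof (rule PiE_I)
        fix i assume "i \<in> {..<s}"
        then show "K i \<in> {u\<in>P i. {u, v} \<in> S}" using K v PiE_mem[OF K] by auto
      qed (use K in auto)
      with v show ?thesis by auto
    qed simp
  qed
  have finE: "finite ?E" using fin by (auto simp: escaping_transversals_def)
  have "real (card ?Pi) \<le> real (card ?E) + (\<Sum>v\<in>W. real (card (?B v)))"
  proof -
    have "card ?Pi \<le> card (?E \<union> (\<Union>v\<in>W. ?B v))"
      using sub finE finB W by (intro card_mono) auto
    also have "\<dots> \<le> card ?E + (\<Sum>v\<in>W. card (?B v))"
      using card_UN_le[OF W, of ?B] by (intro order_trans[OF card_Un_le]) auto
    finally show ?thesis by (simp flip: of_nat_sum of_nat_add)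
  qed
  also have "(\<Sum>v\<in>W. real (card (?B v))) = real N ^ s * (\<Sum>v\<in>W. \<Prod>i<s. real (card {u\<in>P i. {u, v} \<in> S}) / real N)"
    using N by (simp add: sum_distrib_left card_PiE prod_dividef)
  also have "\<dots> \<le> real N ^ s * (1 / 2)" using sum by (intro mult_left_mono) auto
  also have "real (card ?Pi) = real N ^ s" using P by (simp add: card_PiE)
  finally show ?thesis by simp
qed

text \<open>
  If C were not dominated, parts inside C could be found for which at least half of the
  transversals have no common neighbour outside C. One of these would be a clique and would lead
  to a maximal clique in C.
\<close>
lemma colour_class_dominated:
  fixes V :: "'a set" and \<beta> R \<theta> :: real
  assumes fin: "finite V" and s: "2 \<le> s" "q \<le> s" and N: "N > 0" and R: "0 \<le> R"
    and \<beta>: "0 \<le> \<beta>"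
    and large: "s * N \<le> card V"
    and heavy: "\<forall>D\<in>{D. D \<subseteq> V \<and> card D = N}. \<forall>B\<in>Pow (V - D).
        (\<forall>v\<in>B. \<beta> * real N \<le> real (card {u\<in>D. {u, v} \<in> S})) \<longrightarrow>
        (\<Sum>v\<in>B. real (card {u\<in>D. {u, v} \<in> S})) \<le> R * real N"
    and dense: "\<forall>D\<in>{D. D \<subseteq> V \<and> card D = q * N}. \<forall>A\<in>{A. A \<subseteq> V - D \<and> card A = s - q + 1}.
        \<exists>v\<in>A. real (card {u\<in>D. {u, v} \<in> S}) < \<theta> * real (q * N)"
    and trans: "\<forall>P\<in>PiE {..<s} (\<lambda>_. {D. D \<subseteq> V \<and> card D = N}). \<forall>W\<in>Pow V.
        disjoint_family_on P {..<s} \<and> W \<inter> (\<Union>i<s. P i) = {}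
          \<and> real N ^ s \<le> 2 * real (card (escaping_transversals s P W S)) \<longrightarrow>
        (\<exists>K\<in>escaping_transversals s P W S. vertex_pairs (K ` {..<s}) \<subseteq> S)"
    and num: "real (card V) * \<beta> ^ s + real s * R * exp (1 - (1 - \<theta>) * real q) \<le> 1 / 2"
    and C: "C \<subseteq> V" "\<And>K. maximal_clique (V, S) K \<Longrightarrow> 2 \<le> card K \<Longrightarrow> \<not> K \<subseteq> C"
  shows "\<exists>v\<in>V - C. card {u\<in>C. {u, v} \<notin> S} < s * N"
proof (rule ccontr)
  assume "\<not> ?thesis"
  then have far: "s * N \<le> card {u\<in>C. {u, v} \<notin> S}" if "v \<in> V - C" for v
    using that by (meson not_less)
  have finC: "finite C" using C fin finite_subset by auto
  have cardC: "s * N \<le> card C"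
  proof (cases "V = C")
    case False
    then obtain v where "v \<in> V - C" using C by auto
    from far[OF this] show ?thesis
      using card_mono[OF finC, of "{u\<in>C. {u, v} \<notin> S}"] by auto
  qed (use large in simp)
  define d where "d D v = real (card {u\<in>D. {u, v} \<in> S})" for D v
  have "finite C \<and> (0 + q) * N \<le> card C"
    using cardC finC le_trans[OF mult_le_mono1[OF s(2), of N]] by simp
  then obtain P0 where P0: "\<forall>i<q. P0 i \<subseteq> C" "\<forall>i<q. card (P0 i) = N" "disjoint_family_on P0 {..<q}"
    using extend_disjoint_parts[OF N, of 0 "\<lambda>_. {}" q "\<lambda>_. C"] by (auto simp: disjoint_family_on_def)
  define U0 where "U0 = (\<Union>i<q. P0 i)"
  have fP0: "finite (P0 i)" if "i < q" for i using P0(1) that finC finite_subset by blast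
  have U0: "U0 \<subseteq> C" "card U0 = q * N"
  proof -
    show "U0 \<subseteq> C" using P0 by (auto simp: U0_def)
    have "card U0 = (\<Sum>i<q. card (P0 i))"
      unfolding U0_def using P0 fP0 by (intro card_UN_disjoint') auto
    then show "card U0 = q * N" using P0 by simp
  qed
  \<comment> \<open>The exceptional vertices, which are adjacent to nearly all of the first q parts.\<close>
  define A where "A = {v\<in>V - C. \<theta> * real (q * N) \<le> d U0 v}"
  have cardA: "card A \<le> s - q"
  proof (rule ccontr)
    assume "\<not> ?thesis"
    then have "s - q + 1 \<le> card A" by simp
    then obtain A' where A': "A' \<subseteq> A" "card A' = s - q + 1"
      by (rule obtain_subset_with_card_n)
    then have "A' \<in> {A. A \<subseteq> V - U0 \<and> card A = s - q + 1}" "U0 \<in> {D. D \<subseteq> V \<and> card D = q * N}"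
      using U0 C by (auto simp: A_def)
    with dense obtain v where "v \<in> A'" "d U0 v < \<theta> * real (q * N)"
      unfolding d_def by blast
    with A' show False by (auto simp: A_def)
  qed
  have finA: "finite A" using fin by (auto simp: A_def)
  obtain a where a: "bij_betw a {..<card A} A"
    using ex_bij_betw_nat_finite[OF finA] by (auto simp: atLeast0LessThan)
  \<comment> \<open>Part q + i is to avoid the neighbourhood of the i-th exceptional vertex; parts left
    over are arbitrary.\<close>
  define T where "T i = (if i - q < card A then {u\<in>C. {u, a (i - q)} \<notin> S} else C)" for i
  have "finite (T i) \<and> (q + (s - q)) * N \<le> card (T i)" for i
  proof -
    have "a (i - q) \<in> V - C" if "i - q < card A"
      using a that by (auto simp: bij_betw_def A_def)
    then show ?thesis using far cardC finC s by (auto simp: T_def)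
  qed
  then obtain P1 where P1: "\<forall>i<q. P1 i = P0 i" "\<forall>i. q \<le> i \<longrightarrow> i < s \<longrightarrow> P1 i \<subseteq> T i"
      "\<forall>i<s. card (P1 i) = N" "disjoint_family_on P1 {..<s}"
    using extend_disjoint_parts[OF N, of q P0 "s - q" T] P0 s by auto
  define P where "P = restrict P1 {..<s}"
  have PC: "P i \<subseteq> C" and cardP: "card (P i) = N" if "i < s" for i
  proof -
    show "P i \<subseteq> C"
    proof (cases "i < q")
      case True
      then show ?thesis using P1(1) P0(1) that by (auto simp: P_def)
    next
      case False
      then have "P i \<subseteq> T i" using P1(2) that by (auto simp: P_def)
      also have "T i \<subseteq> C" by (auto simp: T_def)
      finally show ?thesis .
    qed
    show "card (P i) = N" using P1(3) that by (simp add: P_def)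
  qed
  have disjP: "disjoint_family_on P {..<s}"
    using P1(4) by (auto simp: P_def disjoint_family_on_def)
  have PP: "P \<in> PiE {..<s} (\<lambda>_. {D. D \<subseteq> V \<and> card D = N})"
    using PC cardP C by (auto simp: P_def PiE_def extensional_def)
  have finP: "finite (P i)" if "i < s" for i using PC[OF that] finC finite_subset by auto
  define W where "W = V - C"
  have finW: "finite W" using fin by (simp add: W_def)
  define x where "x i v = d (P i) v / real N" for i v
  have x01: "0 \<le> x i v" "x i v \<le> 1" if "i < s" for i v
  proof -
    have "card {u\<in>P i. {u, v} \<in> S} \<le> N"
      using card_mono[OF finP[OF that], of "{u\<in>P i. {u, v} \<in> S}"] cardP[OF that] by auto
    then show "0 \<le> x i v" "x i v \<le> 1" using N by (auto simp: x_def d_def)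
  qed
  let ?e = "exp (1 - (1 - \<theta>) * real q)"
  \<comment> \<open>An exceptional vertex has density 0 into its own part. Any other vertex has either all
    densities below \<beta>, or a density at least \<beta> into some part j, which is kept
    as a factor, while the other densities among the first q parts multiply to an
    exponentially small number.\<close>
  have bound: "(\<Prod>i<s. x i v) \<le> \<beta> ^ s + (\<Sum>j<s. (if \<beta> \<le> x j v then x j v else 0) * ?e)"
    if v: "v \<in> W" for v
  proof -
    have nn: "0 \<le> (\<Sum>j<s. (if \<beta> \<le> x j v then x j v else 0) * ?e)"
      using x01 by (intro sum_nonneg) auto
    consider "v \<in> A" | "v \<notin> A" "\<forall>j<s. x j v < \<beta>" | j where "v \<notin> A" "j < s" "\<beta> \<le> x j v"
      by fastforce
    then show ?thesis
    proof cases
      case 1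
      then have "v \<in> a ` {..<card A}" using a by (simp add: bij_betw_def)
      then obtain i where i: "i < card A" "a i = v" by auto
      then have "P1 (q + i) \<subseteq> T (q + i)" using P1(2) cardA by auto
      then have "{u\<in>P (q + i). {u, v} \<in> S} = {}"
        using i cardA by (auto simp: P_def T_def)
      then have "x (q + i) v = 0" unfolding x_def d_def by (simp only: card.empty)
      moreover have "q + i < s" using i cardA by simp
      ultimately have "(\<Prod>i<s. x i v) = 0" by (intro prod_zero) auto
      moreover have "0 \<le> \<beta> ^ s" using \<beta> by simp
      ultimately show ?thesis using nn by linarith
    next
      case 2
      have "(\<Prod>i<s. x i v) \<le> (\<Prod>i<s. \<beta>)" using 2 x01 by (intro prod_mono) auto
      with nn show ?thesis by simp
    next
      case (3 j)
      let ?I = "{..<q} - {j}"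
      \<comment> \<open>The part j need not be among the first q, so up to one of these is lost; this is
        the 1 in the exponent.\<close>
      have "(\<Prod>i<s. x i v) = x j v * (\<Prod>i\<in>{..<s} - {j}. x i v)"
        using 3 by (intro prod.remove) auto
      also have "(\<Prod>i\<in>{..<s} - {j}. x i v) = (\<Prod>i\<in>({..<s} - {j}) - ?I. x i v) * (\<Prod>i\<in>?I. x i v)"
        using s by (intro prod.subset_diff) auto
      also have "\<dots> \<le> 1 * (\<Prod>i\<in>?I. x i v)"
        using x01 s by (intro mult_right_mono prod_le_1 prod_nonneg) auto
      also have "(\<Prod>i\<in>?I. x i v) \<le> exp (\<Sum>i\<in>?I. x i v - 1)"
        using x01 s by (intro prod_le_exp_sum) auto
      also have "(\<Sum>i\<in>?I. x i v - 1) \<le> 1 - (1 - \<theta>) * real q"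
      proof -
        have xq: "x i v = d (P0 i) v / real N" if "i < q" for i
          using that s P1(1) by (simp add: x_def P_def)
        have "(\<Sum>i<q. d (P0 i) v) = d U0 v"
        proof -
          have "{u\<in>U0. {u, v} \<in> S} = (\<Union>i<q. {u\<in>P0 i. {u, v} \<in> S})" by (auto simp: U0_def)
          moreover have "disjoint_family_on (\<lambda>i. {u\<in>P0 i. {u, v} \<in> S}) {..<q}"
            using P0(3) by (fastforce simp: disjoint_family_on_def)
          ultimately have "card {u\<in>U0. {u, v} \<in> S} = (\<Sum>i<q. card {u\<in>P0 i. {u, v} \<in> S})"
            using fP0 by (simp only:) (intro card_UN_disjoint', auto)
          then show ?thesis by (simp add: d_def)
        qed
        also have "\<dots> < \<theta> * real (q * N)" using 3 v by (auto simp: A_def W_def)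
        finally have "(\<Sum>i<q. d (P0 i) v) / real N \<le> \<theta> * real q"
          using N by (simp add: field_simps)
        moreover have "(\<Sum>i<q. x i v) = (\<Sum>i<q. d (P0 i) v) / real N"
          using xq by (simp add: sum_divide_distrib)
        ultimately have "(\<Sum>i<q. x i v) \<le> \<theta> * real q" by simp
        then have "(\<Sum>i<q. x i v - 1) \<le> - (1 - \<theta>) * real q"
          by (simp add: sum_subtractf algebra_simps)
        moreover have "(\<Sum>i\<in>?I. x i v - 1) \<le> (\<Sum>i<q. x i v - 1) + 1"
          using x01[OF 3(2), of v] by (subst sum_diff1) auto
        ultimately show ?thesis by (simp add: algebra_simps)
      qed
      finally have "(\<Prod>i<s. x i v) \<le> x j v * ?e"
        using x01[OF 3(2), of v] by (simp add: mult_left_mono)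
      also have "\<dots> = (if \<beta> \<le> x j v then x j v else 0) * ?e" using 3 by simp
      also have "\<dots> \<le> (\<Sum>j<s. (if \<beta> \<le> x j v then x j v else 0) * ?e)"
        using 3 x01 by (intro member_le_sum) auto
      also have "\<dots> \<le> \<beta> ^ s + \<dots>" using \<beta> by simp
      finally show ?thesis .
    qed
  qed
  have hs: "(\<Sum>v\<in>W. if \<beta> \<le> x j v then x j v else 0) \<le> R" if j: "j < s" for j
  proof -
    let ?B = "{v\<in>W. \<beta> \<le> x j v}"
    have "P j \<in> {D. D \<subseteq> V \<and> card D = N}" using PiE_mem[OF PP, of j] j by auto
    moreover have "?B \<in> Pow (V - P j)" using PC[OF j] by (auto simp: W_def)
    moreover have "\<forall>v\<in>?B. \<beta> * real N \<le> real (card {u\<in>P j. {u, v} \<in> S})"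
      using N by (auto simp: x_def d_def field_simps)
    ultimately have "(\<Sum>v\<in>?B. d (P j) v) \<le> R * real N"
      using heavy unfolding d_def by blast
    then have "(\<Sum>v\<in>?B. x j v) \<le> R"
      using N by (simp add: x_def sum_divide_distrib[symmetric] field_simps)
    then show ?thesis using finW by (subst sum.inter_filter[symmetric]) auto
  qed
  have "(\<Sum>v\<in>W. \<Prod>i<s. x i v) \<le> (\<Sum>v\<in>W. \<beta> ^ s + (\<Sum>j<s. (if \<beta> \<le> x j v then x j v else 0) * ?e))"
    by (intro sum_mono bound)
  also have "\<dots> = real (card W) * \<beta> ^ s + (\<Sum>j<s. (\<Sum>v\<in>W. if \<beta> \<le> x j v then x j v else 0) * ?e)"
    by (simp add: sum.distrib sum_distrib_right) (rule sum.swap)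
  also have "\<dots> \<le> real (card V) * \<beta> ^ s + (\<Sum>j<s. R * ?e)"
    using hs \<beta> fin by (intro add_mono mult_right_mono sum_mono) (auto simp: W_def intro!: card_mono)
  also have "\<dots> \<le> 1 / 2" using num by simp
  finally have "(\<Sum>v\<in>W. \<Prod>i<s. x i v) \<le> 1 / 2" .
  then have "real N ^ s \<le> 2 * real (card (escaping_transversals s P W S))"
    using N cardP finW by (intro escaping_transversals_majority) (auto simp: x_def d_def)
  moreover have "W \<inter> (\<Union>i<s. P i) = {}" using PC by (auto simp: W_def)
  moreover have "W \<in> Pow V" by (auto simp: W_def)
  ultimately obtain K where K: "K \<in> escaping_transversals s P W S" "vertex_pairs (K ` {..<s}) \<subseteq> S"
    using bspec[OF bspec[OF trans PP], of W] disjP by auto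
  have KPi: "K \<in> PiE {..<s} P" using K by (auto simp: escaping_transversals_def)
  have Ki: "K i \<in> P i" if "i < s" for i using PiE_mem[OF KPi] that by simp
  have KC: "K ` {..<s} \<subseteq> C" using Ki PC by blast
  have esc: "\<exists>u\<in>K ` {..<s}. {u, v} \<notin> S" if "v \<in> V - C" for v
    using K(1) that by (auto simp: escaping_transversals_def W_def)
  obtain L where L: "maximal_clique (V, S) L" "K ` {..<s} \<subseteq> L" "L \<subseteq> C"
    using maximal_clique_within[OF fin C(1) _ KC esc] KC C(1) K(2) by (auto simp: clique_iff)
  have "inj_on K {..<s}"
  proof (rule inj_onI)
    fix i j assume ij: "i \<in> {..<s}" "j \<in> {..<s}" "K i = K j"
    show "i = j"
    proof (rule ccontr)
      assume "i \<noteq> j"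
      then have "P i \<inter> P j = {}" using disjP ij by (auto simp: disjoint_family_on_def)
      with Ki[of i] Ki[of j] ij show False by auto
    qed
  qed
  then have "card (K ` {..<s}) = s" by (simp add: card_image)
  moreover have "card (K ` {..<s}) \<le> card L"
    using L finC finite_subset by (intro card_mono) auto
  ultimately have "2 \<le> card L" using s by simp
  with C(2) L show False by blast
qed

text \<open>
  The k dominating vertices have at most k m common non-neighbours, as every vertex is adjacent to
  the one that dominates its own class unless it is among the fewer than m exceptions.
\<close>
lemma no_clique_coloring_if_classes_dominated:
  assumes fin: "finite V"
    and dom: "\<And>C. C \<subseteq> V \<Longrightarrow> (\<And>K. maximal_clique (V, S) K \<Longrightarrow> 2 \<le> card K \<Longrightarrow> \<not> K \<subseteq> C) \<Longrightarrow>
       \<exists>v\<in>V - C. card {u\<in>C. {u, v} \<notin> S} < m"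
    and nonn: "\<forall>T X. T \<subseteq> V \<longrightarrow> X \<subseteq> V \<longrightarrow> card T \<le> k \<longrightarrow> card X \<le> k * m \<longrightarrow>
            (\<exists>v\<in>V - T - X. \<forall>u\<in>T. {u, v} \<notin> S)"
  shows "\<not> clique_coloring (V, S) k c"
proof
  assume c: "clique_coloring (V, S) k c"
  define C where "C i = {v\<in>V. c v = i}" for i
  have "\<exists>v\<in>V - C i. card {u\<in>C i. {u, v} \<notin> S} < m" for i
  proof (rule dom)
    fix K assume "maximal_clique (V, S) K" "2 \<le> card K"
    then have "\<not> monochromatic c K" using c by (auto simp: clique_coloring_def)
    then show "\<not> K \<subseteq> C i" unfolding monochromatic_def C_def by blast
  qed (auto simp: C_def)
  then obtain w where w: "\<And>i. w i \<in> V - C i" "\<And>i. card {u\<in>C i. {u, w i} \<notin> S} < m" by metis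
  define T where "T = w ` {..<k}"
  define X where "X = (\<Union>i<k. {u\<in>C i. {u, w i} \<notin> S})"
  have "card T \<le> k" unfolding T_def using card_image_le[of "{..<k}" w] by simp
  moreover have "card X \<le> k * m"
  proof -
    have "card X \<le> (\<Sum>i<k. card {u\<in>C i. {u, w i} \<notin> S})" unfolding X_def by (rule card_UN_le) simp
    also have "\<dots> \<le> (\<Sum>i<k. m)" using w(2) by (intro sum_mono) (simp add: less_imp_le)
    finally show ?thesis by simp
  qed
  moreover have "T \<subseteq> V" "X \<subseteq> V" using w(1) by (auto simp: T_def X_def C_def)
  ultimately obtain v where v: "v \<in> V - T - X" "\<forall>u\<in>T. {u, v} \<notin> S" using nonn by blast
  have "c v < k" using c v by (auto simp: clique_coloring_def)
  then have "{w (c v), v} \<notin> S" "v \<in> C (c v)" using v by (auto simp: T_def C_def)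
  then have "v \<in> X" using \<open>c v < k\<close> by (auto simp: X_def insert_commute)
  with v show False by simp
qed

lemma lower_bound_prob:
  fixes V :: "'a set" and p b \<beta> R \<theta> l \<kappa> :: real
  assumes fin: "finite V" and p: "0 < p" "p < 1" "p = exp (- b)"
    and s: "2 \<le> s" "q \<le> s" and N: "N > 0" and R: "0 \<le> R" and \<beta>: "0 < \<beta>"
    and l: "0 \<le> l" "p * exp l / \<beta> + \<kappa> \<le> l" "0 \<le> \<kappa>"
      "real (card V) * exp (- \<kappa> * \<beta> * real N / 2) \<le> 1"
    and large: "s * N \<le> card V" "k + k * (s * N) \<le> card V"
    and num: "real (card V) * \<beta> ^ s + real s * R * exp (1 - (1 - \<theta>) * real q) \<le> 1 / 2"
  shows "bprob p (vertex_pairs V) (\<lambda>S. \<exists>c. clique_coloring (V, S) k c)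
     \<le> real (card V) ^ (k + k * (s * N)) * (1 - (1 - p) ^ k) ^ (card V - k - k * (s * N))
      + real (card V) ^ N * (exp 1 * exp (- \<kappa> * R * real N / 2))
      + real (card V choose (q * N)) * real (card V) ^ (s - q + 1)
          * exp (real (s - q + 1) * real (q * N) * (1 - \<theta> * b))
      + real (card V) ^ (N * s) * 2 ^ card V
          * exp (- 1 / (8 * (\<Sum>j=2..s. real s ^ j / (real N ^ j * p ^ (j choose 2)))))"
proof -
  let ?A = "vertex_pairs V"
  let ?E1 = "\<lambda>S. \<forall>T X. T \<subseteq> V \<longrightarrow> X \<subseteq> V \<longrightarrow> card T \<le> k \<longrightarrow> card X \<le> k * (s * N) \<longrightarrow>
            (\<exists>v\<in>V - T - X. \<forall>u\<in>T. {u, v} \<notin> S)"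
  let ?E2 = "\<lambda>S. \<forall>D\<in>{D. D \<subseteq> V \<and> card D = N}. \<forall>B\<in>Pow (V - D).
        (\<forall>v\<in>B. \<beta> * real N \<le> real (card {u\<in>D. {u, v} \<in> S})) \<longrightarrow>
        (\<Sum>v\<in>B. real (card {u\<in>D. {u, v} \<in> S})) \<le> R * real N"
  let ?E3 = "\<lambda>S. \<forall>D\<in>{D. D \<subseteq> V \<and> card D = q * N}. \<forall>A\<in>{A. A \<subseteq> V - D \<and> card A = s - q + 1}.
        \<exists>v\<in>A. real (card {u\<in>D. {u, v} \<in> S}) < \<theta> * real (q * N)"
  let ?E4 = "\<lambda>S. \<forall>P\<in>PiE {..<s} (\<lambda>_. {D. D \<subseteq> V \<and> card D = N}). \<forall>W\<in>Pow V.
        disjoint_family_on P {..<s} \<and> W \<inter> (\<Union>i<s. P i) = {}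
          \<and> real N ^ s \<le> 2 * real (card (escaping_transversals s P W S)) \<longrightarrow>
        (\<exists>K\<in>escaping_transversals s P W S. vertex_pairs (K ` {..<s}) \<subseteq> S)"
  have p': "0 \<le> p" "p \<le> 1" using p by auto
  have "bprob p ?A (\<lambda>S. \<exists>c. clique_coloring (V, S) k c)
     \<le> bprob p ?A (\<lambda>S. ((\<not> ?E1 S \<or> \<not> ?E2 S) \<or> \<not> ?E3 S) \<or> \<not> ?E4 S)"
  proof (rule bprob_mono[OF p'])
    fix S assume col: "\<exists>c. clique_coloring (V, S) k c"
    show "((\<not> ?E1 S \<or> \<not> ?E2 S) \<or> \<not> ?E3 S) \<or> \<not> ?E4 S"
    proof (rule ccontr)
      assume neg: "\<not> (((\<not> ?E1 S \<or> \<not> ?E2 S) \<or> \<not> ?E3 S) \<or> \<not> ?E4 S)"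
      have E: "?E1 S" "?E2 S" "?E3 S" "?E4 S" using neg by satx+
      have "\<not> clique_coloring (V, S) k c" for c
      proof (rule no_clique_coloring_if_classes_dominated[OF fin _ E(1)])
        fix C assume C: "C \<subseteq> V" "\<And>K. maximal_clique (V, S) K \<Longrightarrow> 2 \<le> card K \<Longrightarrow> \<not> K \<subseteq> C"
        show "\<exists>v\<in>V - C. card {u\<in>C. {u, v} \<notin> S} < s * N"
          by (rule colour_class_dominated[OF fin s N R less_imp_le[OF \<beta>] large(1) E(2,3,4) num C])
      qed
      with col show False by blast
    qed
  qed
  also have "\<dots> \<le> bprob p ?A (\<lambda>S. \<not> ?E1 S) + bprob p ?A (\<lambda>S. \<not> ?E2 S)
      + bprob p ?A (\<lambda>S. \<not> ?E3 S) + bprob p ?A (\<lambda>S. \<not> ?E4 S)"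
    by (rule order_trans[OF bprob_disj[OF p']], rule add_right_mono,
        rule order_trans[OF bprob_disj[OF p']], rule add_right_mono, rule bprob_disj[OF p'])
  finally show ?thesis
    using common_nonneighbour_prob[OF fin p' large(2)]
      heavy_degree_sum_prob[OF fin p(1,2) l(1) \<beta> l(2,3,4), of R]
      dense_vertices_prob[OF fin p(1,2,3), of "q * N" "s - q + 1" \<theta>]
      escaping_transversal_clique_prob[OF fin p(1,2) s(1) N]
    by linarith
qed

section \<open>Size of the error terms\<close>

lemma one_minus_power_le_exp: "0 \<le> q \<Longrightarrow> q \<le> 1 \<Longrightarrow> (1 - q) ^ m \<le> exp (- (q * real m))" for q :: real
proof -
  assume q: "0 \<le> q" "q \<le> 1"
  have "(1 - q) ^ m \<le> exp (- q) ^ m"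
    using q exp_ge_add_one_self[of "- q"] by (intro power_mono) auto
  then show ?thesis by (simp add: exp_of_nat_mult[symmetric] mult.commute)
qed

lemma real_power_eq_exp: "(y :: real) = exp x \<Longrightarrow> y ^ m = exp (real m * x)"
  by (simp add: exp_of_nat_mult)

lemma choose_two_real: "real (j choose 2) = real j * (real j - 1) / 2"
  by (cases j) (auto simp: choose_two real_of_nat_div algebra_simps)

text \<open>
  From m^m / m! being a term of the series of exp m.
\<close>
lemma binomial_le_exp_bound:
  assumes "0 < m"
  shows "real (n choose m) \<le> (exp 1 * real n / real m) ^ m"
proof -
  have "real m ^ m / fact m \<le> exp (real m)"
  proof -
    have "(\<lambda>k. real m ^ k / fact k) sums exp (real m)"
      using exp_converges[of "real m"] by (simp add: field_simps)
    then show ?thesis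
      using sum_le_suminf[of "\<lambda>k. real m ^ k / fact k" "{m}"] by (simp add: sums_iff)
  qed
  then have "1 / fact m \<le> exp (real m) / real m ^ m"
    using assms by (simp add: field_simps)
  moreover have "real (n choose m) \<le> real n ^ m * (1 / fact m)"
  proof (cases "m \<le> n")
    case True
    have "real (n choose m) = (fact n / fact (n - m)) * (1 / fact m)"
      using binomial_fact[OF True, where ?'a=real] by (simp add: mult.commute)
    moreover have "fact n / fact (n - m) \<le> (real n ^ m)"
    proof -
      have "(fact n div fact (n - m) :: nat) \<le> n ^ m" using True by (rule fact_div_fact_le_pow)
      moreover have "real (fact n div fact (n - m)) = fact n / fact (n - m)"
        using True by (simp add: fact_dvd real_of_nat_div)
      ultimately show ?thesis by (metis of_nat_le_iff of_nat_power)
    qed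
    ultimately show ?thesis by (metis mult_right_mono zero_le_divide_1_iff fact_ge_zero)
  next
    case False
    then have "real (n choose m) = 0" by (simp add: binomial_eq_0)
    also have "0 \<le> real n ^ m * (1 / fact m)" by simp
    finally show ?thesis .
  qed
  ultimately have "real (n choose m) \<le> real n ^ m * (exp (real m) / real m ^ m)"
    by (meson mult_left_mono of_nat_0_le_iff order_trans zero_le_power)
  also have "\<dots> = (exp 1 * real n / real m) ^ m"
    by (simp add: power_divide power_mult_distrib exp_of_nat_mult[symmetric])
  finally show ?thesis .
qed

text \<open>
  At least n^(1/2 + 19 \<delta>) / 2 common non-neighbours are expected, and the sets over which
  the union bound runs have at most n^(1/2 + 9 \<delta>) vertices.
\<close>
lemma nonneighbour_term_small:
  fixes x b \<delta> :: real
  assumes n: "real n = exp x" and p: "p = exp (- b)" "p \<le> \<delta> / 2"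
    and d: "0 < \<delta>" "\<delta> \<le> 1 / 40" and x: "0 < x"
    and k: "real k \<le> (1 / 2 - 20 * \<delta>) * x / p" and b: "b \<le> \<delta> * x"
    and M: "real M \<le> exp ((1 / 2 + 6 * \<delta>) * x)"
    and xs: "x \<le> exp (\<delta> * x)" "2 \<le> exp (\<delta> * x)"
      "2 * exp ((1 / 2 + 9 * \<delta>) * x) \<le> exp x"
      "x * exp ((1 / 2 + 9 * \<delta>) * x) - exp ((1 / 2 + 19 * \<delta>) * x) / 2 \<le> - x"
  shows "real n ^ (k + k * M) * (1 - (1 - p) ^ k) ^ (n - k - k * M) \<le> exp (- x)"
    and "k + k * M \<le> n"
proof -
  have p0: "0 < p" "p \<le> 1 / 2" using p d by auto
  define m where "m = k + k * M"
  have "real k \<le> x / p"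
  proof -
    have "(1 / 2 - 20 * \<delta>) * x / p \<le> 1 * x / p"
      using d x p0 by (intro divide_right_mono mult_right_mono) auto
    with k show ?thesis by simp
  qed
  also have "\<dots> \<le> exp (\<delta> * x) * exp (\<delta> * x)"
  proof -
    have "x / p = x * exp b" unfolding p(1) by (simp add: exp_minus divide_inverse)
    also have "\<dots> \<le> exp (\<delta> * x) * exp (\<delta> * x)" using xs x b by (intro mult_mono) auto
    finally show ?thesis .
  qed
  finally have kx: "real k \<le> exp (2 * \<delta> * x)" by (simp add: mult_exp_exp mult.assoc)
  have "1 \<le> exp ((1 / 2 + 6 * \<delta>) * x)" using x d by simp
  with M have "1 + real M \<le> 2 * exp ((1 / 2 + 6 * \<delta>) * x)" by linarith
  also have "\<dots> \<le> exp (\<delta> * x) * exp ((1 / 2 + 6 * \<delta>) * x)" using xs by (intro mult_right_mono) auto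
  finally have M1: "1 + real M \<le> exp ((1 / 2 + 7 * \<delta>) * x)" by (simp add: mult_exp_exp algebra_simps)
  have "real m = real k * (1 + real M)" by (simp add: m_def algebra_simps)
  also have "\<dots> \<le> exp (2 * \<delta> * x) * exp ((1 / 2 + 7 * \<delta>) * x)" using kx M1 by (intro mult_mono) auto
  finally have m: "real m \<le> exp ((1 / 2 + 9 * \<delta>) * x)" by (simp add: mult_exp_exp algebra_simps)
  then have mn: "2 * real m \<le> real n" using xs(3) n by simp
  then have "real m \<le> real n" by linarith
  then show "k + k * M \<le> n" unfolding of_nat_le_iff by (simp add: m_def)
  have q: "0 \<le> (1 - p) ^ k" "(1 - p) ^ k \<le> 1" using p0 by (auto simp: power_le_one)
  have lower: "exp ((1 / 2 + 19 * \<delta>) * x) / 2 \<le> (1 - p) ^ k * real (n - m)"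
  proof -
    have "- p - 2 * p\<^sup>2 \<le> ln (1 - p)" using p0 by (intro ln_one_minus_pos_lower_bound) auto
    then have "real k * (- p - 2 * p\<^sup>2) \<le> real k * ln (1 - p)" by (intro mult_left_mono) auto
    moreover have "- (1 / 2 - 19 * \<delta>) * x \<le> real k * (- p - 2 * p\<^sup>2)"
    proof -
      have "real k * p \<le> (1 / 2 - 20 * \<delta>) * x" using k p0 by (simp add: field_simps)
      then have "real k * p * (1 + 2 * p) \<le> (1 / 2 - 20 * \<delta>) * x * (1 + 2 * p)"
        using p0 by (intro mult_right_mono) auto
      also have "\<dots> \<le> (1 / 2 - 20 * \<delta>) * x * (1 + \<delta>)"
        using p d x by (intro mult_left_mono) auto
      also have "\<dots> \<le> (1 / 2 - 19 * \<delta>) * x"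
      proof -
        have "(1 / 2 - 20 * \<delta>) * (1 + \<delta>) \<le> 1 / 2 - 19 * \<delta>"
          using d by (simp add: algebra_simps)
        from mult_right_mono[OF this less_imp_le[OF x]] show ?thesis by (simp add: mult_ac)
      qed
      finally show ?thesis by (simp add: power2_eq_square algebra_simps)
    qed
    ultimately have "exp (- (1 / 2 - 19 * \<delta>) * x) \<le> exp (real k * ln (1 - p))" by simp
    also have "\<dots> = (1 - p) ^ k" using p0 by (simp add: exp_of_nat_mult)
    finally have "exp (- (1 / 2 - 19 * \<delta>) * x) * (exp x / 2) \<le> (1 - p) ^ k * real (n - m)"
      using mn n q by (intro mult_mono) auto
    then show ?thesis by (simp add: mult_exp_exp algebra_simps)
  qed
  have "real n ^ m * (1 - (1 - p) ^ k) ^ (n - m) \<le> exp (real m * x) * exp (- ((1 - p) ^ k * real (n - m)))"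
    using q n by (intro mult_mono one_minus_power_le_exp) (auto simp: real_power_eq_exp)
  also have "\<dots> \<le> exp (- x)"
  proof -
    have "real m * x \<le> x * exp ((1 / 2 + 9 * \<delta>) * x)" using m x by (simp add: mult.commute)
    with lower xs(4) show ?thesis by (simp add: mult_exp_exp)
  qed
  finally show "real n ^ (k + k * M) * (1 - (1 - p) ^ k) ^ (n - k - k * M) \<le> exp (- x)"
    by (simp add: m_def diff_diff_left)
qed

text \<open>
  Per vertex of the M-set, choosing the set costs x/2, and a vertices of density 9/10 gain about
  9/10 a b \<ge> 0.54 x.
\<close>
lemma dense_term_small:
  fixes x b L :: real
  assumes n: "real n = exp x" and b: "100 \<le> b" and x: "200 \<le> x" and L: "L * b = x" "0 < L"
    and a: "6 / 10 * L \<le> real a" "real a \<le> L" and M: "exp (x / 2) \<le> real M" "200 * x \<le> real M"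
  shows "real (n choose M) * real n ^ a * exp (real a * real M * (1 - 9 / 10 * b)) \<le> exp (- x)"
proof -
  have M0: "0 < M" using M(2) x by (cases M) auto
  have "real (n choose M) \<le> (exp 1 * real n / real M) ^ M" by (rule binomial_le_exp_bound[OF M0])
  also have "\<dots> \<le> exp (1 + x / 2) ^ M"
  proof (rule power_mono)
    have "exp 1 * real n / real M \<le> exp 1 * exp x / exp (x / 2)"
      unfolding n using M M0 by (intro divide_left_mono) auto
    also have "\<dots> = exp (1 + x / 2)" by (simp add: mult_exp_exp exp_diff[symmetric] field_simps)
    finally show "exp 1 * real n / real M \<le> exp (1 + x / 2)" .
  qed auto
  also have "\<dots> = exp (real M * (1 + x / 2))" by (simp add: exp_of_nat_mult)
  finally have 1: "real (n choose M) \<le> exp (real M * (1 + x / 2))" .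
  have "L * 100 \<le> L * b" using L b by (intro mult_left_mono) auto
  then have Lx: "100 * L \<le> x" using L by simp
  have "6 / 10 * L * b \<le> real a * b" using a b by (intro mult_right_mono) auto
  then have ab: "6 / 10 * x \<le> real a * b" using L by (simp add: mult.assoc)
  have ax: "real a * x \<le> real M * x / 200"
  proof -
    have "real a \<le> real M / 200" using a Lx M(2) x L by linarith
    from mult_right_mono[OF this, of x] show ?thesis using x by simp
  qed
  have "real (n choose M) * real n ^ a * exp (real a * real M * (1 - 9 / 10 * b))
     \<le> exp (real M * (1 + x / 2)) * exp (real a * x) * exp (real a * real M * (1 - 9 / 10 * b))"
    using 1 n by (intro mult_right_mono) (auto simp: real_power_eq_exp)
  also have "\<dots> = exp (real M * (1 + x / 2 + real a - 9 / 10 * (real a * b)) + real a * x)"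
    by (simp add: mult_exp_exp algebra_simps)
  also have "\<dots> \<le> exp (- x)"
  proof -
    have "1 + x / 2 + real a - 9 / 10 * (real a * b) \<le> - x / 100"
      using ab a Lx x by linarith
    then have "real M * (1 + x / 2 + real a - 9 / 10 * (real a * b)) \<le> real M * (- x / 100)"
      by (intro mult_left_mono) auto
    moreover have "200 * x \<le> real M * x"
      using M(2) x by (intro mult_right_mono) auto
    ultimately have "real M * (1 + x / 2 + real a - 9 / 10 * (real a * b)) + real a * x \<le> - x"
      using ax x by linarith
    then show ?thesis by simp
  qed
  finally show ?thesis .
qed

text \<open>
  The logarithm of the summand is convex in the overlap j, so both ends matter. Small j give about
  N^(-2) = n^(-1 - 8 \<delta>), and for large j the j-th root of the summand is at most n^(-
  \<delta>), while j is at least a large constant, as 2 \<delta> L \<ge> 2 / \<delta>.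
\<close>
lemma overlap_sum_small:
  fixes x b L \<delta> :: real
  assumes p: "p = exp (- b)" and b: "0 < b" and d: "0 < \<delta>" "\<delta> \<le> 1 / 40" and x: "0 < x"
    and L: "L * b = x" "1 / \<delta>\<^sup>2 \<le> L"
    and s: "real s \<le> (1 + 4 * \<delta>) * L" "real s \<le> exp (\<delta> * x)" "0 < s"
    and N: "exp ((1 / 2 + 4 * \<delta>) * x) \<le> real N"
  shows "(\<Sum>j=2..s. real s ^ j / (real N ^ j * p ^ (j choose 2))) \<le> exp (- (1 + 3 * \<delta>) * x)"
proof -
  have L0: "0 < L" using L d by (smt (verit) zero_less_divide_1_iff zero_less_power2)
  have summand: "real s ^ j / (real N ^ j * p ^ (j choose 2)) \<le> exp (- (1 + 4 * \<delta>) * x)"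
    if j: "j \<in> {2..s}" for j
  proof -
    define c where "c = b * (real j - 1) / 2"
    have "real s ^ j / (real N ^ j * p ^ (j choose 2))
       \<le> exp (\<delta> * x) ^ j / (exp ((1 / 2 + 4 * \<delta>) * x) ^ j * p ^ (j choose 2))"
      using s N p by (intro frac_le mult_mono power_mono mult_pos_pos) auto
    also have "\<dots> = exp (real j * (\<delta> * x) - (real j * ((1 / 2 + 4 * \<delta>) * x) + real (j choose 2) * (- b)))"
      by (simp only: p exp_of_nat_mult[symmetric] mult_exp_exp exp_diff[symmetric])
    also have "real j * (\<delta> * x) - (real j * ((1 / 2 + 4 * \<delta>) * x) + real (j choose 2) * (- b))
       = real j * (c - (1 / 2 + 3 * \<delta>) * x)"
      by (simp add: choose_two_real c_def algebra_simps add_divide_distrib diff_divide_distrib)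
    also have "\<dots> \<le> - (1 + 4 * \<delta>) * x"
    \<comment> \<open>Here p^(- (j - 1)/2) is compared with n^\<delta>.\<close>
    proof (cases "c \<le> \<delta> * x")
      case True
      then have "real j * (c - (1 / 2 + 3 * \<delta>) * x) \<le> real j * (- (1 / 2 + 2 * \<delta>) * x)"
        by (intro mult_left_mono) (auto simp: algebra_simps)
      also have "\<dots> \<le> 2 * (- (1 / 2 + 2 * \<delta>) * x)"
        using j d x by (intro mult_right_mono_neg mult_nonpos_nonneg) auto
      finally show ?thesis by (simp add: algebra_simps)
    next
      case False
      have "real j - 1 \<le> (1 + 4 * \<delta>) * L" using j s by auto
      then have "b * (real j - 1) \<le> b * ((1 + 4 * \<delta>) * L)" using b by (intro mult_left_mono) auto
      also have "\<dots> = (1 + 4 * \<delta>) * x" using L(1) by (simp add: mult_ac)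
      finally have "c \<le> (1 / 2 + 2 * \<delta>) * x" by (simp add: c_def algebra_simps)
      then have "real j * (c - (1 / 2 + 3 * \<delta>) * x) \<le> real j * (- (\<delta> * x))"
        by (intro mult_left_mono) (auto simp: algebra_simps)
      also have "\<dots> \<le> (2 * \<delta> * L) * (- (\<delta> * x))"
      proof (rule mult_right_mono_neg)
        have "\<delta> * (L * b) < b * (real j - 1) / 2" using False L(1) by (simp add: c_def)
        then have "b * (2 * \<delta> * L) < b * (real j - 1)" by (simp add: algebra_simps)
        then show "2 * \<delta> * L \<le> real j" using b by simp
      qed (use d x in auto)
      also have "\<dots> = - (2 * (\<delta>\<^sup>2 * L)) * x" by (simp add: power2_eq_square)
      also have "\<dots> \<le> - (1 + 4 * \<delta>) * x"
      proof (rule mult_right_mono)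
        have "1 \<le> \<delta>\<^sup>2 * L" using L(2) d by (simp add: field_simps)
        then show "- (2 * (\<delta>\<^sup>2 * L)) \<le> - (1 + 4 * \<delta>)" using d by linarith
      qed (use x in auto)
      finally show ?thesis .
    qed
    finally show ?thesis by simp
  qed
  have "(\<Sum>j=2..s. real s ^ j / (real N ^ j * p ^ (j choose 2))) \<le> (\<Sum>j=2..s. exp (- (1 + 4 * \<delta>) * x))"
    by (intro sum_mono summand)
  also have "\<dots> \<le> real s * exp (- (1 + 4 * \<delta>) * x)" by (simp add: mult_right_mono)
  also have "\<dots> \<le> exp (\<delta> * x) * exp (- (1 + 4 * \<delta>) * x)" using s by (intro mult_right_mono) auto
  also have "\<dots> = exp (- (1 + 3 * \<delta>) * x)" by (simp add: mult_exp_exp algebra_simps)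
  finally show ?thesis .
qed

text \<open>
  The inverse of D exceeds n by a power of n, hence also the logarithm M x + n ln 2 of the number
  of choices in the union bound.
\<close>
lemma janson_term_small:
  fixes x \<delta> D :: real
  assumes n: "real n = exp x" and x: "0 < x"
    and D: "0 < D" "D \<le> exp (- (1 + 3 * \<delta>) * x)"
    and M: "real M * x \<le> exp x"
    and xs: "2 * exp x - exp ((1 + 3 * \<delta>) * x) / 8 \<le> - x"
  shows "real n ^ M * 2 ^ n * exp (- 1 / (8 * D)) \<le> exp (- x)"
proof -
  have "exp ((1 + 3 * \<delta>) * x) = 1 / exp (- (1 + 3 * \<delta>) * x)"
    by (simp add: exp_minus[symmetric] inverse_eq_divide[symmetric] algebra_simps)
  also have "\<dots> \<le> 1 / D" using D by (intro divide_left_mono) auto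
  finally have 1: "exp ((1 + 3 * \<delta>) * x) / 8 \<le> 1 / (8 * D)" by simp
  have "(2 :: real) ^ n \<le> exp 1 ^ n" using exp_ge_add_one_self[of 1] by (intro power_mono) auto
  also have "\<dots> = exp (exp x)" using n by (simp add: exp_of_nat_mult[symmetric])
  finally have 2: "(2 :: real) ^ n \<le> exp (exp x)" .
  have "real n ^ M * 2 ^ n * exp (- 1 / (8 * D)) \<le> exp (real M * x) * exp (exp x) * exp (- 1 / (8 * D))"
    using 2 n by (intro mult_right_mono mult_mono) (auto simp: real_power_eq_exp)
  also have "\<dots> = exp (real M * x + exp x - 1 / (8 * D))" by (simp add: mult_exp_exp)
  also have "\<dots> \<le> exp (- x)" using 1 M xs by simp
  finally show ?thesis .
qed

text \<open>
  The choices are s = (1 + 3 \<delta>) L parts with N = n^(1/2 + 4 \<delta>) vertices, of which q,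
  about 0.4 L, are generic and a - 1, about 0.6 L, avoid exceptional vertices, and \<beta> = p^(1
  - \<delta>), R = 8 L / \<delta>.
\<close>
lemma coloring_prob_le:
  fixes x b L \<delta> :: real
  assumes n: "real n = exp x" and p: "p = exp (- b)" "p \<le> \<delta> / 2"
    and d: "0 < \<delta>" "\<delta> \<le> 1 / 40"
    and b: "100 \<le> b" "2 / \<delta> \<le> b" and L: "L * b = x" "1 / \<delta>\<^sup>2 \<le> L"
      "2 * L * (8 * L / \<delta>) * exp (1 - 7 / 200 * L) \<le> 1 / 4"
    and k: "real k \<le> (1 / 2 - 20 * \<delta>) * x / p"
    and xs: "200 \<le> x" "x \<le> exp (\<delta> * x)" "2 \<le> exp (\<delta> * x)" "exp (- \<delta> * x) \<le> 1 / 4"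
      "2 * exp ((1 / 2 + 9 * \<delta>) * x) \<le> exp x"
      "x * exp ((1 / 2 + 9 * \<delta>) * x) - exp ((1 / 2 + 19 * \<delta>) * x) / 2 \<le> - x"
      "2 * exp x - exp ((1 + 3 * \<delta>) * x) / 8 \<le> - x"
      "200 * x \<le> exp (x / 2)"
  shows "bprob p (vertex_pairs {1..n}) (\<lambda>S. \<exists>c. clique_coloring ({1..n}, S) k c) \<le> 4 * exp (- x)"
proof -
  define s where "s = nat \<lceil>(1 + 3 * \<delta>) * L\<rceil>"
  define a where "a = nat \<lceil>6 / 10 * L\<rceil>"
  define q where "q = s + 1 - a"
  define N where "N = nat \<lceil>exp ((1 / 2 + 4 * \<delta>) * x)\<rceil>"
  define \<beta> where "\<beta> = exp (- (1 - \<delta>) * b)"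
  define R where "R = 8 * L / \<delta>"
  define \<kappa> where "\<kappa> = \<delta> * b - 1"
  have x0: "0 < x" and b0: "0 < b" using xs b by auto
  have L0: "0 < L" using L(2) d by (smt (verit) zero_less_divide_1_iff zero_less_power2)
  have dL: "1 \<le> \<delta>\<^sup>2 * L" using L(2) d by (simp add: field_simps)
  have "\<delta>\<^sup>2 * L \<le> (\<delta> * (1 / 40)) * L"
    unfolding power2_eq_square using d L0 by (intro mult_right_mono mult_left_mono) auto
  with dL have dL1: "40 \<le> \<delta> * L" by simp
  have "\<delta> * L \<le> 1 / 40 * L" using d L0 by (intro mult_right_mono) auto
  with dL1 have L40: "1600 \<le> L" by simp
  have Lx: "L * 100 \<le> x" using b L0 by (simp add: L(1)[symmetric])
  have bx: "b \<le> \<delta> * x"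
  proof -
    have "1 * b \<le> (\<delta> * L) * b" using dL1 b0 by (intro mult_right_mono) auto
    then show ?thesis by (simp add: L(1)[symmetric] mult.assoc)
  qed
  have p0: "0 < p" "p < 1" using p b by auto
  have s: "(1 + 3 * \<delta>) * L \<le> real s" "real s \<le> (1 + 4 * \<delta>) * L"
  proof -
    have "0 \<le> (1 + 3 * \<delta>) * L" using d L0 by simp
    then have "real s = of_int \<lceil>(1 + 3 * \<delta>) * L\<rceil>" by (simp add: s_def)
    then have "(1 + 3 * \<delta>) * L \<le> real s" "real s \<le> (1 + 3 * \<delta>) * L + 1"
      using ceiling_correct[of "(1 + 3 * \<delta>) * L"] by linarith+
    then show "(1 + 3 * \<delta>) * L \<le> real s" "real s \<le> (1 + 4 * \<delta>) * L"
      using dL1 by (simp_all add: algebra_simps)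
  qed
  have sL: "real s \<le> 2 * L" "L \<le> real s"
    using s d L0 by (auto intro: order_trans[OF s(2)] order_trans[OF _ s(1)])
  have a: "6 / 10 * L \<le> real a" "real a \<le> 65 / 100 * L"
  proof -
    have "real a = of_int \<lceil>6 / 10 * L\<rceil>" using L0 by (simp add: a_def)
    then have "6 / 10 * L \<le> real a" "real a \<le> 6 / 10 * L + 1"
      using ceiling_correct[of "6 / 10 * L"] by linarith+
    then show "6 / 10 * L \<le> real a" "real a \<le> 65 / 100 * L" using L40 by auto
  qed
  have "real a \<le> real s" "1 \<le> real a" using a sL L0 L40 by linarith+
  then have as: "a \<le> s" "1 \<le> a" by simp_all
  have q: "q \<le> s" "s - q + 1 = a" "0 < q" using as by (auto simp: q_def)
  have "real q = real s + 1 - real a" using as by (simp add: q_def)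
  then have qL: "35 / 100 * L \<le> real q" using a sL by linarith
  have s2: "2 \<le> s"
  proof -
    have "2 \<le> real s" using sL L40 by linarith
    then show ?thesis by simp
  qed
  have N: "exp ((1 / 2 + 4 * \<delta>) * x) \<le> real N" "real N \<le> exp ((1 / 2 + 5 * \<delta>) * x)"
  proof -
    have "real N = of_int \<lceil>exp ((1 / 2 + 4 * \<delta>) * x)\<rceil>" by (simp add: N_def)
    then have N': "exp ((1 / 2 + 4 * \<delta>) * x) \<le> real N" "real N \<le> exp ((1 / 2 + 4 * \<delta>) * x) + 1"
      using ceiling_correct[of "exp ((1 / 2 + 4 * \<delta>) * x)"] by linarith+
    then show "exp ((1 / 2 + 4 * \<delta>) * x) \<le> real N" by simp
    have "1 \<le> exp ((1 / 2 + 4 * \<delta>) * x)" using x0 d by simp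
    with N' have "real N \<le> 2 * exp ((1 / 2 + 4 * \<delta>) * x)" by linarith
    also have "\<dots> \<le> exp (\<delta> * x) * exp ((1 / 2 + 4 * \<delta>) * x)" using xs by (intro mult_right_mono) auto
    finally show "real N \<le> exp ((1 / 2 + 5 * \<delta>) * x)" by (simp add: mult_exp_exp algebra_simps)
  qed
  have N0: "0 < N"
  proof -
    have "0 < real N" using N(1) by (rule less_le_trans[OF exp_gt_zero])
    then show ?thesis by simp
  qed
  have Nx: "exp (x / 2) \<le> real N"
    using d x0 by (intro order_trans[OF _ N(1)]) (simp add: algebra_simps)
  have sx: "real s \<le> exp (\<delta> * x)"
  proof -
    have "real s \<le> x" using sL Lx L0 by linarith
    with xs show ?thesis by simp
  qed
  have sN: "real (s * N) \<le> exp ((1 / 2 + 6 * \<delta>) * x)"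
  proof -
    have "real s * real N \<le> exp (\<delta> * x) * exp ((1 / 2 + 5 * \<delta>) * x)"
      using sx N by (intro mult_mono) auto
    then show ?thesis by (simp add: mult_exp_exp algebra_simps)
  qed
  have sNx: "real (N * s) * x \<le> exp x"
  proof -
    have "real (s * N) * x \<le> exp ((1 / 2 + 6 * \<delta>) * x) * exp (\<delta> * x)"
      using sN xs x0 by (intro mult_mono) auto
    also have "\<dots> = exp ((1 / 2 + 7 * \<delta>) * x)" by (simp add: mult_exp_exp algebra_simps)
    also have "\<dots> \<le> exp (1 * x)" unfolding exp_le_cancel_iff using d x0 by (intro mult_right_mono) auto
    finally show ?thesis by (simp add: mult.commute)
  qed
  have k2: "\<delta> * b / 2 \<le> \<kappa>" "1 \<le> \<kappa>" "0 \<le> \<kappa>"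
  proof -
    have "2 \<le> \<delta> * b" using b(2) d by (simp add: field_simps)
    then show "\<delta> * b / 2 \<le> \<kappa>" "1 \<le> \<kappa>" "0 \<le> \<kappa>" by (auto simp: \<kappa>_def)
  qed
  have \<beta>0: "0 < \<beta>" by (simp add: \<beta>_def)
  have rate: "p * exp (\<delta> * b) / \<beta> + \<kappa> \<le> \<delta> * b"
    by (simp add: p(1) \<beta>_def \<kappa>_def mult_exp_exp exp_diff[symmetric] algebra_simps)
  have small: "real (card {1..n}) * exp (- \<kappa> * \<beta> * real N / 2) \<le> 1"
  proof -
    have "exp (- \<delta> * x) * exp ((1 / 2 + 4 * \<delta>) * x) \<le> \<beta> * real N"
    proof (intro mult_mono N)
      have "- \<delta> * x \<le> - b" using bx by simp
      also have "\<dots> \<le> - (1 - \<delta>) * b" using d b0 by (simp add: algebra_simps)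
      finally show "exp (- \<delta> * x) \<le> \<beta>" by (simp add: \<beta>_def)
    qed (use \<beta>0 in auto)
    moreover have "exp (x / 2) \<le> exp (- \<delta> * x) * exp ((1 / 2 + 4 * \<delta>) * x)"
      using d x0 by (simp add: mult_exp_exp algebra_simps)
    ultimately have "200 * x \<le> \<beta> * real N" using xs(8) by linarith
    moreover have "1 * (\<beta> * real N) \<le> \<kappa> * (\<beta> * real N)" using k2 \<beta>0 by (intro mult_right_mono) auto
    ultimately have "2 * x \<le> \<kappa> * \<beta> * real N" using x0 by (simp add: mult.assoc)
    then show ?thesis using n by (simp add: mult_exp_exp)
  qed
  have num: "real (card {1..n}) * \<beta> ^ s + real s * R * exp (1 - (1 - 9 / 10) * real q) \<le> 1 / 2"
  proof -
    have "real (card {1..n}) * \<beta> ^ s = exp (x - (1 - \<delta>) * (real s * b))"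
      using n by (simp add: \<beta>_def exp_of_nat_mult[symmetric] mult_exp_exp algebra_simps)
    also have "\<dots> \<le> exp (- \<delta> * x)"
    proof -
      have "(1 + 3 * \<delta>) * L * b \<le> real s * b" using s b0 by (intro mult_right_mono) auto
      then have "(1 + 3 * \<delta>) * x \<le> real s * b" by (simp add: L(1)[symmetric] mult.assoc)
      then have "(1 - \<delta>) * ((1 + 3 * \<delta>) * x) \<le> (1 - \<delta>) * (real s * b)"
        using d by (intro mult_left_mono) auto
      moreover have "(1 + \<delta>) * x \<le> (1 - \<delta>) * ((1 + 3 * \<delta>) * x)"
      proof -
        have "3 * \<delta> * \<delta> \<le> \<delta>" using d by simp
        then have "1 + \<delta> \<le> (1 - \<delta>) * (1 + 3 * \<delta>)" by (simp add: algebra_simps)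
        from mult_right_mono[OF this less_imp_le[OF x0]] show ?thesis by (simp add: mult.assoc)
      qed
      ultimately show ?thesis by (simp add: algebra_simps)
    qed
    also have "\<dots> \<le> 1 / 4" by (rule xs)
    finally have 1: "real (card {1..n}) * \<beta> ^ s \<le> 1 / 4" .
    have "real s * R * exp (1 - (1 - 9 / 10) * real q) \<le> 2 * L * (8 * L / \<delta>) * exp (1 - 7 / 200 * L)"
      using sL qL L0 d by (intro mult_mono) (auto simp: R_def)
    with L(3) 1 show ?thesis by linarith
  qed
  have T1: "real n ^ (k + k * (s * N)) * (1 - (1 - p) ^ k) ^ (n - k - k * (s * N)) \<le> exp (- x)"
    and kn: "k + k * (s * N) \<le> n"
    using nonneighbour_term_small[OF n p d x0 k bx sN xs(2,3,5,6)] by auto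
  have T2: "real n ^ N * (exp 1 * exp (- \<kappa> * R * real N / 2)) \<le> exp (- x)"
  proof -
    have "4 * x \<le> \<kappa> * R"
    proof -
      have "4 * x = (\<delta> * b / 2) * R" using d by (simp add: R_def L(1)[symmetric] field_simps)
      also have "\<dots> \<le> \<kappa> * R" using k2 d L0 by (intro mult_right_mono) (auto simp: R_def)
      finally show ?thesis .
    qed
    then have "4 * x * real N \<le> \<kappa> * R * real N" by (intro mult_right_mono) auto
    then have "4 * (x * real N) \<le> \<kappa> * R * real N" by (simp only: mult.assoc)
    moreover have "2 * x \<le> x * real N"
    proof -
      have "2 \<le> real N" using Nx xs by linarith
      from mult_left_mono[OF this, of x] x0 show ?thesis by (simp add: mult.commute)
    qed
    ultimately have "x * real N + 1 - \<kappa> * R * real N / 2 \<le> - x" using xs(1) by linarith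
    then have "real N * x + 1 - \<kappa> * R * real N / 2 \<le> - x" by (simp only: mult.commute[of x])
    then show ?thesis using n by (simp add: real_power_eq_exp mult_exp_exp)
  qed
  have T3: "real (n choose (q * N)) * real n ^ (s - q + 1)
          * exp (real (s - q + 1) * real (q * N) * (1 - 9 / 10 * b)) \<le> exp (- x)"
  proof -
    have "1 * real N \<le> real q * real N" using q by (intro mult_right_mono) auto
    then have "exp (x / 2) \<le> real (q * N)" using Nx by simp
    then show ?thesis unfolding q(2)
      using a L0 xs by (intro dense_term_small[OF n b(1) xs(1) L(1) L0]) auto
  qed
  have T4: "real n ^ (N * s) * 2 ^ n
      * exp (- 1 / (8 * (\<Sum>j=2..s. real s ^ j / (real N ^ j * p ^ (j choose 2))))) \<le> exp (- x)"
  proof (rule janson_term_small[OF n x0 _ _ sNx xs(7)])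
    show "0 < (\<Sum>j=2..s. real s ^ j / (real N ^ j * p ^ (j choose 2)))"
      using s2 N0 p0 by (intro sum_pos) auto
    show "(\<Sum>j=2..s. real s ^ j / (real N ^ j * p ^ (j choose 2))) \<le> exp (- (1 + 3 * \<delta>) * x)"
      using s2 by (intro overlap_sum_small[OF p(1) b0 d x0 L(1,2) s(2) sx _ N(1)]) auto
  qed
  have sNn: "s * N \<le> card {1..n}"
  proof -
    have "real (N * s) * 1 \<le> real (N * s) * x" using xs(1) by (intro mult_left_mono) auto
    with sNx n have "real (N * s) \<le> real n" by simp
    then show ?thesis by (simp add: mult.commute flip: of_nat_mult)
  qed
  have R0: "0 \<le> R" using L0 d by (simp add: R_def)
  have "0 \<le> \<delta> * b" using d b0 by simp
  from lower_bound_prob[OF finite_atLeastAtMost p0 p(1) s2 q(1) N0 R0 \<beta>0 this rate k2(3) small sNn _ num, of k] kn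
  show ?thesis using T1 T2 T3 T4 by simp
qed

section \<open>Concentration\<close>

text \<open>
  With s = (1 - \<epsilon>) L, sets of s vertices have common neighbours as n p^s is a power of n,
  and each vertex of an (s + 1)-clique without neighbours among the k fixed vertices contributes a
  factor n p^(s/2) (1 - p)^k, which is at most n^(- \<epsilon>/2).
\<close>
lemma no_coloring_prob_le:
  fixes x b L \<epsilon> :: real
  assumes n: "real n = exp x" and p: "p = exp (- b)"
    and e: "0 < \<epsilon>" "\<epsilon> \<le> 1 / 2" and b: "1 \<le> b" and L: "L * b = x" "4 / \<epsilon> \<le> L" "16 \<le> L"
    and k: "(1 / 2 + \<epsilon>) * x / p \<le> real k" "real k \<le> x / p + 1"
    and xs: "1 \<le> x" "x\<^sup>2 - exp (\<epsilon> / 2 * x) / 2 \<le> - x" "2 * x \<le> exp x"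
      "x * exp (x / 16) + 1 \<le> exp (x / 8)"
  shows "bprob p (vertex_pairs {1..n}) (\<lambda>S. \<not> (\<exists>c. clique_coloring ({1..n}, S) (k + 2) c)) \<le> 3 * exp (- x)"
proof -
  define s where "s = nat \<lceil>(1 - \<epsilon>) * L\<rceil>"
  have p0: "0 < p" "p < 1" using p b by auto
  have s: "(1 - \<epsilon>) * L \<le> real s" "real s \<le> (1 - \<epsilon> / 2) * L"
  proof -
    have "0 \<le> (1 - \<epsilon>) * L" using e L by simp
    then have "real s = of_int \<lceil>(1 - \<epsilon>) * L\<rceil>" by (simp add: s_def)
    then have "(1 - \<epsilon>) * L \<le> real s" "real s \<le> (1 - \<epsilon>) * L + 1"
      using ceiling_correct[of "(1 - \<epsilon>) * L"] by linarith+
    moreover have "2 \<le> \<epsilon> * L" using L(2) e by (simp add: field_simps)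
    ultimately show "(1 - \<epsilon>) * L \<le> real s" "real s \<le> (1 - \<epsilon> / 2) * L"
      by (simp_all add: algebra_simps)
  qed
  have "1 / 2 * L \<le> (1 - \<epsilon>) * L" using e L by (intro mult_right_mono) auto
  with s have sL: "L / 2 \<le> real s" by simp
  have "(1 - \<epsilon> / 2) * L \<le> 1 * L" using e L by (intro mult_right_mono) auto
  with s have sL': "real s \<le> L" by simp
  have Lx: "L \<le> x" using b L by (simp add: L(1)[symmetric])
  have bs: "(1 - \<epsilon>) * x \<le> b * real s" "b * real s \<le> (1 - \<epsilon> / 2) * x"
    using mult_left_mono[OF s(1), of b] mult_left_mono[OF s(2), of b] b
    by (simp_all add: L(1)[symmetric] mult_ac)
  have sn: "2 * real s \<le> real n" using sL' Lx xs(3) n by linarith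
  have kx: "real k \<le> exp (x / 8)"
  proof -
    have "b * 16 \<le> b * L" using b L by (intro mult_left_mono) auto
    then have "b \<le> x / 16" using L(1) by (simp add: mult.commute)
    then have "x * exp b + 1 \<le> x * exp (x / 16) + 1" using xs by simp
    moreover have "x / p = x * exp b" unfolding p by (simp add: exp_minus divide_inverse)
    ultimately show ?thesis using k xs(4) by simp
  qed
  also have "\<dots> \<le> real n" using n xs(1) by simp
  finally have kn: "k \<le> n" by simp
  have T1: "real n ^ s * (1 - p ^ s) ^ (n - s) \<le> exp (- x)"
  proof -
    have ps: "0 \<le> p ^ s" "p ^ s \<le> 1" using p0 by (auto simp: power_le_one)
    have "exp (\<epsilon> / 2 * x) / 2 = exp (- ((1 - \<epsilon> / 2) * x)) * (exp x / 2)"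
      by (simp add: mult_exp_exp algebra_simps)
    also have "\<dots> \<le> p ^ s * real (n - s)"
    proof (rule mult_mono)
      have "p ^ s = exp (- (b * real s))" using p by (simp add: exp_of_nat_mult[symmetric] mult.commute)
      then show "exp (- ((1 - \<epsilon> / 2) * x)) \<le> p ^ s" using bs by simp
      show "exp x / 2 \<le> real (n - s)" using sn n by simp
    qed (use ps in auto)
    finally have 1: "exp (\<epsilon> / 2 * x) / 2 \<le> p ^ s * real (n - s)" .
    have "real s * x \<le> x * x" using sL' Lx xs(1) by (intro mult_right_mono) auto
    then have 2: "real s * x \<le> x\<^sup>2" by (simp add: power2_eq_square)
    have "real n ^ s * (1 - p ^ s) ^ (n - s) \<le> exp (real s * x) * exp (- (p ^ s * real (n - s)))"
      using ps n by (intro mult_mono one_minus_power_le_exp) (auto simp: real_power_eq_exp)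
    also have "\<dots> \<le> exp (- x)" using 1 2 xs(2) by (simp add: mult_exp_exp)
    finally show ?thesis .
  qed
  have pC: "p ^ ((s + 1) choose 2) = exp (- (real (s + 1) * (b * real s / 2)))"
  proof -
    have "p ^ ((s + 1) choose 2) = exp (real ((s + 1) choose 2) * (- b))"
      using p by (rule real_power_eq_exp)
    also have "real ((s + 1) choose 2) * (- b) = - (real (s + 1) * (b * real s / 2))"
      by (simp only: choose_two_real) (simp add: algebra_simps)
    finally show ?thesis .
  qed
  have T2: "real k ^ (s + 1) * p ^ ((s + 1) choose 2) \<le> exp (- x)"
  proof -
    have "real k ^ (s + 1) * p ^ ((s + 1) choose 2) \<le> exp (x / 8) ^ (s + 1) * p ^ ((s + 1) choose 2)"
      using kx p0 by (intro mult_right_mono power_mono) auto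
    also have "\<dots> = exp (real (s + 1) * (x / 8 - b * real s / 2))"
      unfolding pC by (simp only: exp_of_nat_mult[symmetric] mult_exp_exp) (simp add: algebra_simps)
    also have "\<dots> \<le> exp (- x)"
    proof -
      have "1 / 2 * x \<le> (1 - \<epsilon>) * x" using e xs by (intro mult_right_mono) auto
      then have "x / 8 - b * real s / 2 \<le> - x / 8" using bs by linarith
      then have "real (s + 1) * (x / 8 - b * real s / 2) \<le> real (s + 1) * (- x / 8)"
        by (intro mult_left_mono) auto
      also have "\<dots> \<le> 8 * (- x / 8)" using sL L xs by (intro mult_right_mono_neg) auto
      finally show ?thesis by simp
    qed
    finally show ?thesis .
  qed
  have T3: "real n ^ (s + 1) * (p ^ ((s + 1) choose 2) * (1 - p) ^ ((s + 1) * k)) \<le> exp (- x)"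
  proof -
    have "(1 - p) ^ ((s + 1) * k) \<le> exp (- (p * real ((s + 1) * k)))"
      using p0 by (intro one_minus_power_le_exp) auto
    also have "\<dots> = exp (- (real (s + 1) * (p * real k)))" by (simp add: algebra_simps)
    finally have "real n ^ (s + 1) * (p ^ ((s + 1) choose 2) * (1 - p) ^ ((s + 1) * k))
      \<le> exp (real (s + 1) * x) * (exp (- (real (s + 1) * (b * real s / 2))) * exp (- (real (s + 1) * (p * real k))))"
      unfolding pC real_power_eq_exp[OF n] by (intro mult_left_mono) auto
    also have "\<dots> = exp (real (s + 1) * (x - b * real s / 2 - p * real k))"
      by (simp only: mult_exp_exp) (simp add: algebra_simps)
    also have "\<dots> \<le> exp (- x)"
    proof -
      have "(1 / 2 + \<epsilon>) * x \<le> p * real k" using k(1) p0 by (simp add: field_simps)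
      then have "x - b * real s / 2 - p * real k \<le> - (\<epsilon> / 2 * x)" using bs by (simp add: algebra_simps)
      then have "real (s + 1) * (x - b * real s / 2 - p * real k) \<le> real (s + 1) * (- (\<epsilon> / 2 * x))"
        by (intro mult_left_mono) auto
      also have "\<dots> \<le> (2 / \<epsilon>) * (- (\<epsilon> / 2 * x))"
        using sL L e xs by (intro mult_right_mono_neg) auto
      also have "\<dots> = - x" using e by simp
      finally show ?thesis by simp
    qed
    finally show ?thesis .
  qed
  have "s \<le> n" using sn by simp
  then show ?thesis
    using upper_bound_prob[of "{1..n}" p s k] p0 kn T1 T2 T3 by simp
qed

lemma clique_coloring_mono:
  "clique_coloring G k c \<Longrightarrow> k \<le> k' \<Longrightarrow> clique_coloring G k' c"
  by (auto simp: clique_coloring_def)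

lemma clique_chromatic_number_le: "clique_coloring G k c \<Longrightarrow> clique_chromatic_number G \<le> k"
  unfolding clique_chromatic_number_def by (rule Least_le) blast

lemma clique_chromatic_number_gt:
  assumes "finite (fst G)" "\<nexists>c. clique_coloring G k c"
  shows "k < clique_chromatic_number G"
proof (rule ccontr)
  assume "\<not> ?thesis"
  then have le: "clique_chromatic_number G \<le> k" by simp
  have "\<exists>c. clique_coloring G (clique_chromatic_number G) c"
    unfolding clique_chromatic_number_def
    by (rule LeastI[of "\<lambda>k. \<exists>c. clique_coloring G k c"], rule clique_coloring_exists[OF assms(1)])
  with assms(2) clique_coloring_mono[OF _ le] show False by blast
qed

text \<open>
  A single rate is obtained by letting e = 1/(m + 1) decrease slowly: at n the largest m \<le> n
  is used for which f (1/(m + 1)) is known to be close to 1 from n on.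
\<close>
lemma diagonal_rate:
  fixes f :: "real \<Rightarrow> nat \<Rightarrow> real"
  assumes lim: "\<And>e. 0 < e \<Longrightarrow> f e \<longlonglongrightarrow> 1" and le: "\<And>e n. f e n \<le> 1"
  shows "\<exists>\<eta>. \<eta> \<longlonglongrightarrow> 0 \<and> (\<lambda>n. f (\<eta> n) n) \<longlonglongrightarrow> 1"
proof -
  define r where "r m = 1 / real (Suc m)" for m
  have "\<exists>M. \<forall>n\<ge>M. 1 - r m \<le> f (r m) n" for m
  proof -
    have "1 - r m < 1" "0 < r m" by (auto simp: r_def)
    from order_tendstoD(1)[OF lim[OF this(2)] this(1)] show ?thesis
      unfolding eventually_sequentially by (meson less_imp_le)
  qed
  then obtain M where M: "\<And>m n. M m \<le> n \<Longrightarrow> 1 - r m \<le> f (r m) n" by metis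
  define g where "g n = Max {m\<in>{..n}. M m \<le> n}" for n
  have g: "M (g n) \<le> n \<and> m \<le> g n" if "M m \<le> n" "m \<le> n" for m n
  proof -
    let ?A = "{m\<in>{..n}. M m \<le> n}"
    have fin: "finite ?A" and mem: "m \<in> ?A" using that by auto
    then have "g n \<in> ?A" unfolding g_def by (intro Max_in) auto
    moreover have "m \<le> g n" unfolding g_def using fin mem by (rule Max_ge)
    ultimately show ?thesis by simp
  qed
  have "filterlim g at_top sequentially"
    unfolding filterlim_at_top eventually_sequentially
  proof
    fix m
    show "\<exists>N. \<forall>n\<ge>N. m \<le> g n"
      using g[of m] by (intro exI[of _ "max m (M m)"]) auto
  qed
  moreover have "r \<longlonglongrightarrow> 0" unfolding r_def by (rule LIMSEQ_Suc[OF lim_1_over_n, where ?'a1=real])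
  ultimately have r0: "(\<lambda>n. r (g n)) \<longlonglongrightarrow> 0" by (rule filterlim_compose[rotated])
  have "(\<lambda>n. f (r (g n)) n) \<longlonglongrightarrow> 1"
  proof (rule tendsto_sandwich)
    show "\<forall>\<^sub>F n in sequentially. 1 - r (g n) \<le> f (r (g n)) n"
      unfolding eventually_sequentially
      using g[of 0] M by (intro exI[of _ "M 0"]) auto
    show "(\<lambda>n. 1 - r (g n)) \<longlonglongrightarrow> 1" using tendsto_diff[OF tendsto_const r0, of 1] by simp
  qed (use le in auto)
  with r0 show ?thesis by blast
qed

context
  fixes p :: "nat \<Rightarrow> real"
  assumes p01: "\<And>n. n \<ge> 1 \<Longrightarrow> 0 < p n \<and> p n < 1"
    and p_lower: "\<exists>\<gamma> :: nat \<Rightarrow> real. \<gamma> \<longlonglongrightarrow> 0 \<and> (\<forall>\<^sub>F n in sequentially. p n \<ge> real n powr (- \<gamma> n))"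
    and p_zero: "p \<longlonglongrightarrow> 0"
begin

lemma ln_inverse_p_at_top: "filterlim (\<lambda>n. - ln (p n)) at_top sequentially"
proof -
  have "filterlim p (at_right 0) sequentially"
    using p_zero by (rule tendsto_imp_filterlim_at_right)
      (auto simp: eventually_sequentially intro!: exI[of _ 1] dest: p01)
  from filterlim_compose[OF ln_at_0 this] show ?thesis
    by (simp add: filterlim_uminus_at_top)
qed

lemma log_ratio_at_top: "filterlim (\<lambda>n. ln (real n) / - ln (p n)) at_top sequentially"
proof (rule filterlim_at_top_gt[THEN iffD2, of 0], intro allI impI)
  fix C :: real assume C: "0 < C"
  obtain \<gamma> where g: "\<gamma> \<longlonglongrightarrow> 0" "\<forall>\<^sub>F n in sequentially. p n \<ge> real n powr (- \<gamma> n)"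
    using p_lower by auto
  have "\<forall>\<^sub>F n in sequentially. \<gamma> n < 1 / C" using order_tendstoD(2)[OF g(1)] C by simp
  then show "\<forall>\<^sub>F n in sequentially. C \<le> ln (real n) / - ln (p n)"
    using g(2) eventually_ge_at_top[of 1]
  proof eventually_elim
    case (elim n)
    have "real n powr (- \<gamma> n) = exp (- \<gamma> n * ln (real n))" using elim by (simp add: powr_def)
    with elim have "ln (exp (- \<gamma> n * ln (real n))) \<le> ln (p n)"
      using p01[of n] by (subst ln_le_cancel_iff) auto
    then have "- ln (p n) \<le> \<gamma> n * ln (real n)" by simp
    also have "\<dots> \<le> 1 / C * ln (real n)" using elim by (intro mult_right_mono) auto
    finally have "- ln (p n) * C \<le> ln (real n)" using C by (simp add: field_simps)
    moreover have "0 < - ln (p n)" using p01[of n] elim by simp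
    ultimately show ?case by (simp add: pos_le_divide_eq mult.commute del: divide_minus_right)
  qed
qed

lemma ln_at_top_seq: "filterlim (\<lambda>n. ln (real n)) at_top sequentially"
  by (rule filterlim_compose[OF ln_at_top filterlim_real_sequentially])

lemma coloring_prob_small:
  assumes d: "0 < \<delta>" "\<delta> \<le> 1 / 40"
  shows "\<forall>\<^sub>F n in sequentially.
     bprob (p n) (vertex_pairs {1..n})
       (\<lambda>S. \<exists>c. clique_coloring ({1..n}, S) (nat \<lfloor>(1 / 2 - 20 * \<delta>) * ln (real n) / p n\<rfloor>) c) \<le> 4 / real n"
proof -
  have X: "\<forall>\<^sub>F x in at_top. (200 \<le> x \<and> x \<le> exp (\<delta> * x) \<and> 2 \<le> exp (\<delta> * x) \<and> exp (- \<delta> * x) \<le> 1 / 4)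
      \<and> 2 * exp ((1 / 2 + 9 * \<delta>) * x) \<le> exp x
      \<and> x * exp ((1 / 2 + 9 * \<delta>) * x) - exp ((1 / 2 + 19 * \<delta>) * x) / 2 \<le> - x
      \<and> 2 * exp x - exp ((1 + 3 * \<delta>) * x) / 8 \<le> - x
      \<and> 200 * x \<le> exp (x / 2)"
    (is "eventually ?X at_top")
  proof (intro eventually_conj)
    show "\<forall>\<^sub>F x :: real in at_top. 2 * exp ((1 / 2 + 9 * \<delta>) * x) \<le> exp x"
      using d by real_asymp
    show "\<forall>\<^sub>F x in at_top. x * exp ((1 / 2 + 9 * \<delta>) * x) - exp ((1 / 2 + 19 * \<delta>) * x) / 2 \<le> - x"
      using d by real_asymp
    show "\<forall>\<^sub>F x in at_top. 2 * exp x - exp ((1 + 3 * \<delta>) * x) / 8 \<le> - x"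
      using d by real_asymp
    show "\<forall>\<^sub>F x :: real in at_top. 200 * x \<le> exp (x / 2)" by real_asymp
    show "\<forall>\<^sub>F x in at_top. x \<le> exp (\<delta> * x)" using d by real_asymp
    show "\<forall>\<^sub>F x in at_top. 2 \<le> exp (\<delta> * x)" using d by real_asymp
    show "\<forall>\<^sub>F x in at_top. exp (- \<delta> * x) \<le> 1 / 4" using d by real_asymp
  qed (rule eventually_ge_at_top)
  have Lc: "\<forall>\<^sub>F L in at_top. 1 / \<delta>\<^sup>2 \<le> L \<and> 2 * L * (8 * L / \<delta>) * exp (1 - 7 / 200 * L) \<le> 1 / 4"
    (is "eventually ?L at_top")
  proof (intro eventually_conj)
    show "\<forall>\<^sub>F L in at_top. 2 * L * (8 * L / \<delta>) * exp (1 - 7 / 200 * L) \<le> 1 / 4"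
      using d by real_asymp
  qed (rule eventually_ge_at_top)
  have B: "\<forall>\<^sub>F b in at_top. 100 \<le> b \<and> 2 / \<delta> \<le> b" (is "eventually ?B at_top")
    by (intro eventually_conj eventually_ge_at_top)
  have P: "\<forall>\<^sub>F n in sequentially. p n < \<delta> / 2"
    using order_tendstoD(2)[OF p_zero, of "\<delta> / 2"] d by simp
  show ?thesis
    using eventually_compose_filterlim[OF X ln_at_top_seq]
      eventually_compose_filterlim[OF Lc log_ratio_at_top]
      eventually_compose_filterlim[OF B ln_inverse_p_at_top] P eventually_ge_at_top[of 1]
  proof eventually_elim
    case (elim n)
    let ?x = "ln (real n)"
    have pn: "0 < p n" "p n < 1" using p01[of n] elim by auto
    have x0: "0 \<le> ?x" using elim by auto
    have "0 \<le> (1 / 2 - 20 * \<delta>) * ?x / p n"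
      using d x0 pn by (intro divide_nonneg_nonneg mult_nonneg_nonneg) auto
    then have k: "real (nat \<lfloor>(1 / 2 - 20 * \<delta>) * ?x / p n\<rfloor>) \<le> (1 / 2 - 20 * \<delta>) * ?x / p n"
      by simp
    have nx: "real n = exp ?x" and pb: "p n = exp (- (- ln (p n)))"
      and Lb: "?x / - ln (p n) * - ln (p n) = ?x"
      using elim(5) pn by simp_all
    have xs: "200 \<le> ?x" "?x \<le> exp (\<delta> * ?x)" "2 \<le> exp (\<delta> * ?x)" "exp (- \<delta> * ?x) \<le> 1 / 4"
      "2 * exp ((1 / 2 + 9 * \<delta>) * ?x) \<le> exp ?x"
      "?x * exp ((1 / 2 + 9 * \<delta>) * ?x) - exp ((1 / 2 + 19 * \<delta>) * ?x) / 2 \<le> - ?x"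
      "2 * exp ?x - exp ((1 + 3 * \<delta>) * ?x) / 8 \<le> - ?x"
      "200 * ?x \<le> exp (?x / 2)"
      using elim(1) by blast+
    let ?L = "?x / - ln (p n)"
    have L: "1 / \<delta>\<^sup>2 \<le> ?L" "2 * ?L * (8 * ?L / \<delta>) * exp (1 - 7 / 200 * ?L) \<le> 1 / 4"
      using elim(2) by blast+
    have b: "100 \<le> - ln (p n)" "2 / \<delta> \<le> - ln (p n)" using elim(3) by blast+
    have "bprob (p n) (vertex_pairs {1..n})
       (\<lambda>S. \<exists>c. clique_coloring ({1..n}, S) (nat \<lfloor>(1 / 2 - 20 * \<delta>) * ?x / p n\<rfloor>) c) \<le> 4 * exp (- ?x)"
      by (rule coloring_prob_le[OF nx pb less_imp_le[OF elim(4)] d b Lb L k xs])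
    also have "\<dots> = 4 / real n" using elim(5) by (simp add: exp_minus divide_inverse)
    finally show ?case .
  qed
qed

lemma no_coloring_prob_small:
  assumes e: "0 < \<epsilon>" "\<epsilon> \<le> 1 / 2"
  shows "\<forall>\<^sub>F n in sequentially.
     bprob (p n) (vertex_pairs {1..n})
       (\<lambda>S. \<not> (\<exists>c. clique_coloring ({1..n}, S) (nat \<lceil>(1 / 2 + \<epsilon>) * ln (real n) / p n\<rceil> + 2) c)) \<le> 3 / real n"
proof -
  have X: "\<forall>\<^sub>F x in at_top. 1 \<le> x \<and> x\<^sup>2 - exp (\<epsilon> / 2 * x) / 2 \<le> - x \<and> 2 * x \<le> exp x
      \<and> x * exp (x / 16) + 1 \<le> exp (x / 8)" (is "eventually ?X at_top")
  proof (intro eventually_conj)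
    show "\<forall>\<^sub>F x in at_top. x\<^sup>2 - exp (\<epsilon> / 2 * x) / 2 \<le> - x" using e by real_asymp
    show "\<forall>\<^sub>F x :: real in at_top. 2 * x \<le> exp x" by real_asymp
    show "\<forall>\<^sub>F x :: real in at_top. x * exp (x / 16) + 1 \<le> exp (x / 8)" by real_asymp
  qed (rule eventually_ge_at_top)
  have Lc: "\<forall>\<^sub>F L in at_top. 4 / \<epsilon> \<le> L \<and> 16 \<le> L"
    by (intro eventually_conj eventually_ge_at_top)
  show ?thesis
    using eventually_compose_filterlim[OF X ln_at_top_seq]
      eventually_compose_filterlim[OF Lc log_ratio_at_top]
      eventually_compose_filterlim[OF eventually_ge_at_top[of 1] ln_inverse_p_at_top]
      eventually_ge_at_top[of 1]
  proof eventually_elim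
    case (elim n)
    let ?x = "ln (real n)"
    have pn: "0 < p n" "p n < 1" using p01[of n] elim by auto
    have x0: "0 \<le> ?x" using elim by auto
    let ?y = "(1 / 2 + \<epsilon>) * ?x / p n"
    have y: "0 \<le> ?y" "?y \<le> ?x / p n"
    proof -
      show "0 \<le> ?y" using e x0 pn by (intro divide_nonneg_nonneg mult_nonneg_nonneg) auto
      have "(1 / 2 + \<epsilon>) * ?x \<le> 1 * ?x" using e x0 by (intro mult_right_mono) auto
      then show "?y \<le> ?x / p n" using pn by (simp add: divide_right_mono)
    qed
    then have "real (nat \<lceil>?y\<rceil>) = of_int \<lceil>?y\<rceil>" by simp
    then have k: "?y \<le> real (nat \<lceil>?y\<rceil>)" "real (nat \<lceil>?y\<rceil>) \<le> ?x / p n + 1"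
      using ceiling_correct[of ?y] y by linarith+
    have nx: "real n = exp ?x" and pb: "p n = exp (- (- ln (p n)))"
      and Lb: "?x / - ln (p n) * - ln (p n) = ?x"
      using elim(4) pn by simp_all
    have xs: "1 \<le> ?x" "?x\<^sup>2 - exp (\<epsilon> / 2 * ?x) / 2 \<le> - ?x" "2 * ?x \<le> exp ?x"
      "?x * exp (?x / 16) + 1 \<le> exp (?x / 8)"
      using elim(1) by blast+
    have L: "4 / \<epsilon> \<le> ?x / - ln (p n)" "16 \<le> ?x / - ln (p n)" using elim(2) by blast+
    have "bprob (p n) (vertex_pairs {1..n})
       (\<lambda>S. \<not> (\<exists>c. clique_coloring ({1..n}, S) (nat \<lceil>?y\<rceil> + 2) c)) \<le> 3 * exp (- ?x)"
      by (rule no_coloring_prob_le[OF nx pb e elim(3) Lb L k xs])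
    also have "\<dots> = 3 / real n" using elim(4) by (simp add: exp_minus divide_inverse)
    finally show ?case .
  qed
qed

lemma clique_chromatic_number_concentrated:
  assumes e: "0 < e"
  shows "(\<lambda>n. measure_pmf.prob (gnp n (p n))
       {G. \<bar>real (clique_chromatic_number G) * p n / ln (real n) - 1 / 2\<bar> \<le> e}) \<longlonglongrightarrow> 1"
    (is "?f \<longlonglongrightarrow> 1")
proof (rule tendsto_sandwich)
  define \<delta> where "\<delta> = min (1 / 40) (e / 20)"
  define \<epsilon> where "\<epsilon> = min (1 / 2) (e / 2)"
  have d: "0 < \<delta>" "\<delta> \<le> 1 / 40" "20 * \<delta> \<le> e" and ep: "0 < \<epsilon>" "\<epsilon> \<le> 1 / 2" "\<epsilon> \<le> e / 2"
    using e by (auto simp: \<delta>_def \<epsilon>_def)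
  have "\<forall>\<^sub>F x :: real in at_top. 0 < x \<and> 3 / x \<le> e / 2"
    using e by (intro eventually_conj eventually_gt_at_top) real_asymp
  from eventually_compose_filterlim[OF this ln_at_top_seq]
  show "\<forall>\<^sub>F n in sequentially. 1 - 7 / real n \<le> ?f n"
    using coloring_prob_small[OF d(1,2)] no_coloring_prob_small[OF ep(1,2)] eventually_ge_at_top[of 1]
  proof eventually_elim
    case (elim n)
    let ?x = "ln (real n)" and ?A = "vertex_pairs {1..n}"
    let ?k = "nat \<lfloor>(1 / 2 - 20 * \<delta>) * ?x / p n\<rfloor>" and ?l = "nat \<lceil>(1 / 2 + \<epsilon>) * ?x / p n\<rceil>"
    let ?Q = "\<lambda>G. \<bar>real (clique_chromatic_number G) * p n / ?x - 1 / 2\<bar> \<le> e"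
    let ?B1 = "\<lambda>S. \<exists>c. clique_coloring ({1..n}, S) ?k c"
    let ?B2 = "\<lambda>S. \<not> (\<exists>c. clique_coloring ({1..n}, S) (?l + 2) c)"
    have pn: "0 < p n" "p n < 1" using p01[of n] elim by auto
    have x: "0 < ?x" "3 / ?x \<le> e / 2" using elim by auto
    have good: "?Q ({1..n}, S)" if "\<not> ?B1 S" "\<not> ?B2 S" for S
    proof -
      let ?c = "real (clique_chromatic_number ({1..n}, S))"
      have "?k < clique_chromatic_number ({1..n}, S)"
        using that(1) by (intro clique_chromatic_number_gt) auto
      then have "(1 / 2 - 20 * \<delta>) * ?x / p n \<le> ?c" by linarith
      then have lo: "1 / 2 - 20 * \<delta> \<le> ?c * p n / ?x" using pn x by (simp add: field_simps)
      have "clique_chromatic_number ({1..n}, S) \<le> ?l + 2"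
        using that(2) clique_chromatic_number_le by blast
      then have "?c \<le> real ?l + 2" by linarith
      moreover have "0 \<le> (1 / 2 + \<epsilon>) * ?x / p n"
        using ep x pn by (intro divide_nonneg_nonneg mult_nonneg_nonneg) auto
      then have "real ?l \<le> (1 / 2 + \<epsilon>) * ?x / p n + 1"
        using ceiling_correct[of "(1 / 2 + \<epsilon>) * ?x / p n"] by simp
      ultimately have "?c * p n \<le> ((1 / 2 + \<epsilon>) * ?x / p n + 3) * p n"
        using pn by (intro mult_right_mono) auto
      also have "\<dots> = (1 / 2 + \<epsilon>) * ?x + 3 * p n" using pn by (simp add: field_simps)
      also have "\<dots> \<le> (1 / 2 + \<epsilon>) * ?x + 3" using pn by simp
      finally have "?c * p n / ?x \<le> ((1 / 2 + \<epsilon>) * ?x + 3) / ?x" using x by (intro divide_right_mono) auto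
      also have "\<dots> = 1 / 2 + \<epsilon> + 3 / ?x" using x by (simp add: field_simps)
      finally have "?c * p n / ?x \<le> 1 / 2 + e" using x ep by linarith
      with lo d show ?thesis by (simp add: abs_le_iff)
    qed
    have "1 - 7 / real n \<le> 1 - (bprob (p n) ?A ?B1 + bprob (p n) ?A ?B2)"
      using elim by (simp add: field_simps)
    also have "\<dots> \<le> 1 - bprob (p n) ?A (\<lambda>S. ?B1 S \<or> ?B2 S)"
      using bprob_disj[of "p n" ?A ?B1 ?B2] pn by simp
    also have "\<dots> = bprob (p n) ?A (\<lambda>S. \<not> (?B1 S \<or> ?B2 S))"
      by (subst bprob_not) simp_all
    also have "\<dots> \<le> bprob (p n) ?A (\<lambda>S. ?Q ({1..n}, S))"
      using pn good by (intro bprob_mono) auto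
    also have "\<dots> = ?f n"
      using pn gnp_prob[of "p n" n ?Q] by simp
    finally show ?case .
  qed
  show "(\<lambda>n. 1 - 7 / real n) \<longlonglongrightarrow> 1" by real_asymp
qed auto

end

theorem theorem1p2:
  fixes p :: "nat \<Rightarrow> real"
  assumes "\<And>n. n \<ge> 1 \<Longrightarrow> 0 < p n \<and> p n < 1"
    and "\<exists>\<gamma> :: nat \<Rightarrow> real. \<gamma> \<longlonglongrightarrow> 0 \<and> (\<forall>\<^sub>F n in sequentially. p n \<ge> real n powr (- \<gamma> n))"
    and "p \<longlonglongrightarrow> 0"
  shows "\<exists>\<eta> :: nat \<Rightarrow> real. \<eta> \<longlonglongrightarrow> 0 \<and>
    (\<lambda>n. measure_pmf.prob (gnp n (p n))
       {G. \<bar>real (clique_chromatic_number G) * p n / ln (real n) - 1 / 2\<bar> \<le> \<eta> n}) \<longlonglongrightarrow> 1"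
  by (rule diagonal_rate[where f="\<lambda>e n. measure_pmf.prob (gnp n (p n))
       {G. \<bar>real (clique_chromatic_number G) * p n / ln (real n) - 1 / 2\<bar> \<le> e}"])
    (use clique_chromatic_number_concentrated[OF assms] in auto)

end
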